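(* Let $q$ be a prime power and let $V$ be a finite-dimensional $\mathbb F_q$-vector space with a decomposition $$V=W\oplus X_0\oplus X_1\oplus\cdots\oplus X_h,\qquad h\ge1,$$ where $R=\dim V$, $m_i=\dim X_i>0$ for $1\le i\le h$, and $X_0$ may be zero. For $1\le i\le h$ choose arbitrary subspaces $L_i\le W$ (with arbitrary intersections) and vectors $w_i\in W\setminus L_i$, put $\ell_i=\dim L_i$, and set $$C_i=\{\langle w_i+l+x\rangle: l\in L_i,\ x\in X_i\},\quad B=\mathbb P(V)\setminus\mathbb P(W),\quad N_i=B\setminus C_i,\quad N=B\setminus\bigcup_{i=1}^hC_i .$$ Assume that $N$ spans $V$. (1) If $q>2$, then $$Q_N(t)=\sum_{i=1}^hQ_{N_i}(t)-(h-1)Q_B(t).$$ (2) If $q=2$, put $c_{ij}=\dim(L_i\cap L_j)$. Then $$Q_N(t)=\sum_{i=1}^hQ_{N_i}(t)-(h-1)Q_B(t)-\sum_{1\le i<j\le h}(2^{m_i}-1)(2^{m_j}-1)\sum_{\substack{0\le b\le c_{ij}\\ b\text{ even}}}\binom{c_{ij}}{b}_{2}\,2^{\ell_i+\ell_j-2b}\,\tau(A_b)\,u_{R-b-2}\,t^{(b+2)/2}.$$ In particular there are no interactions involving three or more charts, and the contribution of the pair $(i,j)$ is supported in degrees at most $1+\lfloor c_{ij}/2\rfloor$.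
   Context: For a vector space $V$ over $\mathbb F_q$, $\mathbb P(V)$ denotes the set of its projective points (one-dimensional subspaces). A subset $E\subseteq\mathbb P(V)$ is identified with the simple matroid on ground set $E$ represented by it: the rank of a subset is the dimension of its linear span. $E$ spans $V$ if this span is $V$. Notation: $\binom{a}{b}_q$ is the Gaussian binomial coefficient (zero unless $0\le b\le a$). In part (2), $u_a=2^{\binom a2}$ with $u_0=1$; $A_b=\mathrm{AG}(b,2)$ is the binary affine geometry matroid of rank $b+1$ (on the $2^b$ points of affine $b$-space over $\mathbb F_2$). For a matroid $N$ of odd rank, $\tau(N)$ is the coefficient of $t^{(\operatorname{rk}N-1)/2}$ in $P_N$; $\tau(N)=0$ if the rank is even. In particular $\tau(A_0)=1$. Matroid polynomials: for a loopless matroid $M$ of rank $r$, let $L(M)$ be its lattice of flats, $M|F$ the restriction to a flat $F$, $M/F$ the contraction, $\mu$ the Möbius function of $L(M)$, and $\chi_M(t)=\sum_{F\in L(M)}\mu(\varnothing,F)t^{r-\operatorname{rk}F}$. The Kazhdan–Lusztig polynomial $P_M$ is determined by: $P_M=1$ if $r=0$; $\deg P_M<r/2$ if $r>0$; and $t^rP_M(t^{-1})=\sum_{F\in L(M)}\chi_{M|F}(t)P_{M/F}(t)$. The (ordinary, unnormalized) inverse Kazhdan–Lusztig polynomial $Q_M$ is determined by $Q_M=1$ if $r=0$, and for $r>0$, $$Q_M=\sum_{\varnothing\ne F\in L(M)}(-1)^{\operatorname{rk}F+1}P_{M|F}\,Q_{M/F}.$$ *)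

theory Defs
  imports
    "HOL-Computational_Algebra.Polynomial"
    "HOL-Library.Function_Algebras"
    "HOL-Library.FuncSet"
    "HOL-Library.Z2"
    "HOL-Library.Cardinality"
begin

section \<open>Matroids given by their rank function\<close>

datatype 'e matroid_data = Matroid (ground: "'e set") (rk: "'e set \<Rightarrow> nat")

definition matroid :: "'e matroid_data \<Rightarrow> bool" where
  "matroid M \<longleftrightarrow> finite (ground M) \<and>
     (\<forall>S\<subseteq>ground M. rk M S \<le> card S) \<and>
     (\<forall>S T. S \<subseteq> T \<and> T \<subseteq> ground M \<longrightarrow> rk M S \<le> rk M T) \<and>
     (\<forall>S T. S \<subseteq> ground M \<and> T \<subseteq> ground M \<longrightarrow>
        rk M (S \<union> T) + rk M (S \<inter> T) \<le> rk M S + rk M T)"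

definition matroid_rank :: "'e matroid_data \<Rightarrow> nat" where
  "matroid_rank M = rk M (ground M)"

definition flats :: "'e matroid_data \<Rightarrow> 'e set set" where
  "flats M = {F. F \<subseteq> ground M \<and> (\<forall>x\<in>ground M - F. rk M F < rk M (insert x F))}"

definition restrict_to :: "'e matroid_data \<Rightarrow> 'e set \<Rightarrow> 'e matroid_data" where
  "restrict_to M F = Matroid F (rk M)"

definition contract :: "'e matroid_data \<Rightarrow> 'e set \<Rightarrow> 'e matroid_data" where
  "contract M F = Matroid (ground M - F) (\<lambda>S. rk M (S \<union> F) - rk M F)"


section \<open>Characteristic and Kazhdan--Lusztig polynomials\<close>

text \<open>The Moebius function of a family \<open>L\<close> of sets ordered by inclusion. The finiteness
  condition only serves termination.\<close>

function moebius :: "'e set set \<Rightarrow> 'e set \<Rightarrow> 'e set \<Rightarrow> int" where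
  "moebius L X Y =
     (if X = Y then 1
      else if X \<subset> Y \<and> finite Y then - (\<Sum>Z\<in>{Z\<in>L. X \<subseteq> Z \<and> Z \<subset> Y}. moebius L X Z)
      else 0)"
  by auto
termination
  by (relation "Wellfounded.measure (\<lambda>(L, X, Y). card Y)") (auto intro: psubset_card_mono)

declare moebius.simps [simp del]

definition matroid_char_poly :: "'e matroid_data \<Rightarrow> int poly" where
  "matroid_char_poly M = (\<Sum>F\<in>flats M. monom (moebius (flats M) {} F) (matroid_rank M - rk M F))"

text \<open>For \<open>degree p \<le> r\<close> this is \<open>t^r p(1/t)\<close>, because \<^const>\<open>reflect_poly\<close> gives
  \<open>t^(degree p) p(1/t)\<close>.\<close>

definition reverse_poly :: "nat \<Rightarrow> int poly \<Rightarrow> int poly" where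
  "reverse_poly r p = monom 1 (r - degree p) * reflect_poly p"

text \<open>The term for \<open>F = {}\<close> contains the polynomial of \<open>M/{} = M\<close> itself, that is, the unknown
  \<open>p\<close>. By the degree bound, at most one \<open>p\<close> satisfies the condition when \<open>M\<close> is loopless.
  Only matroids with a finite ground set are of interest.\<close>

function KL_poly :: "'e matroid_data \<Rightarrow> int poly" where
  "KL_poly M =
     (if finite (ground M) \<and> 0 < matroid_rank M
      then THE p. 2 * degree p < matroid_rank M \<and>
             reverse_poly (matroid_rank M) p =
               (\<Sum>F\<in>flats M. matroid_char_poly (restrict_to M F) *
                  (if F = {} then p else KL_poly (contract M F)))
      else 1)"
  by auto
termination
  by (relation "Wellfounded.measure (\<lambda>M. card (ground M))")
    (auto simp: flats_def contract_def intro!: psubset_card_mono)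

declare KL_poly.simps [simp del]

function inv_KL_poly :: "'e matroid_data \<Rightarrow> int poly" where
  "inv_KL_poly M =
     (if finite (ground M) \<and> 0 < matroid_rank M
      then \<Sum>F\<in>flats M - {{}}. (- 1) ^ (rk M F + 1) *
             KL_poly (restrict_to M F) * inv_KL_poly (contract M F)
      else 1)"
  by auto
termination
  by (relation "Wellfounded.measure (\<lambda>M. card (ground M))")
    (auto simp: flats_def contract_def intro!: psubset_card_mono)

declare inv_KL_poly.simps [simp del]

definition tau :: "'e matroid_data \<Rightarrow> int" where
  "tau M = (if odd (matroid_rank M) then coeff (KL_poly M) ((matroid_rank M - 1) div 2) else 0)"


section \<open>Projective points and represented matroids\<close>

definition proj_points :: "('a::field \<Rightarrow> 'v::ab_group_add \<Rightarrow> 'v) \<Rightarrow> 'v set \<Rightarrow> 'v set set" where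
  "proj_points scale U = {module.span scale {v} | v. v \<in> U \<and> v \<noteq> 0}"

text \<open>A set of projective points is a set of subspaces; its linear span is the span of
  their union.\<close>

definition proj_span :: "('a::field \<Rightarrow> 'v::ab_group_add \<Rightarrow> 'v) \<Rightarrow> 'v set set \<Rightarrow> 'v set" where
  "proj_span scale E = module.span scale (\<Union>E)"

definition proj_matroid ::
    "('a::field \<Rightarrow> 'v::ab_group_add \<Rightarrow> 'v) \<Rightarrow> 'v set set \<Rightarrow> 'v set matroid_data" where
  "proj_matroid scale E = Matroid E (\<lambda>S. vector_space.dim scale (proj_span scale S))"

lemma (in finite_dimensional_vector_space) matroid_proj_matroid:
  assumes "finite (UNIV :: 'b set)" and E: "E \<subseteq> proj_points scale UNIV"
  shows "matroid (proj_matroid scale E)"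
proof -
  have fin: "finite S" for S :: "'b set set"
    using assms(1) by (metis Finite_Set.finite_set finite_subset subset_UNIV)
  have card: "dim (span (\<Union>S)) \<le> card S" if "S \<subseteq> E" for S
  proof -
    have "\<forall>p\<in>S. \<exists>v. p = span {v}"
      using that E by (auto simp: proj_points_def)
    then obtain g where g: "\<And>p. p \<in> S \<Longrightarrow> p = span {g p}" by metis
    have "\<Union>S \<subseteq> span (g ` S)"
    proof
      fix x assume "x \<in> \<Union>S"
      then obtain p where "p \<in> S" "x \<in> p" by auto
      then have "x \<in> span {g p}" using g by metis
      also have "span {g p} \<subseteq> span (g ` S)" using \<open>p \<in> S\<close> by (intro span_mono) auto
      finally show "x \<in> span (g ` S)" .
    qed
    then have "dim (\<Union>S) \<le> card (g ` S)"
      using fin[of S] by (intro dim_le_card) auto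
    also have "\<dots> \<le> card S" using fin by (rule card_image_le)
    finally show ?thesis by simp
  qed
  have submod: "dim (span (\<Union>(S \<union> T))) + dim (span (\<Union>(S \<inter> T)))
      \<le> dim (span (\<Union>S)) + dim (span (\<Union>T))" for S T :: "'b set set"
  proof -
    have "span (\<Union>(S \<union> T)) = {x + y |x y. x \<in> span (\<Union>S) \<and> y \<in> span (\<Union>T)}"
      by (simp add: span_Un)
    moreover have "dim (span (\<Union>(S \<inter> T))) \<le> dim (span (\<Union>S) \<inter> span (\<Union>T))"
      by (intro dim_subset Int_greatest span_mono Union_mono Int_lower1 Int_lower2)
    ultimately show ?thesis
      using dim_sums_Int[OF subspace_span subspace_span, of "\<Union>S" "\<Union>T"] by simp
  qed
  show ?thesis
    unfolding matroid_def proj_matroid_def proj_span_def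
    using fin card submod by (auto intro!: dim_subset span_mono)
qed

lemma (in vector_space) simple_proj_matroid:
  assumes "p \<in> proj_points scale UNIV" "p' \<in> proj_points scale UNIV" "p \<noteq> p'"
  shows "rk (proj_matroid scale E) {p} = 1" "rk (proj_matroid scale E) {p, p'} = 2"
proof -
  obtain v v' where v: "p = span {v}" "v \<noteq> 0" "p' = span {v'}" "v' \<noteq> 0"
    using assms by (auto simp: proj_points_def)
  have "v \<notin> span {v'}"
  proof
    assume "v \<in> span {v'}"
    then obtain k where k: "v = scale k v'" by (auto simp: span_singleton)
    with v have "k \<noteq> 0" by auto
    then have "v' = scale (1 / k) v" by (simp add: k)
    then have "v' \<in> span {v}" by (metis span_base span_scale singletonI)
    with \<open>v \<in> span {v'}\<close> have "span {v} = span {v'}"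
      by (intro subset_antisym span_minimal subspace_span) auto
    with v assms show False by simp
  qed
  then have "independent {v, v'}" "v \<noteq> v'"
    using v by (auto simp: independent_insert span_base)
  then have "dim {v, v'} = 2" by (simp add: dim_eq_card_independent)
  moreover have "span (span {v} \<union> span {v'}) = span {v, v'}"
  proof (rule span_eq[THEN iffD2], intro conjI)
    have "span {v} \<subseteq> span {v, v'}" "span {v'} \<subseteq> span {v, v'}"
      by (intro span_mono; simp)+
    then show "span {v} \<union> span {v'} \<subseteq> span {v, v'}" by blast
    show "{v, v'} \<subseteq> span (span {v} \<union> span {v'})"
      using span_superset[of "span {v} \<union> span {v'}"] span_base[of v "{v}"] span_base[of v' "{v'}"]
      by blast
  qed
  ultimately show "rk (proj_matroid scale E) {p, p'} = 2"
    by (simp add: proj_matroid_def proj_span_def v del: dim_span)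
       (metis dim_span)
  show "rk (proj_matroid scale E) {p} = 1"
    using v by (simp add: proj_matroid_def proj_span_def dim_eq_card_independent)
qed

text \<open>\<open>V = \<Oplus>i\<in>I. U i\<close>, where \<open>V\<close> is the whole type.\<close>

definition direct_sum ::
    "('a::field \<Rightarrow> 'v::ab_group_add \<Rightarrow> 'v) \<Rightarrow> 'i set \<Rightarrow> ('i \<Rightarrow> 'v set) \<Rightarrow> bool" where
  "direct_sum scale I U \<longleftrightarrow>
     (\<forall>i\<in>I. module.subspace scale (U i)) \<and>
     (\<forall>v. \<exists>!u. u \<in> (\<Pi>\<^sub>E i\<in>I. U i) \<and> v = (\<Sum>i\<in>I. u i))"

text \<open>The binary affine geometry \<open>AG(b,2)\<close>. A point \<open>a\<close> of affine \<open>b\<close>-space is a sequence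
  supported on \<open>{..<b}\<close>; affine dependence of points is linear dependence of the
  vectors \<open>(1, a)\<close>.\<close>

definition binary_affine_geometry :: "nat \<Rightarrow> (nat \<Rightarrow> bit) matroid_data" where
  "binary_affine_geometry b =
     Matroid {a. \<forall>i\<ge>b. a i = 0}
       (\<lambda>S. vector_space.dim (\<lambda>c f i. c * f i) (case_nat 1 ` S))"


section \<open>Numerical coefficients\<close>

definition gauss_binomial :: "nat \<Rightarrow> nat \<Rightarrow> nat \<Rightarrow> nat" where
  "gauss_binomial q a b =
     (if b \<le> a then (\<Prod>i<b. q ^ (a - i) - 1) div (\<Prod>i<b. q ^ (i + 1) - 1) else 0)"

definition u_coeff :: "nat \<Rightarrow> int" where
  "u_coeff a = 2 ^ (a choose 2)"

end

theory Submission
  imports Defs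
begin

text \<open>
  The defining equation of the Kazhdan--Lusztig polynomials is equivalent to the palindromicity of
  \<open>\<Sum>F. t^(rk F) P(M/F)\<close> for all upper intervals. Palindromicity is preserved when functions on the
  lattice of all subspaces are pushed forward along \<open>U \<mapsto> span (E \<inter> U)\<close> to the lattice of flats of a
  set of points \<open>E\<close>, with weight \<open>t^(dim U - dim (span (E \<inter> U)))\<close>: a combinatorial form of the
  decomposition theorem. Expand the push-forward of the function that is 1 on the subspaces of \<open>F\<close> in
  terms of the Kazhdan--Lusztig basis and let \<open>c F\<close> be the coefficient of the function supported at the
  zero subspace. Moebius inversion gives
  \<open>Q E = \<Sum>F. (-1)^(dim F) q^(codim F choose 2) c F\<close>.

  The polynomial \<open>c F\<close> is palindromic of weight \<open>dim F\<close>, so only its coefficients from the middle on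
  matter. If \<open>span (E \<inter> U)\<close> is zero or of codimension at most one in \<open>U\<close> for all \<open>U\<close>, they are those of
  \<open>\<Sum>U. t^(dim U)\<close> over the \<open>U \<subseteq> F\<close> without points of \<open>E\<close>, up to a correction of the middle coefficient
  when \<open>span (E \<inter> F)\<close> is a hyperplane \<open>H\<close> of \<open>F\<close>; the correction is \<open>\<tau>\<close> of \<open>E \<inter> H\<close>.

  For complements of charts a subspace without points of \<open>E\<close> outside \<open>W\<close> meets only one chart, since
  the sum of points of two different charts lies in no chart. Hence the sums are additive in the
  charts. The corrections come from subspaces \<open>F\<close> all of whose points outside \<open>H\<close> and \<open>W\<close> lie in
  charts; these points lie in a single chart or, for \<open>q = 2\<close> only, in exactly two, in which case \<open>F\<close>
  is spanned by a subspace of \<open>L\<^sub>i \<inter> L\<^sub>j\<close> and one point of either chart, and \<open>E \<inter> H\<close> is an affine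
  geometry.
\<close>

section \<open>Palindromic polynomials\<close>

text \<open>A hyperplane \<open>H = span (E \<inter> F)\<close> of \<open>F\<close> carries the
  coefficient 1 + t, and t times the polynomial of \<open>E \<inter> H\<close> reaches degree dim F
  / 2 only through the top coefficient that its degree bound allows. This is why just \<tau>
  survives, and only for even dim F. Corrections from a single chart agree for N and N_i, because
  the hyperplane H and its point set H - W are the same for both. Pairs force q = 2: for points a, b
  of two charts and d nonzero, both a + b and a + d b lie in H, so H contains (d - 1) b but not b.
  The constants of the pair term count the F with dim F = b + 2. The intersection of F and W is any
  b-dimensional subspace of the intersection of L_i and L_j; there are 2^l_i (2^m_i - 1) points of
  C_i outside W, and each F arises from 2^b of them in either chart, whence the power 2^(l_i + l_j -
  2b). The factor u_(R-b-2) is the absolute Moebius value between F and V, and (b+2)/2 is the middle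
  degree of F.\<close>

lemma coeff_reverse_poly:
  assumes "degree p \<le> n"
  shows "coeff (reverse_poly n p) i = (if i \<le> n then coeff p (n - i) else 0)"
proof -
  have "coeff (reverse_poly n p) i
      = (if i < n - degree p then 0 else coeff (reflect_poly p) (i - (n - degree p)))"
    unfolding reverse_poly_def by (simp add: coeff_monom_mult)
  also have "\<dots> = (if i \<le> n then coeff p (n - i) else 0)"
  proof (cases "i < n - degree p")
    case True
    then show ?thesis by (auto intro!: coeff_eq_0)
  next
    case False
    then have "degree p < i - (n - degree p) \<longleftrightarrow> n < i"
      "\<not> n < i \<Longrightarrow> degree p - (i - (n - degree p)) = n - i"
      using assms by linarith+
    with False show ?thesis by (auto simp: coeff_reflect_poly)
  qed
  finally show ?thesis .
qed

lemma reverse_poly_0 [simp]: "reverse_poly n 0 = 0"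
  by (simp add: reverse_poly_def)

lemma reverse_poly_add:
  assumes "degree p \<le> n" "degree q \<le> n"
  shows "reverse_poly n (p + q) = reverse_poly n p + reverse_poly n q"
  using assms degree_add_le[OF assms] by (intro poly_eqI) (simp add: coeff_reverse_poly)

lemma reverse_poly_diff:
  assumes "degree p \<le> n" "degree q \<le> n"
  shows "reverse_poly n (p - q) = reverse_poly n p - reverse_poly n q"
  using assms degree_diff_le[OF assms] by (intro poly_eqI) (simp add: coeff_reverse_poly)

lemma reverse_poly_sum:
  assumes "\<And>x. x \<in> A \<Longrightarrow> degree (f x) \<le> n"
  shows "reverse_poly n (sum f A) = (\<Sum>x\<in>A. reverse_poly n (f x))"
  using assms
proof (induction A rule: infinite_finite_induct)
  case (insert x A)
  then show ?case by (simp add: reverse_poly_add degree_sum_le)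
qed auto

lemma reverse_poly_mult:
  assumes "degree p \<le> m" "degree q \<le> n"
  shows "reverse_poly (m + n) (p * q) = reverse_poly m p * reverse_poly n q"
proof (cases "p = 0 \<or> q = 0")
  case False
  then have "degree (p * q) = degree p + degree q" by (simp add: degree_mult_eq)
  then have "monom 1 (m + n - degree (p * q)) = monom (1::int) (m - degree p) * monom 1 (n - degree q)"
    using assms by (simp add: mult_monom)
  then show ?thesis
    by (simp add: reverse_poly_def reflect_poly_mult mult_ac)
qed auto

lemma reverse_poly_monom [simp]: "reverse_poly n (monom 1 n) = 1"
  by (rule poly_eqI) (auto simp: coeff_reverse_poly degree_monom_eq split: if_splits)

definition palindromic :: "nat \<Rightarrow> int poly \<Rightarrow> bool" where
  "palindromic n p \<longleftrightarrow> degree p \<le> n \<and> reverse_poly n p = p"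

lemma palindromic_iff:
  "palindromic n p \<longleftrightarrow> (\<forall>i. coeff p i = (if i \<le> n then coeff p (n - i) else 0))"
proof
  assume p: "palindromic n p"
  show "\<forall>i. coeff p i = (if i \<le> n then coeff p (n - i) else 0)"
  proof
    fix i
    have "coeff p i = coeff (reverse_poly n p) i" using p by (simp add: palindromic_def)
    also have "\<dots> = (if i \<le> n then coeff p (n - i) else 0)"
      using p by (intro coeff_reverse_poly) (simp add: palindromic_def)
    finally show "coeff p i = (if i \<le> n then coeff p (n - i) else 0)" .
  qed
next
  assume p: "\<forall>i. coeff p i = (if i \<le> n then coeff p (n - i) else 0)"
  then have "degree p \<le> n" by (metis degree_le not_le)
  moreover from this have "reverse_poly n p = p"
    using p by (intro poly_eqI) (simp add: coeff_reverse_poly)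
  ultimately show "palindromic n p" by (simp add: palindromic_def)
qed

lemma palindromic_coeff: "palindromic n p \<Longrightarrow> i \<le> n \<Longrightarrow> coeff p i = coeff p (n - i)"
  unfolding palindromic_iff by metis

lemma palindromic_0 [simp]: "palindromic n 0"
  by (simp add: palindromic_iff)

lemma palindromic_add: "palindromic n p \<Longrightarrow> palindromic n q \<Longrightarrow> palindromic n (p + q)"
  by (simp add: palindromic_def reverse_poly_add degree_add_le)

lemma palindromic_diff: "palindromic n p \<Longrightarrow> palindromic n q \<Longrightarrow> palindromic n (p - q)"
  by (simp add: palindromic_def reverse_poly_diff degree_diff_le)

lemma palindromic_sum: "(\<And>x. x \<in> A \<Longrightarrow> palindromic n (f x)) \<Longrightarrow> palindromic n (sum f A)"
  by (induction A rule: infinite_finite_induct) (auto intro: palindromic_add)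

lemma palindromic_mult:
  assumes "palindromic m p" "palindromic n q"
  shows "palindromic (m + n) (p * q)"
proof -
  have "degree p \<le> m" "degree q \<le> n" using assms by (auto simp: palindromic_def)
  moreover from this have "degree (p * q) \<le> m + n"
    by (meson add_mono degree_mult_le le_trans)
  ultimately show ?thesis using assms by (simp add: palindromic_def reverse_poly_mult)
qed

text \<open>Symmetry about n/2 carries the vanishing of the upper half over to the lower half.
  Identities between palindromic polynomials therefore need checking only in degrees i with n \<le>
  2i.\<close>

lemma palindromic_eq_0:
  assumes "palindromic n p" "\<And>i. n \<le> 2 * i \<Longrightarrow> coeff p i = 0"
  shows "p = 0"
proof (rule poly_eqI)
  fix i
  show "coeff p i = coeff 0 i"
  proof (cases "n \<le> 2 * i")
    case False
    then have "coeff p i = coeff p (n - i)" using assms(1) by (intro palindromic_coeff) auto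
    also have "\<dots> = 0" using False by (intro assms(2)) auto
    finally show ?thesis by simp
  qed (simp add: assms(2))
qed

lemma palindromic_small_eq_0:
  assumes "palindromic n p" "2 * degree p < n"
  shows "p = 0"
  using assms by (intro palindromic_eq_0[OF assms(1)] coeff_eq_0) auto

text \<open>Below the middle, p adds to z what its mirror coefficient has in excess; from the middle
  on nothing is changed. This is the existence half of the construction of Kazhdan--Lusztig
  polynomials.\<close>

lemma palindromic_completion:
  assumes "degree z \<le> n" "0 < n"
  shows "\<exists>p. 2 * degree p < n \<and> palindromic n (p + z)"
proof -
  define p where "p = (\<Sum>i | 2 * i < n. monom (coeff z (n - i) - coeff z i) i)"
  have fin: "finite {i. 2 * i < n}" by (rule finite_subset[of _ "{..n}"]) auto
  have p: "coeff p i = (if 2 * i < n then coeff z (n - i) - coeff z i else 0)" for i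
    using fin by (simp add: p_def coeff_sum coeff_monom sum.delta)
  have "2 * degree p < n"
  proof (cases "p = 0")
    case False
    then have "coeff p (degree p) \<noteq> 0" by simp
    with p[of "degree p"] show ?thesis by presburger
  qed (use assms in simp)
  moreover have "palindromic n (p + z)"
    unfolding palindromic_iff
  proof
    fix i
    show "coeff (p + z) i = (if i \<le> n then coeff (p + z) (n - i) else 0)"
    proof (cases "i \<le> n")
      case True
      then have eq: "n - (n - i) = i" by simp
      consider "2 * i < n" "\<not> 2 * (n - i) < n" | "\<not> 2 * i < n" "2 * (n - i) < n"
        | "n - i = i" using True by linarith
      then show ?thesis using True by cases (simp_all only: coeff_add p eq if_True if_False)
    next
      case False
      then show ?thesis using assms by (simp add: p coeff_eq_0)
    qed
  qed
  ultimately show ?thesis by blast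
qed

lemma minus_one_poly_power: "(- 1 :: int poly) ^ n = [:(- 1) ^ n:]"
  by (induction n) (simp_all add: one_pCons)

section \<open>Intervals in the lattice of flats\<close>

lemma matroid_rk_mono: "matroid M \<Longrightarrow> S \<subseteq> T \<Longrightarrow> T \<subseteq> ground M \<Longrightarrow> rk M S \<le> rk M T"
  unfolding matroid_def by blast

lemma matroid_rk_le_card: "matroid M \<Longrightarrow> S \<subseteq> ground M \<Longrightarrow> rk M S \<le> card S"
  by (simp add: matroid_def)

lemma matroid_finite: "matroid M \<Longrightarrow> finite (ground M)"
  by (simp add: matroid_def)

lemma matroid_submod: "matroid M \<Longrightarrow> S \<subseteq> ground M \<Longrightarrow> T \<subseteq> ground M \<Longrightarrow>
    rk M (S \<union> T) + rk M (S \<inter> T) \<le> rk M S + rk M T"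
  unfolding matroid_def by blast

lemma matroid_rk_empty: "matroid M \<Longrightarrow> rk M {} = 0"
  unfolding matroid_def by (metis card.empty empty_subsetI le_zero_eq)

lemma flats_subset: "F \<in> flats M \<Longrightarrow> F \<subseteq> ground M"
  by (simp add: flats_def)

lemma finite_flats: "matroid M \<Longrightarrow> finite (flats M)"
  by (rule finite_subset[of _ "Pow (ground M)"]) (auto simp: flats_def matroid_def)

lemma flats_rk_less:
  assumes "matroid M" "F \<in> flats M" "F \<subset> G" "G \<subseteq> ground M"
  shows "rk M F < rk M G"
proof -
  obtain x where x: "x \<in> G - F" using assms by blast
  then have "rk M F < rk M (insert x F)" using assms by (auto simp: flats_def)
  also have "\<dots> \<le> rk M G" using assms x by (intro matroid_rk_mono) auto
  finally show ?thesis .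
qed

lemma ground_contract [simp]: "ground (contract M F) = ground M - F"
  and rk_contract [simp]: "rk (contract M F) S = rk M (S \<union> F) - rk M F"
  and ground_restrict_to [simp]: "ground (restrict_to M F) = F"
  and rk_restrict_to [simp]: "rk (restrict_to M F) = rk M"
  by (simp_all add: contract_def restrict_to_def)

lemma matroid_restrict_to: "matroid M \<Longrightarrow> F \<subseteq> ground M \<Longrightarrow> matroid (restrict_to M F)"
  unfolding matroid_def ground_restrict_to rk_restrict_to
  by (meson finite_subset subset_trans)

lemma matroid_contract:
  assumes M: "matroid M" and F: "F \<subseteq> ground M"
  shows "matroid (contract M F)"
proof -
  have mono: "rk M F \<le> rk M (S \<union> F)" if "S \<subseteq> ground M - F" for S
    using that F by (intro matroid_rk_mono[OF M]) auto
  have "rk M (S \<union> F) - rk M F \<le> card S" if "S \<subseteq> ground M - F" for S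
  proof -
    have "rk M (S \<union> F) \<le> rk M S + rk M F" using matroid_submod[OF M, of S F] that F by fastforce
    moreover have "rk M S \<le> card S" using that by (intro matroid_rk_le_card[OF M]) auto
    ultimately show ?thesis by linarith
  qed
  moreover have "rk M (S \<union> F) - rk M F \<le> rk M (T \<union> F) - rk M F"
    if "S \<subseteq> T" "T \<subseteq> ground M - F" for S T
    using that F by (intro diff_le_mono matroid_rk_mono[OF M]) auto
  moreover have "rk M (S \<union> T \<union> F) - rk M F + (rk M (S \<inter> T \<union> F) - rk M F)
      \<le> rk M (S \<union> F) - rk M F + (rk M (T \<union> F) - rk M F)"
    if "S \<subseteq> ground M - F" "T \<subseteq> ground M - F" for S T
  proof -
    have "S \<union> F \<union> (T \<union> F) = S \<union> T \<union> F" "(S \<union> F) \<inter> (T \<union> F) = S \<inter> T \<union> F" by auto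
    with matroid_submod[OF M, of "S \<union> F" "T \<union> F"] mono[of S] mono[of T] mono[of "S \<inter> T"]
      mono[of "S \<union> T"] that F
    have "rk M (S \<union> T \<union> F) + rk M (S \<inter> T \<union> F) \<le> rk M (S \<union> F) + rk M (T \<union> F)"
      "rk M F \<le> rk M (S \<union> F)" "rk M F \<le> rk M (T \<union> F)" "rk M F \<le> rk M (S \<inter> T \<union> F)"
      "rk M F \<le> rk M (S \<union> T \<union> F)"
      by auto
    then show ?thesis by linarith
  qed
  ultimately show ?thesis
    unfolding matroid_def using matroid_finite[OF M] by (auto simp: Un_commute)
qed

lemma matroid_rank_contract:
  "F \<subseteq> ground M \<Longrightarrow> matroid_rank (contract M F) = matroid_rank M - rk M F"
  by (simp add: matroid_rank_def Un_absorb2)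

lemma contract_empty:
  assumes "matroid M" shows "contract M {} = M"
  using matroid_rk_empty[OF assms] by (cases M) (simp add: contract_def)

lemma contract_contract:
  assumes "matroid M" "F \<subseteq> G" "G \<subseteq> ground M"
  shows "contract (contract M F) (G - F) = contract M G"
proof -
  have "rk M F \<le> rk M G" using assms by (intro matroid_rk_mono)
  moreover have "S \<union> (G - F) \<union> F = S \<union> G" "G - F \<union> F = G" for S using assms by auto
  ultimately show ?thesis using assms by (auto simp: contract_def)
qed

lemma flats_contract:
  assumes M: "matroid M" and F: "F \<subseteq> ground M"
  shows "flats (contract M F) = (\<lambda>G. G - F) ` {G \<in> flats M. F \<subseteq> G}"
proof -
  have iff: "S \<in> flats (contract M F) \<longleftrightarrow> S \<union> F \<in> flats M" if S: "S \<subseteq> ground M - F" for S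
  proof -
    have le: "rk M F \<le> rk M (S \<union> F)" using that F by (intro matroid_rk_mono[OF M]) auto
    then have "rk M (S \<union> F) - rk M F < rk M (insert x S \<union> F) - rk M F
        \<longleftrightarrow> rk M (S \<union> F) < rk M (insert x (S \<union> F))" for x
      by auto
    moreover have "ground M - F - S = ground M - (S \<union> F)" by auto
    moreover have "S \<subseteq> ground M" using S by auto
    ultimately show ?thesis using that F unfolding flats_def by simp
  qed
  show ?thesis
  proof (intro set_eqI iffI)
    fix S assume S: "S \<in> flats (contract M F)"
    then have "S \<subseteq> ground M - F" using flats_subset by fastforce
    with iff S have "S \<union> F \<in> flats M" "S = S \<union> F - F" by auto
    then show "S \<in> (\<lambda>G. G - F) ` {G \<in> flats M. F \<subseteq> G}" by blast
  next
    fix S assume "S \<in> (\<lambda>G. G - F) ` {G \<in> flats M. F \<subseteq> G}"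
    then obtain G where G: "G \<in> flats M" "F \<subseteq> G" "S = G - F" by auto
    moreover from this have "S \<subseteq> ground M - F" "S \<union> F = G" using flats_subset by fastforce+
    ultimately show "S \<in> flats (contract M F)" using iff by simp
  qed
qed

lemma flats_restrict_to:
  assumes M: "matroid M" and G: "G \<in> flats M"
  shows "flats (restrict_to M G) = {F \<in> flats M. F \<subseteq> G}"
proof (intro set_eqI iffI)
  fix F assume F: "F \<in> flats (restrict_to M G)"
  then have FG: "F \<subseteq> G" using flats_subset by fastforce
  have "rk M F < rk M (insert x F)" if x: "x \<in> ground M - F" for x
  proof (cases "x \<in> G")
    case True
    then show ?thesis using F x by (auto simp: flats_def)
  next
    case False
    then have "insert x F \<union> G = insert x G" "insert x F \<inter> G = F" using FG by auto
    \<comment> \<open>Submodularity passes the strict rank increase caused by x from G down to the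
      smaller set F.\<close>
    moreover have "rk M (insert x F \<union> G) + rk M (insert x F \<inter> G) \<le> rk M (insert x F) + rk M G"
      using x FG flats_subset[OF G] by (intro matroid_submod[OF M]) auto
    moreover have "rk M G < rk M (insert x G)" using G False x by (auto simp: flats_def)
    ultimately show ?thesis by simp
  qed
  with FG flats_subset[OF G] show "F \<in> {F \<in> flats M. F \<subseteq> G}" by (auto simp: flats_def)
next
  fix F assume "F \<in> {F \<in> flats M. F \<subseteq> G}"
  then show "F \<in> flats (restrict_to M G)" using flats_subset[OF G] by (auto simp: flats_def)
qed

text \<open>Looplessness is expressed throughout as the empty set being a flat. Contracting a flat
  preserves it, so inductions can pass to contractions.\<close>

lemma loopless_contract:
  assumes "matroid M" "F \<in> flats M" shows "{} \<in> flats (contract M F)"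
  using assms flats_subset[OF assms(2)] by (subst flats_contract) auto

lemma inj_on_Diff_superset: "inj_on (\<lambda>G. G - F) {G \<in> L. F \<subseteq> G}"
  by (rule inj_onI) (metis Diff_partition mem_Collect_eq)

text \<open>The recursion for \<open>moebius L X Y\<close> visits only members of L below Y. Hence
  the Moebius function of a restriction to a flat is that of the whole lattice.\<close>

lemma moebius_down_closed:
  assumes "\<And>Z. Z \<in> L \<Longrightarrow> Z \<subseteq> Y \<Longrightarrow> Z \<in> L'" "\<And>Z. Z \<in> L' \<Longrightarrow> Z \<subseteq> Y \<Longrightarrow> Z \<in> L"
    and "finite Y"
  shows "moebius L X Y = moebius L' X Y"
  using assms(3,1,2)
proof (induction Y rule: finite_psubset_induct)
  case (psubset Y)
  have eq: "{Z \<in> L. X \<subseteq> Z \<and> Z \<subset> Y} = {Z \<in> L'. X \<subseteq> Z \<and> Z \<subset> Y}" using psubset.prems by blast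
  have "moebius L X Z = moebius L' X Z" if "Z \<subset> Y" for Z
    using that psubset.prems by (intro psubset.IH) (auto dest: psubset_imp_subset)
  then have "(\<Sum>Z\<in>{Z \<in> L. X \<subseteq> Z \<and> Z \<subset> Y}. moebius L X Z)
      = (\<Sum>Z\<in>{Z \<in> L'. X \<subseteq> Z \<and> Z \<subset> Y}. moebius L' X Z)"
    unfolding eq by (intro sum.cong) auto
  then show ?case by (simp add: moebius.simps[of L X Y] moebius.simps[of L' X Y])
qed

lemma sum_moebius:
  assumes "finite L" "finite Y" "X \<in> L" "Y \<in> L" "X \<subseteq> Y"
  shows "(\<Sum>Z\<in>{Z \<in> L. X \<subseteq> Z \<and> Z \<subseteq> Y}. moebius L X Z) = (if X = Y then 1 else 0)"
proof (cases "X = Y")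
  case True
  then have "{Z \<in> L. X \<subseteq> Z \<and> Z \<subseteq> Y} = {X}" using assms by auto
  then show ?thesis using True by (simp add: moebius.simps)
next
  case False
  then have "{Z \<in> L. X \<subseteq> Z \<and> Z \<subseteq> Y} = insert Y {Z \<in> L. X \<subseteq> Z \<and> Z \<subset> Y}"
    using assms by auto
  then show ?thesis using False assms
    by (simp add: moebius.simps[of L X Y] psubset_eq)
qed

section \<open>Palindromicity of the Z-polynomial\<close>

lemma smult_sum_right: "smult c (sum f A) = (\<Sum>x\<in>A. smult c (f x))"
  by (induction A rule: infinite_finite_induct) (simp_all add: smult_add_right)

lemma sum_swap_below:
  assumes "finite A"
  shows "(\<Sum>x\<in>A. \<Sum>y\<in>{y \<in> A. R y x}. f x y) = (\<Sum>y\<in>A. \<Sum>x\<in>{x \<in> A. R y x}. f x y)"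
proof -
  have "(\<Sum>x\<in>A. \<Sum>y\<in>{y \<in> A. R y x}. f x y) = (\<Sum>x\<in>A. \<Sum>y\<in>A. if R y x then f x y else 0)"
    using assms by (simp add: sum.inter_filter)
  also have "\<dots> = (\<Sum>y\<in>A. \<Sum>x\<in>A. if R y x then f x y else 0)" by (rule sum.swap)
  also have "\<dots> = (\<Sum>y\<in>A. \<Sum>x\<in>{x \<in> A. R y x}. f x y)"
    using assms by (simp add: sum.inter_filter)
  finally show ?thesis .
qed

text \<open>Moebius inversion turns the defining equation of the Kazhdan--Lusztig polynomials into
  palindromicity of the sums over all upper intervals.\<close>

lemma reverse_eq_char_poly_sum:
  assumes M: "matroid M" and loopless: "{} \<in> flats M"
    and deg: "\<And>F. F \<in> flats M \<Longrightarrow> degree (R F) \<le> matroid_rank M - rk M F"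
    and pal: "\<And>G. G \<in> flats M \<Longrightarrow> palindromic (matroid_rank M - rk M G)
        (\<Sum>F\<in>{F \<in> flats M. G \<subseteq> F}. monom 1 (rk M F - rk M G) * R F)"
  shows "reverse_poly (matroid_rank M) (R {})
    = (\<Sum>F\<in>flats M. matroid_char_poly (restrict_to M F) * R F)"
proof -
  define r where "r = matroid_rank M"
  define L where "L = flats M"
  define \<mu> where "\<mu> = moebius L {}"
  have finL: "finite L" using finite_flats[OF M] by (simp add: L_def)
  have finF: "finite F" if "F \<in> L" for F
    using that flats_subset matroid_finite[OF M] finite_subset unfolding L_def by blast
  have rk_le: "rk M F \<le> r" if "F \<in> L" for F
    using that flats_subset unfolding r_def matroid_rank_def L_def
    by (intro matroid_rk_mono[OF M]) auto
  have rk_mono: "rk M G \<le> rk M F" if "F \<in> L" "G \<subseteq> F" for F G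
    using that flats_subset unfolding L_def by (intro matroid_rk_mono[OF M]) auto
  have char: "matroid_char_poly (restrict_to M F)
      = (\<Sum>G\<in>{G \<in> L. G \<subseteq> F}. smult (\<mu> G) (monom 1 (rk M F - rk M G)))" if F: "F \<in> L" for F
  proof -
    have "flats (restrict_to M F) = {G \<in> L. G \<subseteq> F}"
      using flats_restrict_to[OF M] F by (simp add: L_def)
    moreover have "moebius (flats (restrict_to M F)) {} G = \<mu> G" if "G \<in> L" "G \<subseteq> F" for G
      unfolding \<mu>_def calculation using finF that by (intro moebius_down_closed) auto
    ultimately show ?thesis
      by (auto simp: matroid_char_poly_def matroid_rank_def smult_monom intro!: sum.cong)
  qed
  \<comment> \<open>The reversal degree splits as r - rk G = (rk F - rk G) + (r - rk F), and
    reversing t^(rk F - rk G) gives 1. By palindromicity the sum over an upper interval thus equals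
    a sum whose terms no longer involve G.\<close>
  have rev: "(\<Sum>F\<in>{F \<in> L. G \<subseteq> F}. monom 1 (rk M F - rk M G) * R F)
      = (\<Sum>F\<in>{F \<in> L. G \<subseteq> F}. reverse_poly (r - rk M F) (R F))" if G: "G \<in> L" for G
  proof -
    have deg_term: "degree (monom 1 (rk M F - rk M G) * R F) \<le> r - rk M G"
      "reverse_poly (r - rk M G) (monom 1 (rk M F - rk M G) * R F) = reverse_poly (r - rk M F) (R F)"
      if F: "F \<in> L" "G \<subseteq> F" for F
    proof -
      have le: "rk M G \<le> rk M F" "rk M F \<le> r" using F rk_mono rk_le by auto
      then have eq: "r - rk M G = (rk M F - rk M G) + (r - rk M F)" by simp
      have d: "degree (monom (1::int) (rk M F - rk M G)) \<le> rk M F - rk M G" by (rule degree_monom_le)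
      have dR: "degree (R F) \<le> r - rk M F" using deg F by (simp add: L_def r_def)
      show "degree (monom 1 (rk M F - rk M G) * R F) \<le> r - rk M G"
        unfolding eq using d dR by (meson add_mono degree_mult_le le_trans)
      show "reverse_poly (r - rk M G) (monom 1 (rk M F - rk M G) * R F) = reverse_poly (r - rk M F) (R F)"
        unfolding eq by (subst reverse_poly_mult[OF d dR]) simp
    qed
    have "(\<Sum>F\<in>{F \<in> L. G \<subseteq> F}. monom 1 (rk M F - rk M G) * R F)
        = reverse_poly (r - rk M G) (\<Sum>F\<in>{F \<in> L. G \<subseteq> F}. monom 1 (rk M F - rk M G) * R F)"
      using pal[of G] G by (simp add: palindromic_def L_def r_def)
    also have "\<dots> = (\<Sum>F\<in>{F \<in> L. G \<subseteq> F}. reverse_poly (r - rk M F) (R F))"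
      by (subst reverse_poly_sum) (auto simp: deg_term)
    finally show ?thesis .
  qed
  have "(\<Sum>F\<in>L. matroid_char_poly (restrict_to M F) * R F)
      = (\<Sum>F\<in>L. \<Sum>G\<in>{G \<in> L. G \<subseteq> F}. smult (\<mu> G) (monom 1 (rk M F - rk M G) * R F))"
    by (intro sum.cong refl) (simp add: char sum_distrib_right)
  also have "\<dots> = (\<Sum>G\<in>L. \<Sum>F\<in>{F \<in> L. G \<subseteq> F}. smult (\<mu> G) (monom 1 (rk M F - rk M G) * R F))"
    by (rule sum_swap_below[OF finL])
  also have "\<dots> = (\<Sum>G\<in>L. \<Sum>F\<in>{F \<in> L. G \<subseteq> F}. smult (\<mu> G) (reverse_poly (r - rk M F) (R F)))"
    by (rule sum.cong[OF refl]) (simp add: rev flip: smult_sum_right)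
  \<comment> \<open>As the reversed terms do not depend on G, swapping back collects the full
    Moebius sum over G below F, which leaves only F = {}.\<close>
  also have "\<dots> = (\<Sum>F\<in>L. \<Sum>G\<in>{G \<in> L. G \<subseteq> F}. smult (\<mu> G) (reverse_poly (r - rk M F) (R F)))"
    by (rule sum_swap_below[OF finL, symmetric])
  also have "\<dots> = (\<Sum>F\<in>L. smult (\<Sum>G\<in>{G \<in> L. {} \<subseteq> G \<and> G \<subseteq> F}. \<mu> G) (reverse_poly (r - rk M F) (R F)))"
    by (simp add: smult_sum)
  also have "\<dots> = (\<Sum>F\<in>L. if F = {} then reverse_poly (r - rk M F) (R F) else 0)"
    using finL finF loopless by (intro sum.cong refl)
      (subst \<mu>_def, subst sum_moebius, auto simp: L_def)
  also have "\<dots> = reverse_poly r (R {})"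
    using finL loopless matroid_rk_empty[OF M] by (simp add: L_def)
  finally show ?thesis by (simp add: L_def r_def)
qed

lemma matroid_char_poly_restrict_empty:
  assumes "matroid M" "{} \<in> flats M"
  shows "matroid_char_poly (restrict_to M {}) = 1"
proof -
  have "flats (restrict_to M {}) = {{}}" using flats_restrict_to[OF assms] assms(2) by auto
  then show ?thesis
    by (simp add: matroid_char_poly_def matroid_rank_def moebius.simps)
qed

lemma loopless_rank_0:
  assumes "matroid M" "{} \<in> flats M" "matroid_rank M = 0"
  shows "ground M = {}"
  using flats_rk_less[OF assms(1,2), of "ground M"] assms(3) by (auto simp: matroid_rank_def)

lemma KL_poly_rank_0: "matroid_rank M = 0 \<Longrightarrow> KL_poly M = 1"
  by (simp add: KL_poly.simps)

lemma inv_KL_poly_rank_0: "matroid_rank M = 0 \<Longrightarrow> inv_KL_poly M = 1"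
  by (simp add: inv_KL_poly.simps)

text \<open>\<open>KL_poly\<close> is a definite description, so a solution must be exhibited and
  shown to be unique. By induction all proper contractions are palindromic;
  \<open>palindromic_completion\<close> supplies a candidate p for M itself, and
  \<open>reverse_eq_char_poly_sum\<close> shows that p solves the defining equation.\<close>

theorem KL_poly_palindromic:
  assumes "matroid M" "{} \<in> flats M"
  shows "(0 < matroid_rank M \<longrightarrow> 2 * degree (KL_poly M) < matroid_rank M) \<and>
    palindromic (matroid_rank M) (\<Sum>F\<in>flats M. monom 1 (rk M F) * KL_poly (contract M F))"
  using assms
proof (induction "card (ground M)" arbitrary: M rule: less_induct)
  case less
  note M = less.prems(1) and loopless = less.prems(2)
  define r where "r = matroid_rank M"
  show ?case
  proof (cases "r = 0")
    case True
    then have "ground M = {}" using loopless_rank_0 M loopless by (simp add: r_def)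
    then have "flats M = {{}}" using loopless flats_subset by fastforce
    then show ?thesis using True matroid_rk_empty[OF M]
      by (simp add: contract_empty[OF M] KL_poly_rank_0 r_def palindromic_iff)
  next
    case False
    define K where "K F = KL_poly (contract M F)" for F
    have rk_le: "rk M F \<le> r" if "F \<in> flats M" for F
      using that flats_subset unfolding r_def matroid_rank_def
      by (intro matroid_rk_mono[OF M]) auto
    have IH: "(rk M G < r \<longrightarrow> 2 * degree (K G) < r - rk M G) \<and> palindromic (r - rk M G)
        (\<Sum>F\<in>{F \<in> flats M. G \<subseteq> F}. monom 1 (rk M F - rk M G) * K F)"
      if G: "G \<in> flats M" "G \<noteq> {}" for G
    proof -
      have Gs: "G \<subseteq> ground M" using G flats_subset by blast
      have rank: "matroid_rank (contract M G) = r - rk M G"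
        using Gs by (simp add: matroid_rank_contract r_def)
      have "card (ground (contract M G)) < card (ground M)"
        using G Gs matroid_finite[OF M] by (auto intro!: psubset_card_mono)
      from less.hyps[OF this matroid_contract[OF M Gs] loopless_contract[OF M G(1)]]
      have "(rk M G < r \<longrightarrow> 2 * degree (K G) < r - rk M G)"
        "palindromic (r - rk M G) (\<Sum>F\<in>flats (contract M G).
          monom 1 (rk (contract M G) F) * KL_poly (contract (contract M G) F))"
        unfolding rank K_def by simp_all
      moreover have "(\<Sum>F\<in>flats (contract M G).
            monom 1 (rk (contract M G) F) * KL_poly (contract (contract M G) F))
          = (\<Sum>F\<in>{F \<in> flats M. G \<subseteq> F}. monom 1 (rk M F - rk M G) * K F)"
        unfolding flats_contract[OF M Gs] K_def
      proof (subst sum.reindex[OF inj_on_Diff_superset], intro sum.cong refl)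
        fix F assume "F \<in> {F \<in> flats M. G \<subseteq> F}"
        then have "G \<subseteq> F" "F \<subseteq> ground M" "F - G \<union> G = F" using flats_subset by auto
        then show "((\<lambda>F. monom 1 (rk (contract M G) F) * KL_poly (contract (contract M G) F))
            \<circ> (\<lambda>F. F - G)) F = monom 1 (rk M F - rk M G) * KL_poly (contract M F)"
          by (simp add: contract_contract[OF M])
      qed
      ultimately show ?thesis by simp
    qed
    have degK: "degree (K F) \<le> r - rk M F" if "F \<in> flats M" "F \<noteq> {}" for F
    proof (cases "rk M F < r")
      case True
      then show ?thesis using IH[OF that] by simp
    next
      case False
      then have "matroid_rank (contract M F) = 0"
        using that flats_subset[of F M] by (simp add: matroid_rank_contract r_def)
      then show ?thesis by (simp add: K_def KL_poly_rank_0)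
    qed
    define z where "z = (\<Sum>F\<in>flats M - {{}}. monom 1 (rk M F) * K F)"
    have "degree z \<le> r"
      unfolding z_def
    proof (rule degree_sum_le)
      show "finite (flats M - {{}})" using finite_flats[OF M] by simp
      fix F assume F: "F \<in> flats M - {{}}"
      have "degree (monom 1 (rk M F) * K F) \<le> degree (monom (1::int) (rk M F)) + degree (K F)"
        by (rule degree_mult_le)
      also have "\<dots> \<le> rk M F + (r - rk M F)"
        using F degK by (intro add_mono degree_monom_le) auto
      also have "\<dots> = r" using F rk_le by simp
      finally show "degree (monom 1 (rk M F) * K F) \<le> r" .
    qed
    then obtain p where p: "2 * degree p < r" "palindromic r (p + z)"
      using palindromic_completion False by blast
    define R where "R F = (if F = {} then p else K F)" for F
    have sumR: "(\<Sum>F\<in>flats M. monom 1 (rk M F) * R F) = p + z"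
    proof -
      have "(\<Sum>F\<in>flats M. monom 1 (rk M F) * R F)
          = monom 1 (rk M {}) * R {} + (\<Sum>F\<in>flats M - {{}}. monom 1 (rk M F) * R F)"
        using finite_flats[OF M] loopless by (rule sum.remove)
      then show ?thesis using matroid_rk_empty[OF M] by (simp add: R_def z_def)
    qed
    have "palindromic (r - rk M G) (\<Sum>F\<in>{F \<in> flats M. G \<subseteq> F}. monom 1 (rk M F - rk M G) * R F)"
      if "G \<in> flats M" for G
    proof (cases "G = {}")
      case True
      then show ?thesis using p(2) matroid_rk_empty[OF M] by (simp add: sumR)
    next
      case False
      then have "(\<Sum>F\<in>{F \<in> flats M. G \<subseteq> F}. monom 1 (rk M F - rk M G) * R F)
          = (\<Sum>F\<in>{F \<in> flats M. G \<subseteq> F}. monom 1 (rk M F - rk M G) * K F)"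
        by (intro sum.cong) (auto simp: R_def)
      then show ?thesis using IH[OF that False] by simp
    qed
    moreover have "degree (R F) \<le> r - rk M F" if "F \<in> flats M" for F
      using degK[OF that] p(1) matroid_rk_empty[OF M] by (auto simp: R_def)
    ultimately have eq: "reverse_poly r p = (\<Sum>F\<in>flats M. matroid_char_poly (restrict_to M F) * R F)"
      using reverse_eq_char_poly_sum[OF M loopless, of R] by (simp add: r_def R_def)
    define C where "C = (\<Sum>F\<in>flats M - {{}}. matroid_char_poly (restrict_to M F) * K F)"
    have split: "(\<Sum>F\<in>flats M. matroid_char_poly (restrict_to M F) *
        (if F = {} then p' else KL_poly (contract M F))) = p' + C" for p'
    proof -
      have "(\<Sum>F\<in>flats M. matroid_char_poly (restrict_to M F) *
          (if F = {} then p' else KL_poly (contract M F)))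
        = matroid_char_poly (restrict_to M {}) * p'
          + (\<Sum>F\<in>flats M - {{}}. matroid_char_poly (restrict_to M F) *
          (if F = {} then p' else KL_poly (contract M F)))"
        using finite_flats[OF M] loopless by (simp add: sum.remove)
      also have "\<dots> = p' + C"
        by (simp add: matroid_char_poly_restrict_empty[OF M loopless] C_def K_def)
      finally show ?thesis .
    qed
    have eq': "reverse_poly r p = p + C"
      using eq split[of p] by (simp only: R_def K_def)
    have KL: "KL_poly M = p"
    proof -
      have "KL_poly M = (THE p'. 2 * degree p' < r \<and> reverse_poly r p' = p' + C)"
        using False matroid_finite[OF M]
        by (subst KL_poly.simps) (simp add: split r_def)
      also have "\<dots> = p"
      proof (rule the_equality)
        \<comment> \<open>The difference of two solutions is palindromic of weight r and has degree
          below r/2, hence vanishes.\<close>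
        fix p' assume p': "2 * degree p' < r \<and> reverse_poly r p' = p' + C"
        have d: "degree (p' - p) \<le> max (degree p') (degree p)" by (rule degree_diff_le_max)
        have "palindromic r (p' - p)"
          unfolding palindromic_def using p' p(1) d eq' by (subst reverse_poly_diff) auto
        then have "p' - p = 0"
          using p' p(1) d by (intro palindromic_small_eq_0[of r]) auto
        then show "p' = p" by simp
      qed (use p eq' in auto)
      finally show ?thesis .
    qed
    have "K = R"
      by (auto simp: fun_eq_iff K_def R_def contract_empty[OF M] KL)
    then have "palindromic r (\<Sum>F\<in>flats M. monom 1 (rk M F) * K F)"
      using sumR p(2) by simp
    then show ?thesis using p(1) by (simp add: KL r_def K_def)
  qed
qed

text \<open>This is the recursion for \<open>inv_KL_poly\<close> with its left side moved into the
  sum as the term of the empty flat. In this form signed P and Q are inverse to each other in the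
  incidence algebra.\<close>

lemma sum_KL_inv_KL:
  assumes M: "matroid M" and "{} \<in> flats M" "0 < matroid_rank M"
  shows "(\<Sum>F\<in>flats M. (- 1) ^ rk M F * KL_poly (restrict_to M F) * inv_KL_poly (contract M F)) = 0"
proof -
  have "KL_poly (restrict_to M {}) = 1"
    using matroid_rk_empty[OF M] by (intro KL_poly_rank_0) (simp add: matroid_rank_def)
  then have "(\<Sum>F\<in>flats M. (- 1) ^ rk M F * KL_poly (restrict_to M F) * inv_KL_poly (contract M F))
    = inv_KL_poly M
      + (\<Sum>F\<in>flats M - {{}}. (- 1) ^ rk M F * KL_poly (restrict_to M F) * inv_KL_poly (contract M F))"
    using finite_flats[OF M] assms(2) matroid_rk_empty[OF M]
    by (subst sum.remove[of _ "{}"]) (simp_all add: contract_empty[OF M])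
  also have "inv_KL_poly M
    = (\<Sum>F\<in>flats M - {{}}. (- 1) ^ (rk M F + 1) * KL_poly (restrict_to M F) * inv_KL_poly (contract M F))"
    using assms matroid_finite[OF M] by (subst inv_KL_poly.simps) simp
  finally show ?thesis by (simp add: sum_negf)
qed

section \<open>Gaussian binomial coefficients\<close>

text \<open>The q-Pascal recursion in the shape that \<open>card_interval\<close> produces: the
  second summand counts the subspaces not contained in a fixed hyperplane. The quotient formula is
  recovered in \<open>gauss_binomial_eq_gauss\<close>.\<close>

fun gauss :: "nat \<Rightarrow> nat \<Rightarrow> nat \<Rightarrow> nat" where
  "gauss q n 0 = 1"
| "gauss q 0 (Suc k) = 0"
| "gauss q (Suc n) (Suc k) = gauss q n (Suc k) + q ^ (n - k) * gauss q n k"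

lemma gauss_eq_0: "n < k \<Longrightarrow> gauss q n k = 0"
  by (induction q n k rule: gauss.induct) auto

text \<open>The usual q-factorial times (q - 1)^n; these powers cancel in Gaussian binomials because
  k + (n - k) = n.\<close>

definition q_factorial :: "nat \<Rightarrow> nat \<Rightarrow> nat" where
  "q_factorial q n = (\<Prod>i<n. q ^ (i + 1) - 1)"

lemma q_factorial_Suc: "q_factorial q (Suc n) = q_factorial q n * (q ^ Suc n - 1)"
  by (simp add: q_factorial_def)

lemma q_factorial_pos: "2 \<le> q \<Longrightarrow> 0 < q_factorial q n"
  unfolding q_factorial_def
  using one_less_power[of q "Suc i" for i] by (intro prod_pos) (simp del: power_Suc)

lemma gauss_mult_q_factorial:
  assumes "0 < q" "k \<le> n"
  shows "gauss q n k * q_factorial q k * q_factorial q (n - k) = q_factorial q n"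
  using assms(2)
proof (induction n arbitrary: k)
  case 0
  then show ?case by (simp add: q_factorial_def)
next
  case (Suc n)
  have pos: "1 \<le> q ^ i" for i using assms(1) by simp
  show ?case
  proof (cases k)
    case 0
    then show ?thesis by (simp add: q_factorial_def)
  next
    case (Suc j)
    with Suc.prems have j: "j \<le> n" by simp
    have 1: "gauss q n (Suc j) * q_factorial q (Suc j) * q_factorial q (n - j)
        = q_factorial q n * (q ^ (n - j) - 1)"
    proof (cases "j = n")
      case True
      then show ?thesis by (simp add: gauss_eq_0)
    next
      case False
      with j have "n - j = Suc (n - Suc j)" by simp
      then have "q_factorial q (n - j) = q_factorial q (n - Suc j) * (q ^ (n - j) - 1)"
        by (metis q_factorial_Suc)
      then show ?thesis using Suc.IH[of "Suc j"] False j by (simp add: mult_ac)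
    qed
    have 2: "gauss q n j * q_factorial q (Suc j) * q_factorial q (n - j)
        = q_factorial q n * (q ^ Suc j - 1)"
      using Suc.IH[OF j] by (simp add: q_factorial_Suc mult_ac)
    have "gauss q (Suc n) k * q_factorial q k * q_factorial q (Suc n - k)
        = gauss q n (Suc j) * q_factorial q (Suc j) * q_factorial q (n - j)
          + q ^ (n - j) * (gauss q n j * q_factorial q (Suc j) * q_factorial q (n - j))"
      by (simp add: Suc algebra_simps)
    also have "\<dots> = q_factorial q n * ((q ^ (n - j) - 1) + q ^ (n - j) * (q ^ Suc j - 1))"
      unfolding 1 2 by (simp add: algebra_simps)
    also have "q ^ (n - j) * (q ^ Suc j - 1) = q ^ Suc n - q ^ (n - j)"
    proof -
      have "n - j + Suc j = Suc n" using j by simp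
      then have "q ^ (n - j) * q ^ Suc j = q ^ Suc n" by (metis power_add)
      then show ?thesis by (simp add: right_diff_distrib' del: power_Suc)
    qed
    also have "(q ^ (n - j) - 1) + (q ^ Suc n - q ^ (n - j)) = q ^ Suc n - 1"
    proof -
      have "q ^ (n - j) \<le> q ^ Suc n" using assms(1) by (intro power_increasing) auto
      with pos[of "n - j"] show ?thesis by linarith
    qed
    finally show ?thesis by (simp add: q_factorial_Suc)
  qed
qed

lemma gauss_symmetric:
  assumes "2 \<le> q" "k \<le> n" shows "gauss q n (n - k) = gauss q n k"
proof -
  have "gauss q n k * (q_factorial q k * q_factorial q (n - k)) = q_factorial q n"
    using gauss_mult_q_factorial[of q k n] assms by (simp add: mult_ac)
  moreover have "gauss q n (n - k) * (q_factorial q k * q_factorial q (n - k)) = q_factorial q n"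
    using gauss_mult_q_factorial[of q "n - k" n] assms by (simp add: mult_ac)
  moreover have "0 < q_factorial q k * q_factorial q (n - k)"
    using assms q_factorial_pos by simp
  ultimately show ?thesis by (metis mult_right_cancel less_numeral_extra(3))
qed

lemma gauss_binomial_eq_gauss:
  assumes "2 \<le> q" shows "gauss_binomial q n k = gauss q n k"
proof (cases "k \<le> n")
  case True
  have "q_factorial q n = (\<Prod>i<k. q ^ (n - i) - 1) * q_factorial q (n - k)"
    using True
  proof (induction k)
    case (Suc k)
    then have "n - k = Suc (n - Suc k)" by simp
    then have "q_factorial q (n - k) = q_factorial q (n - Suc k) * (q ^ (n - k) - 1)"
      by (metis q_factorial_Suc)
    with Suc show ?case by (simp add: mult_ac)
  qed simp
  then have "(\<Prod>i<k. q ^ (n - i) - 1) = gauss q n k * q_factorial q k"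
    using gauss_mult_q_factorial[of q k n] True assms q_factorial_pos[OF assms, of "n - k"]
    by (metis mult_right_cancel less_numeral_extra(3) less_le_trans pos2)
  then show ?thesis
    using True q_factorial_pos[OF assms, of k] by (simp add: gauss_binomial_def q_factorial_def)
qed (simp add: gauss_binomial_def gauss_eq_0)

text \<open>By the q-Pascal recursion, passing from n to n + 1 multiplies the sum by 1 - q^n, and
  this factor is 0 at n = 0. It is the q-binomial theorem for the product of the 1 - q^i x,
  evaluated at x = 1.\<close>

lemma alternating_sum_gauss:
  "(\<Sum>k\<le>n. (- 1) ^ k * int q ^ (k choose 2) * int (gauss q n k)) = (if n = 0 then 1 else 0)"
proof -
  define S where "S n = (\<Sum>k\<le>n. (- 1) ^ k * int q ^ (k choose 2) * int (gauss q n k))" for n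
  have step: "S (Suc n) = (1 - int q ^ n) * S n" for n
  proof -
    let ?t = "\<lambda>k. (- 1) ^ k * int q ^ (k choose 2) * int (gauss q n k)"
    have choose: "Suc k choose 2 = (k choose 2) + k" for k by (simp add: numeral_2_eq_2)
    have step_term: "(- 1) ^ Suc k * int q ^ (Suc k choose 2) * int (gauss q (Suc n) (Suc k))
        = ?t (Suc k) - int q ^ n * ?t k" if "k \<le> n" for k
    proof -
      have "int q ^ k * int q ^ (n - k) = int q ^ n" using that by (simp flip: power_add)
      then show ?thesis by (simp add: choose power_add algebra_simps)
    qed
    have "S (Suc n) = 1 + (\<Sum>k\<le>n. (- 1) ^ Suc k * int q ^ (Suc k choose 2) * int (gauss q (Suc n) (Suc k)))"
      unfolding S_def by (subst sum.atMost_Suc_shift) (simp add: binomial_eq_0)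
    also have "\<dots> = 1 + (\<Sum>k\<le>n. ?t (Suc k)) - int q ^ n * S n"
      using step_term by (simp add: sum_subtractf sum_distrib_left S_def)
    also have "1 + (\<Sum>k\<le>n. ?t (Suc k)) = (\<Sum>k\<le>Suc n. ?t k)"
      by (subst sum.atMost_Suc_shift) (simp add: binomial_eq_0)
    also have "\<dots> = S n" by (simp add: S_def gauss_eq_0)
    finally show ?thesis by (simp add: algebra_simps)
  qed
  have "S n = (if n = 0 then 1 else 0)"
    by (induction n) (simp_all add: step, simp_all add: S_def binomial_eq_0)
  then show ?thesis by (simp add: S_def)
qed

section \<open>Finite subspaces\<close>

text \<open>Dimension theory is developed inside a finite subspace \<open>Y\<close>, not for a
  finite type: the vectors representing AG(b,2) live in the infinite space of binary sequences,
  whereas the final application has \<open>Y = UNIV\<close>.\<close>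

locale finite_space = vector_space scale
  for scale :: "'a::{field,finite} \<Rightarrow> 'b::ab_group_add \<Rightarrow> 'b" +
  fixes Y :: "'b set"
  assumes subspace_Y: "subspace Y" and finite_Y: "finite Y"
begin

definition Sub :: "'b set set" where
  "Sub = {U. subspace U \<and> U \<subseteq> Y}"

lemma SubD: "U \<in> Sub \<Longrightarrow> subspace U" "U \<in> Sub \<Longrightarrow> U \<subseteq> Y" "U \<in> Sub \<Longrightarrow> finite U"
  using finite_Y by (auto simp: Sub_def intro: finite_subset)

lemma finite_Sub: "finite Sub"
  by (rule finite_subset[of _ "Pow Y"]) (auto simp: Sub_def finite_Y)

lemma Y_in_Sub: "Y \<in> Sub" and zero_in_Sub: "{0} \<in> Sub"
  using subspace_Y by (auto simp: Sub_def subspace_single_0 subspace_0)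

lemma Sub_Int: "U \<in> Sub \<Longrightarrow> V \<in> Sub \<Longrightarrow> U \<inter> V \<in> Sub"
  by (auto simp: Sub_def intro: subspace_inter)

lemma Sub_zero: "U \<in> Sub \<Longrightarrow> 0 \<in> U"
  by (simp add: Sub_def subspace_0)

lemma span_Sub: "U \<in> Sub \<Longrightarrow> span U = U"
  by (simp add: Sub_def span_eq_iff)

lemma span_in_Sub: "S \<subseteq> Y \<Longrightarrow> span S \<in> Sub"
  by (simp add: Sub_def span_minimal subspace_Y)

lemma span_le_Sub: "U \<in> Sub \<Longrightarrow> S \<subseteq> U \<Longrightarrow> span S \<subseteq> U"
  by (simp add: Sub_def span_minimal)

lemma CARD_ge_2: "2 \<le> CARD('a)"
proof -
  have "card {0, 1 :: 'a} \<le> CARD('a)" by (rule card_mono) auto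
  then show ?thesis by simp
qed

lemma span_insert_span: "span (insert x (span S)) = span (insert x S)"
  by (subst span_eq) (auto intro: span_base span_mono[THEN subsetD])

lemma card_span_insert:
  assumes S: "subspace S" "finite S" and x: "x \<notin> S"
  shows "finite (span (insert x S))" "card (span (insert x S)) = CARD('a) * card S"
proof -
  let ?f = "\<lambda>(c, y). scale c x + y"
  have "span (insert x S) = ?f ` (UNIV \<times> S)"
  proof (intro set_eqI iffI)
    fix y assume "y \<in> span (insert x S)"
    then obtain k where "y - scale k x \<in> S"
      using S by (metis span_breakdown_eq span_eq_iff)
    then show "y \<in> ?f ` (UNIV \<times> S)" by (intro image_eqI[of _ _ "(k, y - scale k x)"]) auto
  next
    fix y assume "y \<in> ?f ` (UNIV \<times> S)"
    then show "y \<in> span (insert x S)"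
      by (auto intro!: span_add span_scale intro: span_base)
  qed
  moreover have "inj_on ?f (UNIV \<times> S)"
  proof (intro inj_onI; clarify)
    fix c y c' y' assume y: "y \<in> S" "y' \<in> S" and eq: "scale c x + y = scale c' x + y'"
    then have "scale (c - c') x = y' - y" by (simp add: algebra_simps)
    then have "scale (c - c') x \<in> S" using S y by (simp add: subspace_diff)
    then have "c = c'"
    proof (rule contrapos_pp)
      assume "c \<noteq> c'"
      then have "x = scale (1 / (c - c')) (scale (c - c') x)" by simp
      then show "scale (c - c') x \<notin> S" using S(1) x by (metis subspace_scale)
    qed
    with eq show "c = c' \<and> y = y'" by simp
  qed
  ultimately show "finite (span (insert x S))" "card (span (insert x S)) = CARD('a) * card S"
    using S by (simp_all add: card_image card_cartesian_product)
qed

lemma dim_insert_Sub: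
  assumes "U \<in> Sub" "x \<notin> U"
  shows "dim (insert x U) = Suc (dim U)"
proof -
  obtain B where B: "B \<subseteq> U" "independent B" "U \<subseteq> span B" "card B = dim U"
    using basis_exists by blast
  have spanB: "span B = U" using B assms SubD span_le_Sub by blast
  then have ind: "independent (insert x B)" using B assms by (simp add: independent_insertI)
  have "finite B" using B SubD[OF assms(1)] finite_subset by blast
  moreover have "x \<notin> B" using B assms by auto
  moreover have "span (insert x B) = span (insert x U)"
    using span_insert_span[of x B] spanB by simp
  ultimately show ?thesis using B ind dim_span_eq_card_independent[OF ind] by simp
qed

lemma dim_insert:
  assumes "S \<subseteq> Y" "x \<in> Y"
  shows "dim (insert x S) = (if x \<in> span S then dim S else Suc (dim S))"
proof -
  have "dim (span (insert x (span S))) = Suc (dim S)" if "x \<notin> span S"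
    using dim_insert_Sub[OF span_in_Sub that] assms by simp
  then show ?thesis using span_redundant[of x S] span_insert_span[of x S] by (metis dim_span)
qed

text \<open>Turns comparisons of dimensions into comparisons of cardinalities, which is how
  \<open>dim_mono\<close> and \<open>dim_less\<close> are obtained.\<close>

lemma card_Sub:
  assumes "U \<in> Sub" shows "card U = CARD('a) ^ dim U"
proof -
  obtain B where B: "B \<subseteq> U" "independent B" "U \<subseteq> span B" "card B = dim U"
    using basis_exists by blast
  then have spanB: "span B = U" using assms SubD span_le_Sub by blast
  have "finite B" using B SubD[OF assms] finite_subset by blast
  then have "finite (span B) \<and> card (span B) = CARD('a) ^ card B" using B(2)
  proof (induction B)
    case (insert x B)
    then have x: "x \<notin> span B" "independent B"
      by (simp_all add: independent_insert)
    have "span (insert x B) = span (insert x (span B))"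
      by (simp add: span_insert_span)
    then show ?case using card_span_insert[of "span B" x] insert x by simp
  qed simp
  then show ?thesis using spanB B by simp
qed

lemma dim_mono: "U \<in> Sub \<Longrightarrow> V \<in> Sub \<Longrightarrow> U \<subseteq> V \<Longrightarrow> dim U \<le> dim V"
  using card_mono[of V U] SubD(3)[of V] CARD_ge_2 by (simp add: card_Sub)

lemma dim_less:
  assumes "U \<in> Sub" "V \<in> Sub" "U \<subset> V" shows "dim U < dim V"
  using psubset_card_mono[of V U] SubD(3)[OF assms(2)] CARD_ge_2 assms by (simp add: card_Sub)

lemma dim_eq: "U \<in> Sub \<Longrightarrow> V \<in> Sub \<Longrightarrow> U \<subseteq> V \<Longrightarrow> dim V \<le> dim U \<Longrightarrow> U = V"
  using dim_less[of U V] by auto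

lemma dim_zero: "dim {0} = 0"
  using card_Sub[OF zero_in_Sub] CARD_ge_2 by (cases "dim {0}") (auto simp: )

lemma dim_eq_0: "U \<in> Sub \<Longrightarrow> dim U = 0 \<longleftrightarrow> U = {0}"
  using dim_eq[OF zero_in_Sub, of U] Sub_zero dim_zero by auto

lemma hyperplane_span:
  assumes "F \<in> Sub" "A \<in> Sub" "A \<subseteq> F" "dim F = Suc (dim A)" "x \<in> F" "x \<notin> A"
  shows "span (insert x A) = F"
proof (rule dim_eq)
  show "span (insert x A) \<in> Sub" using assms SubD(2) by (intro span_in_Sub) blast
  show "span (insert x A) \<subseteq> F" using assms by (intro span_le_Sub) auto
  show "dim F \<le> dim (span (insert x A))" using assms by (simp add: dim_insert_Sub)
qed fact

lemma hyperplane_coset: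
  assumes "F \<in> Sub" "A \<in> Sub" "A \<subseteq> F" "dim F = Suc (dim A)" "x \<in> F" "x \<notin> A" "y \<in> F"
  obtains k where "y - scale k x \<in> A"
  using hyperplane_span[OF assms(1-6)] assms(2,7) SubD(1) span_breakdown_eq[of y x A]
  by (auto simp: span_Sub)

lemma ex_hyperplane:
  assumes "U \<in> Sub" "F \<in> Sub" "U \<subset> F"
  obtains A where "A \<in> Sub" "U \<subseteq> A" "A \<subset> F" "dim F = Suc (dim A)"
proof -
  let ?C = "{Z \<in> Sub. U \<subseteq> Z \<and> Z \<subset> F}"
  have "finite (dim ` ?C)" "?C \<noteq> {}" using finite_Sub assms by auto
  then have "Max (dim ` ?C) \<in> dim ` ?C" by (intro Max_in) auto
  then obtain A where A: "Max (dim ` ?C) = dim A" "A \<in> ?C" by (rule imageE)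
  then obtain x where x: "x \<in> F" "x \<notin> A" by blast
  let ?Z = "span (insert x A)"
  have "insert x A \<subseteq> F" using A x by auto
  then have Z: "?Z \<in> Sub" "?Z \<subseteq> F"
    using span_in_Sub[of "insert x A"] span_le_Sub[OF assms(2), of "insert x A"] SubD(2)[OF assms(2)]
    by auto
  have "?Z = F"
  proof (rule ccontr)
    assume "?Z \<noteq> F"
    moreover have "A \<subseteq> ?Z" using span_superset by blast
    ultimately have "?Z \<in> ?C" using Z A by auto
    then have "dim ?Z \<le> dim A"
      unfolding A(1)[symmetric] using finite_Sub by (intro Max_ge imageI) simp_all
    then show False using A x by (simp add: dim_insert_Sub)
  qed
  then show ?thesis using that[of A] A x dim_insert_Sub[of A x] by auto
qed

lemma dim_Int_hyperplane:
  assumes "F \<in> Sub" "A \<in> Sub" "A \<subseteq> F" "dim F = Suc (dim A)" "U \<in> Sub" "U \<subseteq> F" "\<not> U \<subseteq> A"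
  shows "dim U = Suc (dim (U \<inter> A))"
proof -
  obtain x where x: "x \<in> U" "x \<notin> A" using assms by blast
  have "span (insert x (U \<inter> A)) = U"
  proof
    show "span (insert x (U \<inter> A)) \<subseteq> U" using x assms by (intro span_le_Sub) auto
    show "U \<subseteq> span (insert x (U \<inter> A))"
    proof
      fix y assume y: "y \<in> U"
      obtain k where k: "y - scale k x \<in> A" using hyperplane_coset[OF assms(1-4)] x y assms by blast
      moreover have "y - scale k x \<in> U"
        using x y SubD[OF assms(5)] by (simp add: subspace_diff subspace_scale)
      ultimately have "y - scale k x \<in> span (U \<inter> A)" by (simp add: span_base)
      then show "y \<in> span (insert x (U \<inter> A))" by (auto simp: span_breakdown_eq)
    qed
  qed
  then have "dim U = dim (insert x (U \<inter> A))" by (metis dim_span)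
  then show ?thesis using dim_insert_Sub[of "U \<inter> A" x] x assms Sub_Int by simp
qed

lemma card_Diff_hyperplane:
  assumes "F \<in> Sub" "A \<in> Sub" "A \<subseteq> F" "dim F = Suc (dim A)"
  shows "card (F - A) = (CARD('a) - 1) * CARD('a) ^ dim A"
  using assms card_Diff_subset[of A F] SubD(3) by (simp add: card_Sub algebra_simps)

text \<open>The sets Z - A = Z - S, for Z in the fibre over S, partition F - A. Each has (q - 1)
  q^(dim S) elements and their union has (q - 1) q^(dim A).\<close>

lemma card_hyperplane_fibre:
  assumes F: "F \<in> Sub" and A: "A \<in> Sub" "A \<subseteq> F" "dim F = Suc (dim A)" and S: "S \<in> Sub" "S \<subseteq> A"
  shows "card {Z \<in> Sub. Z \<subseteq> F \<and> Z \<inter> A = S \<and> \<not> Z \<subseteq> A} = CARD('a) ^ (dim A - dim S)"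
proof -
  let ?C = "{Z \<in> Sub. Z \<subseteq> F \<and> Z \<inter> A = S \<and> \<not> Z \<subseteq> A}"
  have ZS: "dim Z = Suc (dim S)" "S \<subseteq> Z" "Z - A = Z - S" if "Z \<in> ?C" for Z
    using that dim_Int_hyperplane[OF F A, of Z] S by auto
  have eq: "Z = span (insert x S)" if "Z \<in> ?C" "x \<in> Z - A" for Z x
    using that ZS[OF that(1)] S hyperplane_span[of Z S x] by auto
  have "F - A = (\<Union>Z\<in>?C. Z - A)"
  proof (intro set_eqI iffI)
    fix x assume x: "x \<in> F - A"
    let ?Z = "span (insert x S)"
    have "?Z \<in> Sub" "?Z \<subseteq> F" "x \<in> ?Z" "S \<subseteq> ?Z"
    proof -
      have "insert x S \<subseteq> F" using x S A by auto
      then show "?Z \<in> Sub" "?Z \<subseteq> F"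
        using span_in_Sub[of "insert x S"] span_le_Sub[OF F, of "insert x S"] SubD(2)[OF F] by auto
      show "x \<in> ?Z" "S \<subseteq> ?Z" using span_superset[of "insert x S"] by auto
    qed
    moreover have "?Z \<inter> A = S"
    proof -
      have "y \<in> S" if y: "y \<in> ?Z" "y \<in> A" for y
      proof -
        obtain k where k: "y - scale k x \<in> S" using y S by (auto simp: span_breakdown_eq span_Sub)
        then have "scale k x \<in> A"
          using y(2) S subspace_diff[OF SubD(1)[OF A(1)], of y "y - scale k x"] by auto
        then have "k = 0"
          using x SubD(1)[OF A(1)] subspace_scale[of A "scale k x" "1 / k"]
          by (cases "k = 0") auto
        then show ?thesis using k by simp
      qed
      then show ?thesis using S \<open>S \<subseteq> ?Z\<close> by auto
    qed
    ultimately show "x \<in> (\<Union>Z\<in>?C. Z - A)" using x by blast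
  qed auto
  moreover have "card (\<Union>Z\<in>?C. Z - A) = (\<Sum>Z\<in>?C. card (Z - A))"
  proof (intro card_UN_disjoint ballI impI)
    fix Z Z' assume "Z \<in> ?C" "Z' \<in> ?C" "Z \<noteq> Z'"
    with eq[of Z] eq[of Z'] show "(Z - A) \<inter> (Z' - A) = {}" by (metis disjoint_iff)
  qed (use finite_Sub SubD(3) in auto)
  moreover have "card (Z - A) = (CARD('a) - 1) * CARD('a) ^ dim S" if "Z \<in> ?C" for Z
    using card_Diff_hyperplane[of Z S] ZS[OF that] that S by simp
  ultimately have e1: "(CARD('a) - 1) * CARD('a) ^ dim A = card ?C * ((CARD('a) - 1) * CARD('a) ^ dim S)"
    using card_Diff_hyperplane[OF F A] by (simp only: sum_constant of_nat_id cong: sum.cong)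
  have e2: "CARD('a) ^ dim A = CARD('a) ^ (dim A - dim S) * CARD('a) ^ dim S"
    using dim_mono[OF S(1) A(1) S(2)] by (simp flip: power_add)
  have e3: "CARD('a) ^ (dim A - dim S) * ((CARD('a) - 1) * CARD('a) ^ dim S)
      = card ?C * ((CARD('a) - 1) * CARD('a) ^ dim S)"
    using e1 unfolding e2 by (simp only: mult_ac)
  have "(CARD('a) - 1) * CARD('a) ^ dim S \<noteq> 0" using CARD_ge_2 by (simp del: One_nat_def)
  from mult_right_cancel[THEN iffD1, OF this e3] show ?thesis by (rule sym)
qed

definition interval :: "'b set \<Rightarrow> 'b set \<Rightarrow> 'b set set" where
  "interval U F = {Z \<in> Sub. U \<subseteq> Z \<and> Z \<subseteq> F}"

lemma finite_interval: "finite (interval U F)"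
  by (simp add: interval_def finite_Sub)

text \<open>Induction along a hyperplane A of F above U. A subspace Z either lies in A or is counted
  over its trace on A, whose dimension is smaller by one; \<open>card_hyperplane_fibre\<close> gives
  the size of each fibre.\<close>

theorem card_interval:
  assumes "U \<in> Sub" "F \<in> Sub" "U \<subseteq> F"
  shows "card {Z \<in> interval U F. dim Z = dim U + k} = gauss (CARD('a)) (dim F - dim U) k"
  using assms(2,3)
proof (induction "dim F - dim U" arbitrary: F k)
  case 0
  then have "F = U" using dim_eq[OF assms(1), of F] by simp
  then have "{Z \<in> interval U F. dim Z = dim U + k} = (if k = 0 then {U} else {})"
    using assms(1) by (auto simp: interval_def)
  then show ?case using \<open>F = U\<close> by (cases k) (simp_all del: Collect_empty_eq)
next
  case (Suc n)
  then have "U \<noteq> F" by auto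
  then obtain A where A: "A \<in> Sub" "U \<subseteq> A" "A \<subset> F" "dim F = Suc (dim A)"
    using ex_hyperplane[OF assms(1), of F] Suc.prems by blast
  have n: "n = dim A - dim U" "dim A = dim U + n"
    using Suc.hyps A dim_mono[OF assms(1) A(1,2)] by auto
  note IH = Suc.hyps(1)[OF n(1) A(1,2)]
  show ?case
  proof (cases k)
    case 0
    have "{Z \<in> interval U F. dim Z = dim U + k} = {U}"
      using assms(1) Suc.prems dim_eq[OF assms(1)] 0 unfolding interval_def by fastforce
    then show ?thesis using 0 by simp
  next
    case (Suc j)
    let ?in = "{Z \<in> interval U A. dim Z = dim U + k}"
    let ?S = "{S \<in> interval U A. dim S = dim U + j}"
    let ?fib = "\<lambda>S. {Z \<in> Sub. Z \<subseteq> F \<and> Z \<inter> A = S \<and> \<not> Z \<subseteq> A}"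
    have split: "{Z \<in> interval U F. dim Z = dim U + k} = ?in \<union> (\<Union>S\<in>?S. ?fib S)" (is "?L = ?R")
    proof (intro set_eqI iffI)
      fix Z assume Z: "Z \<in> ?L"
      show "Z \<in> ?R"
      proof (cases "Z \<subseteq> A")
        case False
        then have "dim Z = Suc (dim (Z \<inter> A))"
          using dim_Int_hyperplane[of F A Z] A Suc.prems Z by (auto simp: interval_def)
        then have "Z \<inter> A \<in> ?S" using Z A Sub_Int Suc by (auto simp: interval_def)
        then show ?thesis using Z False by (auto simp: interval_def)
      qed (use Z in \<open>auto simp: interval_def\<close>)
    next
      fix Z assume "Z \<in> ?R"
      moreover have "Z \<in> ?L" if "Z \<in> ?in" using that A by (auto simp: interval_def)
      moreover have "Z \<in> ?L" if Z: "S \<in> ?S" "Z \<in> ?fib S" for S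
        using Z dim_Int_hyperplane[OF Suc.prems(1) A(1) _ A(4), of Z] A(3) Suc
        by (auto simp: interval_def)
      ultimately show "Z \<in> ?L" by blast
    qed
    have "card ?L = card ?in + card (\<Union>S\<in>?S. ?fib S)"
      unfolding split using finite_Sub finite_interval
      by (intro card_Un_disjoint) (auto simp: interval_def)
    also have "card (\<Union>S\<in>?S. ?fib S) = (\<Sum>S\<in>?S. card (?fib S))"
      using finite_Sub finite_interval by (intro card_UN_disjoint) auto
    also have "\<dots> = (\<Sum>S\<in>?S. CARD('a) ^ (n - j))"
    proof (intro sum.cong refl)
      fix S assume "S \<in> ?S"
      then show "card (?fib S) = CARD('a) ^ (n - j)"
        using card_hyperplane_fibre[OF Suc.prems(1) A(1) _ A(4), of S] A(3) n(2)
        by (simp add: interval_def psubset_imp_subset)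
    qed
    also have "\<dots> = CARD('a) ^ (n - j) * gauss (CARD('a)) n j"
    proof -
      have "card ?S = gauss (CARD('a)) n j" unfolding n(1) by (rule IH)
      then show ?thesis by (simp only: sum_constant of_nat_id mult.commute)
    qed
    finally have "card ?L = card ?in + CARD('a) ^ (n - j) * gauss (CARD('a)) n j" .
    moreover have "card ?in = gauss (CARD('a)) n (Suc j)" 
      unfolding n(1) Suc by (rule IH)
    moreover have "gauss (CARD('a)) (dim F - dim U) k = gauss (CARD('a)) (Suc n) (Suc j)"
      unfolding Suc.hyps(2) Suc by (rule refl)
    ultimately show ?thesis unfolding gauss.simps by argo
  qed
qed

lemma interval_dim_le:
  assumes "U \<in> Sub" "F \<in> Sub" "Z \<in> interval U F" shows "dim U \<le> dim Z" "dim Z \<le> dim F"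
  using assms dim_mono by (auto simp: interval_def)

lemma sum_interval:
  fixes f :: "nat \<Rightarrow> 'c::comm_ring_1"
  assumes "U \<in> Sub" "F \<in> Sub" "U \<subseteq> F"
  shows "(\<Sum>Z\<in>interval U F. f (dim Z - dim U))
    = (\<Sum>k\<le>dim F - dim U. of_nat (gauss (CARD('a)) (dim F - dim U) k) * f k)"
proof -
  have "(\<Sum>Z\<in>interval U F. f (dim Z - dim U))
      = (\<Sum>k\<le>dim F - dim U. \<Sum>Z\<in>{Z \<in> interval U F. dim Z - dim U = k}. f (dim Z - dim U))"
    using interval_dim_le[OF assms(1,2)]
    by (intro sum.group[symmetric] finite_interval) (auto intro: diff_le_mono)
  also have "\<dots> = (\<Sum>k\<le>dim F - dim U. of_nat (gauss (CARD('a)) (dim F - dim U) k) * f k)"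
  proof (intro sum.cong refl)
    fix k
    have "{Z \<in> interval U F. dim Z - dim U = k} = {Z \<in> interval U F. dim Z = dim U + k}"
      using interval_dim_le[OF assms(1,2)] by fastforce
    then show "(\<Sum>Z\<in>{Z \<in> interval U F. dim Z - dim U = k}. f (dim Z - dim U))
        = of_nat (gauss (CARD('a)) (dim F - dim U) k) * f k"
      by (simp add: card_interval[OF assms])
  qed
  finally show ?thesis .
qed

lemma palindromic_interval:
  assumes "U \<in> Sub" "F \<in> Sub" "U \<subseteq> F"
  shows "palindromic (dim F - dim U) (\<Sum>Z\<in>interval U F. monom 1 (dim Z - dim U))"
proof -
  define n where "n = dim F - dim U"
  have c: "coeff (of_nat g * monom (1::int) k) i = (if i = k then int g else 0)" for g k i
    by (simp add: of_nat_poly)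
  have "coeff (\<Sum>Z\<in>interval U F. monom 1 (dim Z - dim U)) i
      = (if i \<le> n then int (gauss (CARD('a)) n i) else 0)" for i
  proof -
    have "coeff (\<Sum>Z\<in>interval U F. monom 1 (dim Z - dim U)) i
        = coeff (\<Sum>k\<le>n. of_nat (gauss (CARD('a)) n k) * monom (1::int) k) i"
      unfolding n_def by (subst sum_interval[OF assms, of "monom (1::int)"]) (rule refl)
    also have "\<dots> = (\<Sum>k\<le>n. if i = k then int (gauss (CARD('a)) n k) else 0)"
      by (simp only: coeff_sum c)
    also have "\<dots> = (if i \<le> n then int (gauss (CARD('a)) n i) else 0)" by simp
    finally show ?thesis .
  qed
  then show ?thesis
    unfolding palindromic_iff n_def[symmetric]
    using gauss_symmetric[OF CARD_ge_2, of _ n] by simp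
qed

text \<open>Identifies (-1)^k q^(k choose 2) as the Moebius function of intervals of length k in the
  subspace lattice. For q = 2 its absolute value is \<open>u_coeff k\<close>.\<close>

lemma sum_interval_moebius:
  assumes "U \<in> Sub" "F \<in> Sub" "U \<subseteq> F"
  shows "(\<Sum>Z\<in>interval U F. (- 1) ^ (dim F - dim Z) * int (CARD('a)) ^ ((dim F - dim Z) choose 2))
    = (if U = F then 1 else 0)"
proof -
  let ?n = "dim F - dim U" and ?q = "CARD('a)"
  let ?f = "\<lambda>k. (- 1) ^ k * int ?q ^ (k choose 2)"
  have "(\<Sum>Z\<in>interval U F. ?f (dim F - dim Z)) = (\<Sum>Z\<in>interval U F. ?f (?n - (dim Z - dim U)))"
    using interval_dim_le[OF assms(1,2)] by (intro sum.cong refl) (simp add: diff_diff_eq)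
  also have "\<dots> = (\<Sum>k\<le>?n. int (gauss ?q ?n k) * ?f (?n - k))"
    using sum_interval[OF assms, of "\<lambda>k. ?f (?n - k)"] by simp
  also have "\<dots> = (\<Sum>k\<le>?n. int (gauss ?q ?n (?n - k)) * ?f (?n - k))"
    by (intro sum.cong refl) (simp add: gauss_symmetric[OF CARD_ge_2] del: diff_diff_left)
  also have "\<dots> = (\<Sum>k\<le>?n. int (gauss ?q ?n k) * ?f k)"
    by (rule sum.reindex_bij_witness[of _ "\<lambda>k. ?n - k" "\<lambda>k. ?n - k"]) auto
  also have "\<dots> = (\<Sum>k\<le>?n. (- 1) ^ k * int ?q ^ (k choose 2) * int (gauss ?q ?n k))"
    by (intro sum.cong refl) (simp only: mult_ac)
  also have "\<dots> = (if ?n = 0 then 1 else 0)"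
    by (rule alternating_sum_gauss)
  also have "(?n = 0) = (U = F)" using dim_eq[OF assms] by auto
  finally show ?thesis .
qed

section \<open>Matroids represented by vectors\<close>

text \<open>A vector that enlarges the span of the bigger set also enlarges that of the smaller one.
  Taking A as the image of an intersection yields submodularity of the rank.\<close>

lemma dim_Un_diminishing:
  assumes "A \<subseteq> B" "B \<subseteq> Y" "finite X" "X \<subseteq> Y"
  shows "dim (B \<union> X) + dim A \<le> dim (A \<union> X) + dim B"
  using assms(3,4)
proof (induction X)
  case (insert x X)
  have "A \<union> X \<subseteq> Y" "B \<union> X \<subseteq> Y" "x \<in> Y" using insert assms by auto
  then have "dim (A \<union> insert x X) = (if x \<in> span (A \<union> X) then dim (A \<union> X) else Suc (dim (A \<union> X)))"
    "dim (B \<union> insert x X) = (if x \<in> span (B \<union> X) then dim (B \<union> X) else Suc (dim (B \<union> X)))"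
    by (simp_all add: dim_insert)
  moreover have "span (A \<union> X) \<subseteq> span (B \<union> X)" using assms by (intro span_mono) auto
  ultimately show ?case using insert by (auto split: if_splits)
qed simp

section \<open>The lattice of subspaces spanned by their points\<close>

definition spanned :: "'b set \<Rightarrow> 'b set \<Rightarrow> 'b set" where
  "spanned K U = span (K \<inter> U)"

text \<open>Encodes a flat by the subspace that it spans; \<open>flats_represents\<close> shows that
  these subspaces account for all flats.\<close>

definition lat :: "'b set \<Rightarrow> 'b set set" where
  "lat K = {U \<in> Sub. spanned K U = U}"

lemma lat_Sub: "U \<in> lat K \<Longrightarrow> U \<in> Sub"
  by (simp add: lat_def)

lemma spanned_lat: "U \<in> lat K \<Longrightarrow> spanned K U = U"
  by (simp add: lat_def)

lemma finite_lat: "finite (lat K)"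
  using finite_Sub by (simp add: lat_def)

lemma spanned_subset: "U \<in> Sub \<Longrightarrow> spanned K U \<subseteq> U"
  unfolding spanned_def by (rule span_le_Sub) auto

lemma spanned_Sub: "U \<in> Sub \<Longrightarrow> spanned K U \<in> Sub"
  unfolding spanned_def by (rule span_in_Sub) (auto dest: SubD)

lemma Int_spanned: "U \<in> Sub \<Longrightarrow> K \<inter> spanned K U = K \<inter> U"
  using spanned_subset[of U K] by (auto simp: spanned_def intro: span_base)

lemma spanned_in_lat: "U \<in> Sub \<Longrightarrow> spanned K U \<in> lat K"
  using Int_spanned[of U K] spanned_Sub[of U K] by (simp add: lat_def) (simp add: spanned_def)

lemma spanned_mono: "U \<subseteq> V \<Longrightarrow> spanned K U \<subseteq> spanned K V"
  unfolding spanned_def by (rule span_mono) auto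

text \<open>\<open>spanned K\<close> is right adjoint to the inclusion of \<open>lat K\<close> into
  the lattice of all subspaces. In particular \<open>spanned K U\<close> is the largest member of
  \<open>lat K\<close> below U.\<close>

lemma lat_le_spanned_iff: "G \<in> lat K \<Longrightarrow> U \<in> Sub \<Longrightarrow> G \<subseteq> spanned K U \<longleftrightarrow> G \<subseteq> U"
  using spanned_mono[of G U K] spanned_subset[of U K] by (auto simp: lat_def)

lemma zero_in_lat: "{0} \<in> lat K"
proof -
  have "K \<inter> {0} \<subseteq> {0}" by auto
  then have "span (K \<inter> {0}) \<subseteq> span {0}" by (rule span_mono)
  then show ?thesis using zero_in_Sub Sub_zero[OF spanned_Sub[OF zero_in_Sub]]
    by (auto simp: lat_def spanned_def)
qed

text \<open>\<open>P U V\<close> stands for the Kazhdan--Lusztig polynomial of the interval from U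
  to V. Characteristic polynomials are replaced by palindromicity, so that the push-forward argument
  can be carried out with subspaces only.\<close>

definition KL_family :: "'b set set \<Rightarrow> ('b set \<Rightarrow> 'b set \<Rightarrow> int poly) \<Rightarrow> bool" where
  "KL_family L P \<longleftrightarrow> (\<forall>U\<in>L. P U U = 1) \<and>
     (\<forall>U\<in>L. \<forall>V\<in>L. U \<subset> V \<longrightarrow> 2 * degree (P U V) < dim V - dim U) \<and>
     (\<forall>U\<in>L. \<forall>V\<in>L. U \<subseteq> V \<longrightarrow> palindromic (dim V - dim U)
        (\<Sum>Z\<in>{Z \<in> L. U \<subseteq> Z \<and> Z \<subseteq> V}. monom 1 (dim Z - dim U) * P Z V))"

definition inv_KL_family ::
    "'b set set \<Rightarrow> ('b set \<Rightarrow> 'b set \<Rightarrow> int poly) \<Rightarrow> ('b set \<Rightarrow> 'b set \<Rightarrow> int poly) \<Rightarrow> bool" where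
  "inv_KL_family L P Q \<longleftrightarrow> (\<forall>U\<in>L. Q U U = 1) \<and>
     (\<forall>U\<in>L. \<forall>V\<in>L. U \<subset> V \<longrightarrow>
        (\<Sum>Z\<in>{Z \<in> L. U \<subseteq> Z \<and> Z \<subseteq> V}. (- 1) ^ (dim Z - dim U) * P U Z * Q Z V) = 0)"

text \<open>The set \<open>K\<close> may contain further multiples of the representing vectors, so that it can be
  chosen as the cone over a set of projective points.\<close>

definition represents :: "'e matroid_data \<Rightarrow> ('e \<Rightarrow> 'b) \<Rightarrow> 'b set \<Rightarrow> bool" where
  "represents M v K \<longleftrightarrow> finite (ground M) \<and> v ` ground M \<subseteq> K \<and> K \<subseteq> Y \<and> 0 \<notin> K \<and>
     (\<forall>x\<in>K. \<exists>e\<in>ground M. x \<in> span {v e}) \<and> (\<forall>S\<subseteq>ground M. rk M S = dim (v ` S))"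

definition pts :: "'e matroid_data \<Rightarrow> ('e \<Rightarrow> 'b) \<Rightarrow> 'b set \<Rightarrow> 'e set" where
  "pts M v U = {e \<in> ground M. v e \<in> U}"

text \<open>The matroid of the interval from U to V. Contracting or restricting it again gives a
  matroid of the same form, by \<open>contract_minor\<close> and
  \<open>restrict_minor\<close>.\<close>

definition minor :: "'e matroid_data \<Rightarrow> ('e \<Rightarrow> 'b) \<Rightarrow> 'b set \<Rightarrow> 'b set \<Rightarrow> 'e matroid_data" where
  "minor M v U V = contract (restrict_to M (pts M v V)) (pts M v U)"

lemma represents_matroid:
  assumes "represents M v K" shows "matroid M"
proof -
  have fin: "finite S" and Y: "v ` S \<subseteq> Y" if "S \<subseteq> ground M" for S
    using assms that by (auto simp: represents_def intro: finite_subset)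
  have r: "rk M S = dim (v ` S)" if "S \<subseteq> ground M" for S
    using assms that by (simp add: represents_def)
  show ?thesis
    unfolding matroid_def
  proof (intro conjI allI impI)
    show "finite (ground M)" using assms by (simp add: represents_def)
  next
    fix S assume S: "S \<subseteq> ground M"
    have "dim (v ` S) \<le> card S"
      using dim_le_card[OF span_superset, of "v ` S"] card_image_le[of S v] fin[OF S] by simp
    then show "rk M S \<le> card S" by (simp add: r S)
  next
    fix S T assume "S \<subseteq> T \<and> T \<subseteq> ground M"
    then have "S \<subseteq> T" "S \<subseteq> ground M" "T \<subseteq> ground M" by auto
    moreover from this have "dim (span (v ` S)) \<le> dim (span (v ` T))"
      by (intro dim_mono span_in_Sub span_mono Y image_mono)
    ultimately show "rk M S \<le> rk M T" by (simp add: r)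
  next
    fix S T assume ST: "S \<subseteq> ground M \<and> T \<subseteq> ground M"
    have "v ` T \<union> v ` S = v ` (S \<union> T)" "v ` (S \<inter> T) \<union> v ` S = v ` S" by auto
    then have "dim (v ` (S \<union> T)) + dim (v ` (S \<inter> T)) \<le> dim (v ` S) + dim (v ` T)"
      using dim_Un_diminishing[of "v ` (S \<inter> T)" "v ` T" "v ` S"] Y fin ST by (simp add: image_mono)
    moreover have "S \<union> T \<subseteq> ground M" "S \<inter> T \<subseteq> ground M" using ST by auto
    ultimately show "rk M (S \<union> T) + rk M (S \<inter> T) \<le> rk M S + rk M T" using ST by (simp add: r)
  qed
qed

lemma span_pts:
  assumes "represents M v K" "U \<in> Sub"
  shows "span (v ` pts M v U) = spanned K U"
proof -
  have "v ` pts M v U \<subseteq> K \<inter> U" using assms by (auto simp: represents_def pts_def)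
  moreover have "x \<in> span (v ` pts M v U)" if x: "x \<in> K \<inter> U" for x
  proof -
    have "x \<noteq> 0" using x assms(1) by (auto simp: represents_def)
    obtain e where e: "e \<in> ground M" "x \<in> span {v e}"
      using x assms(1) by (auto simp: represents_def)
    then obtain k where k: "x = scale k (v e)" by (auto simp: span_singleton)
    with \<open>x \<noteq> 0\<close> have "v e = scale (1 / k) x" by auto
    then have "v e \<in> U" using x SubD(1)[OF assms(2)] by (simp add: subspace_scale)
    then have "v e \<in> span (v ` pts M v U)" using e by (intro span_base) (simp add: pts_def)
    then show ?thesis unfolding k by (rule span_scale)
  qed
  ultimately have "v ` pts M v U \<subseteq> span (K \<inter> U)" "K \<inter> U \<subseteq> span (v ` pts M v U)"
    using span_superset[of "K \<inter> U"] by blast+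
  then show ?thesis unfolding spanned_def by (simp add: span_eq)
qed

lemma rk_pts:
  assumes "represents M v K" "U \<in> lat K"
  shows "rk M (pts M v U) = dim U"
proof -
  have "rk M (pts M v U) = dim (v ` pts M v U)"
    using assms by (auto simp: represents_def pts_def)
  also have "\<dots> = dim (span (v ` pts M v U))" by simp
  also have "\<dots> = dim U" using span_pts[OF assms(1) lat_Sub[OF assms(2)]] spanned_lat[OF assms(2)] by simp
  finally show ?thesis .
qed

lemma pts_subset_iff:
  assumes "represents M v K" "U \<in> lat K" "V \<in> Sub"
  shows "pts M v U \<subseteq> pts M v V \<longleftrightarrow> U \<subseteq> V"
proof
  assume "pts M v U \<subseteq> pts M v V"
  then have "span (v ` pts M v U) \<subseteq> span (v ` pts M v V)" by (intro span_mono image_mono)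
  then have "spanned K U \<subseteq> spanned K V"
    by (simp only: span_pts[OF assms(1) lat_Sub[OF assms(2)]] span_pts[OF assms(1,3)])
  then show "U \<subseteq> V"
    using spanned_subset[OF assms(3), of K] spanned_lat[OF assms(2)] by (metis order_trans)
qed (auto simp: pts_def)

text \<open>Adding x raises the rank exactly if \<open>v x\<close> lies outside the span of the
  vectors already present, so a flat consists of all ground elements whose vectors lie in its
  span.\<close>

lemma flats_represents:
  assumes M: "represents M v K" shows "flats M = pts M v ` lat K"
proof -
  have rk_insert: "rk M F < rk M (insert x F) \<longleftrightarrow> v x \<notin> span (v ` F)"
    if "F \<subseteq> ground M" "x \<in> ground M" for F x
  proof -
    have "v ` F \<subseteq> Y" "v x \<in> Y" using M that by (auto simp: represents_def)
    then show ?thesis using M that dim_insert[of "v ` F" "v x"] by (simp add: represents_def)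
  qed
  show ?thesis
  proof (intro set_eqI iffI)
    fix F assume F: "F \<in> flats M"
    let ?U = "span (v ` F)"
    have "F \<subseteq> ground M" using F by (rule flats_subset)
    moreover from this have "v ` F \<subseteq> K" using M by (auto simp: represents_def)
    moreover from this have "v ` F \<subseteq> Y" using M by (auto simp: represents_def)
    moreover have "e \<in> F" if "e \<in> ground M" "v e \<in> ?U" for e
      using F that rk_insert[of F e] \<open>F \<subseteq> ground M\<close> by (auto simp: flats_def)
    ultimately have "F = pts M v ?U" "v ` F \<subseteq> K \<inter> ?U" "?U \<in> Sub"
      by (auto simp: pts_def intro: span_base span_in_Sub)
    moreover from this have "?U \<in> lat K"
      using spanned_subset[of ?U K] span_mono[of "v ` F" "K \<inter> ?U"] by (auto simp: lat_def spanned_def)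
    ultimately show "F \<in> pts M v ` lat K" by blast
  next
    fix F assume "F \<in> pts M v ` lat K"
    then obtain U where U: "U \<in> lat K" "F = pts M v U" by blast
    then have "span (v ` F) = U" using span_pts[OF M lat_Sub[OF U(1)]] spanned_lat[OF U(1)] by simp
    then show "F \<in> flats M" using U rk_insert[of F] by (auto simp: flats_def pts_def)
  qed
qed

lemma pts_zero:
  assumes "represents M v K" shows "pts M v {0} = {}"
  using assms by (auto simp: represents_def pts_def)

section \<open>Minors of a represented matroid\<close>

context
  fixes M :: "'e matroid_data" and v K
  assumes M: "represents M v K"
begin

lemma pts_in_flats: "U \<in> lat K \<Longrightarrow> pts M v U \<in> flats M"
  using flats_represents[OF M] by blast

lemma matroid_minor:
  assumes "U \<in> lat K" "V \<in> lat K" "U \<subseteq> V"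
  shows "matroid (minor M v U V)"
proof -
  have "matroid (restrict_to M (pts M v V))"
    using represents_matroid[OF M] by (rule matroid_restrict_to) (auto simp: pts_def)
  then show ?thesis
    unfolding minor_def using assms by (intro matroid_contract) (auto simp: pts_def)
qed

lemma flats_minor:
  assumes "U \<in> lat K" "V \<in> lat K" "U \<subseteq> V"
  shows "flats (minor M v U V) = (\<lambda>Z. pts M v Z - pts M v U) ` {Z \<in> lat K. U \<subseteq> Z \<and> Z \<subseteq> V}"
proof -
  have mM: "matroid M" using M by (rule represents_matroid)
  have "pts M v V \<subseteq> ground M" by (auto simp: pts_def)
  then have mR: "matroid (restrict_to M (pts M v V))" by (rule matroid_restrict_to[OF mM])
  have "pts M v U \<subseteq> ground (restrict_to M (pts M v V))" using assms by (auto simp: pts_def)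
  then have "flats (minor M v U V) = (\<lambda>G. G - pts M v U) `
      {G \<in> flats (restrict_to M (pts M v V)). pts M v U \<subseteq> G}"
    unfolding minor_def by (rule flats_contract[OF mR])
  also have "{G \<in> flats (restrict_to M (pts M v V)). pts M v U \<subseteq> G}
      = pts M v ` {Z \<in> lat K. U \<subseteq> Z \<and> Z \<subseteq> V}"
    unfolding flats_restrict_to[OF mM pts_in_flats[OF assms(2)]] flats_represents[OF M]
    using pts_subset_iff[OF M _ lat_Sub] assms by auto
  finally show ?thesis by (simp add: image_image)
qed

lemma inj_on_minor:
  assumes "U \<in> lat K"
  shows "inj_on (\<lambda>Z. pts M v Z - pts M v U) {Z \<in> lat K. U \<subseteq> Z \<and> Z \<subseteq> V}"
proof (rule inj_onI)
  fix Z Z' assume Z: "Z \<in> {Z \<in> lat K. U \<subseteq> Z \<and> Z \<subseteq> V}" "Z' \<in> {Z \<in> lat K. U \<subseteq> Z \<and> Z \<subseteq> V}"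
    and eq: "pts M v Z - pts M v U = pts M v Z' - pts M v U"
  have "pts M v U \<subseteq> pts M v Z" "pts M v U \<subseteq> pts M v Z'" using Z by (auto simp: pts_def)
  with eq have "pts M v Z = pts M v Z'" by blast
  then show "Z = Z'" using pts_subset_iff[OF M _ lat_Sub] Z by blast
qed

lemma rk_minor:
  assumes "U \<in> lat K" "Z \<in> lat K" "U \<subseteq> Z"
  shows "rk (minor M v U V) (pts M v Z - pts M v U) = dim Z - dim U"
proof -
  have "pts M v Z - pts M v U \<union> pts M v U = pts M v Z" using assms by (auto simp: pts_def)
  then show ?thesis using rk_pts[OF M] assms by (simp add: minor_def)
qed

lemma rank_minor:
  assumes "U \<in> lat K" "V \<in> lat K" "U \<subseteq> V"
  shows "matroid_rank (minor M v U V) = dim V - dim U"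
  using rk_minor[of U V V] assms by (simp add: matroid_rank_def minor_def)

lemma contract_minor:
  assumes "U \<in> lat K" "V \<in> lat K" "Z \<in> lat K" "U \<subseteq> Z" "Z \<subseteq> V"
  shows "contract (minor M v U V) (pts M v Z - pts M v U) = minor M v Z V"
proof -
  have "matroid (restrict_to M (pts M v V))"
    using represents_matroid[OF M] by (rule matroid_restrict_to) (auto simp: pts_def)
  then show ?thesis
    unfolding minor_def using assms by (intro contract_contract) (auto simp: pts_def)
qed

lemma restrict_minor: "restrict_to (minor M v U V) (pts M v Z - pts M v U) = minor M v U Z"
  by (simp add: minor_def restrict_to_def contract_def)

lemma loopless_minor:
  assumes "U \<in> lat K" "V \<in> lat K" "U \<subseteq> V"
  shows "{} \<in> flats (minor M v U V)"
  unfolding flats_minor[OF assms] using assms by (intro image_eqI[of _ _ U]) auto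

lemma KL_family_represents: "KL_family (lat K) (\<lambda>U V. KL_poly (minor M v U V))"
  unfolding KL_family_def
proof (intro conjI ballI impI)
  fix U assume "U \<in> lat K"
  then show "KL_poly (minor M v U U) = 1" by (intro KL_poly_rank_0) (simp add: rank_minor)
next
  fix U V assume UV: "U \<in> lat K" "V \<in> lat K" "U \<subset> V"
  then have "0 < matroid_rank (minor M v U V)"
    using dim_less[of U V] lat_Sub by (simp add: rank_minor)
  then show "2 * degree (KL_poly (minor M v U V)) < dim V - dim U"
    using KL_poly_palindromic[OF matroid_minor loopless_minor, of U V] UV rank_minor[of U V] by auto
next
  fix U V assume UV: "U \<in> lat K" "V \<in> lat K" "U \<subseteq> V"
  have "(\<Sum>F\<in>flats (minor M v U V). monom 1 (rk (minor M v U V) F) * KL_poly (contract (minor M v U V) F))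
      = (\<Sum>Z\<in>{Z \<in> lat K. U \<subseteq> Z \<and> Z \<subseteq> V}. monom 1 (dim Z - dim U) * KL_poly (minor M v Z V))"
    unfolding flats_minor[OF UV] using UV
    by (subst sum.reindex[OF inj_on_minor]) (auto simp: rk_minor contract_minor intro!: sum.cong)
  then show "palindromic (dim V - dim U)
      (\<Sum>Z\<in>{Z \<in> lat K. U \<subseteq> Z \<and> Z \<subseteq> V}. monom 1 (dim Z - dim U) * KL_poly (minor M v Z V))"
    using KL_poly_palindromic[OF matroid_minor loopless_minor, of U V] UV rank_minor[OF UV] by simp
qed

lemma inv_KL_family_represents:
  "inv_KL_family (lat K) (\<lambda>U V. KL_poly (minor M v U V)) (\<lambda>U V. inv_KL_poly (minor M v U V))"
  unfolding inv_KL_family_def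
proof (intro conjI ballI impI)
  fix U assume "U \<in> lat K"
  then show "inv_KL_poly (minor M v U U) = 1" by (intro inv_KL_poly_rank_0) (simp add: rank_minor)
next
  fix U V assume UV: "U \<in> lat K" "V \<in> lat K" "U \<subset> V"
  then have UV': "U \<subseteq> V" by simp
  have pos: "0 < matroid_rank (minor M v U V)"
    using UV dim_less[of U V] lat_Sub by (simp add: rank_minor)
  have "(\<Sum>F\<in>flats (minor M v U V). (- 1) ^ rk (minor M v U V) F *
        KL_poly (restrict_to (minor M v U V) F) * inv_KL_poly (contract (minor M v U V) F))
      = (\<Sum>Z\<in>{Z \<in> lat K. U \<subseteq> Z \<and> Z \<subseteq> V}. (- 1) ^ (dim Z - dim U) *
        KL_poly (minor M v U Z) * inv_KL_poly (minor M v Z V))"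
    unfolding flats_minor[OF UV(1,2) UV'] using UV
    by (subst sum.reindex[OF inj_on_minor])
      (auto simp: rk_minor contract_minor restrict_minor intro!: sum.cong)
  then show "(\<Sum>Z\<in>{Z \<in> lat K. U \<subseteq> Z \<and> Z \<subseteq> V}. (- 1) ^ (dim Z - dim U) *
        KL_poly (minor M v U Z) * inv_KL_poly (minor M v Z V)) = 0"
    using sum_KL_inv_KL[OF matroid_minor loopless_minor pos] UV UV' by simp
qed

lemma minor_zero: "minor M v {0} V = restrict_to M (pts M v V)"
proof -
  have "matroid (restrict_to M (pts M v V))"
    using represents_matroid[OF M] by (rule matroid_restrict_to) (auto simp: pts_def)
  then show ?thesis by (simp add: minor_def pts_zero[OF M] contract_empty)
qed

lemma minor_zero_top: "minor M v {0} Y = M"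
proof -
  have "pts M v Y = ground M" using M by (auto simp: pts_def represents_def)
  then show ?thesis unfolding minor_zero by (cases M) (simp add: restrict_to_def)
qed

end

section \<open>Pushing forward along the span of the represented points\<close>

text \<open>The value at A of the push-forward, along \<open>spanned K\<close>, of the function that
  is 1 on the subspaces of F.\<close>

definition fibre_sum :: "'b set \<Rightarrow> 'b set \<Rightarrow> 'b set \<Rightarrow> int poly" where
  "fibre_sum K F A = (\<Sum>U\<in>{U \<in> Sub. U \<subseteq> F \<and> spanned K U = A}. monom 1 (dim U - dim A))"

text \<open>By \<open>fibre_sum_expansion\<close> below, \<open>push_coeff K Q G F\<close> is the coefficient of the
  Kazhdan--Lusztig basis element of \<open>G\<close> in the push-forward of the function 1 on the subspaces
  of \<open>F\<close>, if \<open>Q\<close> is the family of inverse Kazhdan--Lusztig polynomials.\<close>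

definition push_coeff ::
    "'b set \<Rightarrow> ('b set \<Rightarrow> 'b set \<Rightarrow> int poly) \<Rightarrow> 'b set \<Rightarrow> 'b set \<Rightarrow> int poly" where
  "push_coeff K Q G F = (\<Sum>U\<in>{U \<in> Sub. U \<subseteq> F \<and> G \<subseteq> spanned K U}.
     monom ((- 1) ^ (dim (spanned K U) - dim G)) (dim U - dim (spanned K U)) * Q G (spanned K U))"

lemma KL_familyD:
  assumes "KL_family L P"
  shows "U \<in> L \<Longrightarrow> P U U = 1"
    and "U \<in> L \<Longrightarrow> V \<in> L \<Longrightarrow> U \<subset> V \<Longrightarrow> 2 * degree (P U V) < dim V - dim U"
    and "U \<in> L \<Longrightarrow> V \<in> L \<Longrightarrow> U \<subseteq> V \<Longrightarrow> palindromic (dim V - dim U)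
        (\<Sum>Z\<in>{Z \<in> L. U \<subseteq> Z \<and> Z \<subseteq> V}. monom 1 (dim Z - dim U) * P Z V)"
  using assms by (simp_all add: KL_family_def)

lemma inv_KL_family_sum:
  assumes "inv_KL_family L P Q" "KL_family L P" "U \<in> L" "V \<in> L" "U \<subseteq> V"
  shows "(\<Sum>Z\<in>{Z \<in> L. U \<subseteq> Z \<and> Z \<subseteq> V}. (- 1) ^ (dim Z - dim U) * P U Z * Q Z V)
    = (if U = V then 1 else 0)"
proof (cases "U = V")
  case True
  then have "{Z \<in> L. U \<subseteq> Z \<and> Z \<subseteq> V} = {V}" using assms by auto
  then show ?thesis using True assms by (simp add: KL_family_def inv_KL_family_def)
next
  case False
  then show ?thesis using assms by (auto simp: inv_KL_family_def)
qed

lemma dim_lat_mono: "U \<in> lat K \<Longrightarrow> V \<in> lat K \<Longrightarrow> U \<subseteq> V \<Longrightarrow> dim U \<le> dim V"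
  by (intro dim_mono lat_Sub)

context
  fixes K :: "'b set" and P Q :: "'b set \<Rightarrow> 'b set \<Rightarrow> int poly"
  assumes KL: "KL_family (lat K) P" and inv: "inv_KL_family (lat K) P Q"
begin

text \<open>After inserting the definition of \<open>push_coeff\<close> and summing over U last, the
  inner sum over G between A and \<open>spanned K U\<close> is, up to a common sign, the inverse
  relation of P and Q. It leaves only the U with \<open>spanned K U = A\<close>.\<close>

lemma fibre_sum_expansion:
  assumes A: "A \<in> lat K" and F: "F \<in> Sub"
  shows "fibre_sum K F A
    = (\<Sum>G\<in>{G \<in> lat K. A \<subseteq> G \<and> G \<subseteq> F}. push_coeff K Q G F * P A G)"
proof -
  let ?h = "spanned K"
  let ?G = "{G \<in> lat K. A \<subseteq> G \<and> G \<subseteq> F}" and ?U = "{U \<in> Sub. U \<subseteq> F}"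
  let ?t = "\<lambda>G U. monom ((- 1) ^ (dim (?h U) - dim G)) (dim U - dim (?h U)) * Q G (?h U) * P A G"
  have "(\<Sum>G\<in>?G. push_coeff K Q G F * P A G) = (\<Sum>G\<in>?G. \<Sum>U\<in>{U. U \<in> ?U \<and> G \<subseteq> ?h U}. ?t G U)"
    unfolding push_coeff_def sum_distrib_right by (intro sum.cong) auto
  also have "\<dots> = (\<Sum>U\<in>?U. \<Sum>G\<in>{G. G \<in> ?G \<and> G \<subseteq> ?h U}. ?t G U)"
    using finite_lat finite_Sub by (intro sum.swap_restrict) auto
  also have "\<dots> = (\<Sum>U\<in>?U. if ?h U = A then monom 1 (dim U - dim A) else 0)"
  proof (intro sum.cong refl)
    fix U assume U: "U \<in> ?U"
    then have hU: "?h U \<in> lat K" "?h U \<subseteq> F"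
      using spanned_in_lat spanned_subset[of U K] by auto
    show "(\<Sum>G\<in>{G. G \<in> ?G \<and> G \<subseteq> ?h U}. ?t G U) = (if ?h U = A then monom 1 (dim U - dim A) else 0)"
    proof (cases "A \<subseteq> ?h U")
      case False
      then have "{G. G \<in> ?G \<and> G \<subseteq> ?h U} = {}" by auto
      then show ?thesis using False by (metis (no_types, lifting) order_refl sum.empty)
    next
      case True
      have "{G. G \<in> ?G \<and> G \<subseteq> ?h U} = {G \<in> lat K. A \<subseteq> G \<and> G \<subseteq> ?h U}" using hU by auto
      moreover have "?t G U = monom ((- 1) ^ (dim (?h U) - dim A)) (dim U - dim (?h U)) *
          ((- 1) ^ (dim G - dim A) * P A G * Q G (?h U))"
        if G: "G \<in> {G \<in> lat K. A \<subseteq> G \<and> G \<subseteq> ?h U}" for G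
      proof -
        have "dim A \<le> dim G" "dim G \<le> dim (?h U)"
          using G A hU dim_lat_mono[of A K G] dim_lat_mono[of G K "?h U"] by auto
        then have "(dim (?h U) - dim A) + (dim G - dim A) = (dim (?h U) - dim G) + 2 * (dim G - dim A)"
          by simp
        then have "(- 1 :: int) ^ (dim (?h U) - dim A) * (- 1) ^ (dim G - dim A)
            = (- 1) ^ (dim (?h U) - dim G)"
          by (metis (no_types) power_add power_mult power2_minus power_one mult.right_neutral)
        then have "monom ((- 1) ^ (dim (?h U) - dim G)) (dim U - dim (?h U))
            = (- 1) ^ (dim G - dim A) * monom ((- 1 :: int) ^ (dim (?h U) - dim A)) (dim U - dim (?h U))"
          by (simp add: minus_one_poly_power smult_monom mult.commute)
        then show ?thesis by (simp only: mult_ac)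
      qed
      ultimately have "(\<Sum>G\<in>{G. G \<in> ?G \<and> G \<subseteq> ?h U}. ?t G U)
        = monom ((- 1) ^ (dim (?h U) - dim A)) (dim U - dim (?h U)) *
          (\<Sum>G\<in>{G \<in> lat K. A \<subseteq> G \<and> G \<subseteq> ?h U}. (- 1) ^ (dim G - dim A) * P A G * Q G (?h U))"
        unfolding sum_distrib_left by (intro sum.cong) simp_all
      then show ?thesis using inv_KL_family_sum[OF inv KL A hU(1) True] by auto
    qed
  qed
  also have "\<dots> = fibre_sum K F A"
    unfolding fibre_sum_def using finite_Sub
    by (simp add: sum.inter_filter[symmetric] conj_ac)
  finally show ?thesis by simp
qed

text \<open>The expansion is triangular with diagonal entries \<open>P A A = 1\<close>, so the
  coefficients can be computed from the larger G downwards.\<close>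

lemma push_coeff_eq:
  assumes A: "A \<in> lat K" and F: "F \<in> Sub" "A \<subseteq> F"
  shows "push_coeff K Q A F
    = fibre_sum K F A - (\<Sum>G\<in>{G \<in> lat K. A \<subset> G \<and> G \<subseteq> F}. push_coeff K Q G F * P A G)"
proof -
  have "{G \<in> lat K. A \<subseteq> G \<and> G \<subseteq> F} = insert A {G \<in> lat K. A \<subset> G \<and> G \<subseteq> F}"
    using A F by auto
  then show ?thesis
    using fibre_sum_expansion[OF A F(1)] KL_familyD(1)[OF KL A] finite_lat[of K] by simp
qed

text \<open>The sum of t^(dim U - dim G) over G \<subseteq> U \<subseteq> F is palindromic by the
  symmetry of Gaussian binomials. Grouping it by \<open>spanned K U\<close> and expanding each fibre
  sum gives the sum over G' of \<open>push_coeff K Q G' F\<close> times the palindromic Z-polynomial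
  of the interval from G to G'. Induction covers all G' \<noteq> G, and the term of G is the
  coefficient itself.\<close>

lemma palindromic_push_coeff:
  assumes "G \<in> lat K" "F \<in> Sub" "G \<subseteq> F"
  shows "palindromic (dim F - dim G) (push_coeff K Q G F)"
  using assms(1,3)
proof (induction "dim F - dim G" arbitrary: G rule: less_induct)
  case less
  note G = less.prems
  let ?h = "spanned K"
  let ?L = "{A \<in> lat K. G \<subseteq> A \<and> A \<subseteq> F}"
  let ?Z = "\<lambda>G'. \<Sum>A\<in>{A \<in> lat K. G \<subseteq> A \<and> A \<subseteq> G'}. monom 1 (dim A - dim G) * P A G'"
  have "(\<Sum>U\<in>interval G F. monom (1::int) (dim U - dim G))
      = (\<Sum>A\<in>?L. \<Sum>U\<in>{U \<in> interval G F. ?h U = A}. monom 1 (dim U - dim G))"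
  proof (intro sum.group[symmetric] finite_interval)
    show "?h ` interval G F \<subseteq> ?L"
    proof
      fix A assume "A \<in> ?h ` interval G F"
      then obtain U where U: "U \<in> Sub" "G \<subseteq> U" "U \<subseteq> F" "A = ?h U" by (auto simp: interval_def)
      then show "A \<in> ?L"
        using spanned_in_lat[of U K] spanned_subset[of U K] lat_le_spanned_iff[OF G(1), of U] by auto
    qed
  qed (use finite_lat in auto)
  also have "\<dots> = (\<Sum>A\<in>?L. monom 1 (dim A - dim G) * fibre_sum K F A)"
  proof (intro sum.cong refl)
    fix A assume A: "A \<in> ?L"
    have "{U \<in> interval G F. ?h U = A} = {U \<in> Sub. U \<subseteq> F \<and> ?h U = A}"
      using A spanned_subset[of _ K] unfolding interval_def by blast
    moreover have "monom (1::int) (dim U - dim G) = monom 1 (dim A - dim G) * monom 1 (dim U - dim A)"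
      if "U \<in> Sub" "U \<subseteq> F" "?h U = A" for U
    proof -
      have "dim G \<le> dim A" "dim A \<le> dim U"
        using A G that dim_lat_mono[of G K A] dim_mono[of A U] spanned_subset[of U K] lat_Sub by auto
      then show ?thesis by (simp add: mult_monom)
    qed
    ultimately show "(\<Sum>U\<in>{U \<in> interval G F. ?h U = A}. monom 1 (dim U - dim G))
        = monom 1 (dim A - dim G) * fibre_sum K F A"
      unfolding fibre_sum_def sum_distrib_left by (intro sum.cong) auto
  qed
  also have "\<dots> = (\<Sum>A\<in>?L. \<Sum>G'\<in>{G'. G' \<in> ?L \<and> A \<subseteq> G'}.
      monom 1 (dim A - dim G) * (push_coeff K Q G' F * P A G'))"
    by (intro sum.cong refl) (subst fibre_sum_expansion, auto simp: sum_distrib_left assms intro!: sum.cong)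
  also have "\<dots> = (\<Sum>G'\<in>?L. \<Sum>A\<in>{A. A \<in> ?L \<and> A \<subseteq> G'}.
      monom 1 (dim A - dim G) * (push_coeff K Q G' F * P A G'))"
    using finite_lat by (intro sum.swap_restrict) auto
  also have "\<dots> = (\<Sum>G'\<in>?L. push_coeff K Q G' F * ?Z G')"
    unfolding sum_distrib_left by (intro sum.cong refl) (auto simp: mult_ac)
  also have "?L = insert G {A \<in> lat K. G \<subset> A \<and> A \<subseteq> F}" using G by auto
  also have "(\<Sum>G'\<in>insert G {A \<in> lat K. G \<subset> A \<and> A \<subseteq> F}. push_coeff K Q G' F * ?Z G')
      = push_coeff K Q G F + (\<Sum>G'\<in>{A \<in> lat K. G \<subset> A \<and> A \<subseteq> F}. push_coeff K Q G' F * ?Z G')"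
  proof -
    have "{A \<in> lat K. G \<subseteq> A \<and> A \<subseteq> G} = {G}" using G by auto
    then have "?Z G = 1" using KL_familyD(1)[OF KL G(1)] by simp
    then show ?thesis using finite_lat[of K] by simp
  qed
  finally have eq: "push_coeff K Q G F = (\<Sum>U\<in>interval G F. monom 1 (dim U - dim G))
      - (\<Sum>G'\<in>{A \<in> lat K. G \<subset> A \<and> A \<subseteq> F}. push_coeff K Q G' F * ?Z G')"
    by simp
  show ?case
    unfolding eq
  proof (rule palindromic_diff[OF _ palindromic_sum])
    show "palindromic (dim F - dim G) (\<Sum>U\<in>interval G F. monom 1 (dim U - dim G))"
      using G assms(2) lat_Sub by (intro palindromic_interval) auto
  next
    fix G' assume G': "G' \<in> {A \<in> lat K. G \<subset> A \<and> A \<subseteq> F}"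
    then have dims: "dim G < dim G'" "dim G' \<le> dim F"
      using G lat_Sub assms(2) dim_less[of G G'] dim_mono[of G' F] by auto
    then have "palindromic (dim F - dim G') (push_coeff K Q G' F)"
      using G' by (intro less.hyps) auto
    moreover have "palindromic (dim G' - dim G) (?Z G')"
      using G' G by (intro KL_familyD(3)[OF KL]) auto
    ultimately have "palindromic ((dim F - dim G') + (dim G' - dim G)) (push_coeff K Q G' F * ?Z G')"
      by (rule palindromic_mult)
    then show "palindromic (dim F - dim G) (push_coeff K Q G' F * ?Z G')" using dims by simp
  qed
qed

text \<open>\<open>push_coeff K Q {0} F\<close> is a sum, over the subspaces U of F, of terms that
  do not depend on F. Moebius inversion isolates the term of U = Y, and since the points span Y this
  term is \<open>Q {0} Y\<close> up to sign, without a power of t.\<close>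

lemma inv_KL_eq_sum_push_coeff:
  assumes "spanned K Y = Y"
  shows "Q {0} Y = (\<Sum>F\<in>Sub. smult ((- 1) ^ dim F * int (CARD('a)) ^ ((dim Y - dim F) choose 2))
    (push_coeff K Q {0} F))"
proof -
  let ?h = "spanned K" and ?R = "dim Y"
  let ?m = "\<lambda>F. (- 1) ^ dim F * int (CARD('a)) ^ ((?R - dim F) choose 2)"
  let ?g = "\<lambda>U. monom ((- 1) ^ dim (?h U)) (dim U - dim (?h U)) * Q {0} (?h U)"
  have "push_coeff K Q {0} F = (\<Sum>U\<in>{U. U \<in> Sub \<and> U \<subseteq> F}. ?g U)" for F
    unfolding push_coeff_def using Sub_zero[OF spanned_Sub]
    by (intro sum.cong) (auto simp: dim_zero)
  then have "(\<Sum>F\<in>Sub. smult (?m F) (push_coeff K Q {0} F))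
      = (\<Sum>F\<in>Sub. \<Sum>U\<in>{U. U \<in> Sub \<and> U \<subseteq> F}. smult (?m F) (?g U))"
    by (simp only: smult_sum_right)
  also have "\<dots> = (\<Sum>U\<in>Sub. \<Sum>F\<in>{F. F \<in> Sub \<and> U \<subseteq> F}. smult (?m F) (?g U))"
    using finite_Sub by (intro sum.swap_restrict)
  also have "\<dots> = (\<Sum>U\<in>Sub. smult (\<Sum>F\<in>interval U Y. ?m F) (?g U))"
    unfolding smult_sum by (intro sum.cong) (auto simp: interval_def Sub_def)
  also have "\<dots> = (\<Sum>U\<in>Sub. if U = Y then smult ((- 1) ^ ?R) (?g Y) else 0)"
  proof (intro sum.cong refl)
    fix U assume U: "U \<in> Sub"
    have "(\<Sum>F\<in>interval U Y. ?m F) = (\<Sum>F\<in>interval U Y.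
        (- 1) ^ ?R * ((- 1) ^ (?R - dim F) * int (CARD('a)) ^ ((?R - dim F) choose 2)))"
    proof (intro sum.cong refl)
      fix F assume "F \<in> interval U Y"
      then have "dim F \<le> ?R" using dim_mono[OF _ Y_in_Sub] by (auto simp: interval_def)
      then have "?R + (?R - dim F) = dim F + 2 * (?R - dim F)" by simp
      then have "(- 1 :: int) ^ ?R * (- 1) ^ (?R - dim F) = (- 1) ^ dim F"
        by (metis (no_types) power_add power_mult power2_minus power_one mult.right_neutral)
      then show "?m F = (- 1) ^ ?R * ((- 1) ^ (?R - dim F) * int (CARD('a)) ^ ((?R - dim F) choose 2))"
        by (simp only: mult.assoc[symmetric])
    qed
    also have "\<dots> = (- 1) ^ ?R * (if U = Y then 1 else 0)"
      unfolding sum_distrib_left[symmetric]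
      using sum_interval_moebius[OF U Y_in_Sub SubD(2)[OF U]] by simp
    finally show "smult (\<Sum>F\<in>interval U Y. ?m F) (?g U) = (if U = Y then smult ((- 1) ^ ?R) (?g Y) else 0)"
      by simp
  qed
  also have "\<dots> = smult ((- 1) ^ ?R) (?g Y)"
    using finite_Sub Y_in_Sub by simp
  also have "\<dots> = Q {0} Y"
    using assms by (simp add: monom_0 flip: power_add mult_2)
  finally show ?thesis by simp
qed

end

section \<open>Coefficients from the middle degree on\<close>

lemma degree_mult_le_of_halves:
  fixes p r :: "int poly"
  assumes "2 * degree p \<le> a" "2 * degree r < b" "a + b \<le> 2 * i"
  shows "coeff (p * r) i = 0"
  using assms degree_mult_le[of p r] by (intro coeff_eq_0) linarith

definition corank_one :: "'b set \<Rightarrow> bool" where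
  "corank_one K \<longleftrightarrow> (\<forall>U\<in>Sub. spanned K U \<noteq> {0} \<longrightarrow> dim U \<le> Suc (dim (spanned K U)))"

context
  fixes K :: "'b set" and P Q :: "'b set \<Rightarrow> 'b set \<Rightarrow> int poly"
  assumes KL: "KL_family (lat K) P" and inv: "inv_KL_family (lat K) P Q"
    and corank: "corank_one K"
begin

text \<open>No member of \<open>lat K\<close> lies strictly above \<open>spanned K F\<close> inside
  F, so the coefficient equals the fibre sum. The codimension bound leaves only F and its span in
  that fibre.\<close>

lemma push_coeff_spanned:
  assumes F: "F \<in> Sub" "spanned K F \<noteq> {0}"
  shows "push_coeff K Q (spanned K F) F = (if spanned K F = F then 1 else 1 + monom 1 1)"
proof -
  let ?H = "spanned K F"
  have H: "?H \<in> lat K" "?H \<subseteq> F" "?H \<in> Sub"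
    using spanned_in_lat spanned_subset spanned_Sub F by auto
  have empty: "{G \<in> lat K. ?H \<subset> G \<and> G \<subseteq> F} = {}"
    using lat_le_spanned_iff[OF _ F(1)] by blast
  have "push_coeff K Q ?H F = fibre_sum K F ?H"
    unfolding push_coeff_eq[OF KL inv H(1) F(1) H(2)] empty by simp
  moreover have "{U \<in> Sub. U \<subseteq> F \<and> spanned K U = ?H} = {?H, F}" (is "?L = _")
  proof
    show "?L \<subseteq> {?H, F}"
    proof
      fix U assume U: "U \<in> ?L"
      then have HU: "?H \<subseteq> U" using spanned_subset[of U K] by auto
      have "dim F \<le> Suc (dim ?H)" using corank F by (simp add: corank_one_def)
      then have "dim U \<le> dim ?H \<or> dim F \<le> dim U" using dim_mono[of ?H U] dim_mono[of U F] U H HU F by linarith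
      then show "U \<in> {?H, F}" using dim_eq[of ?H U] dim_eq[of U F] U H HU F by auto
    qed
    show "{?H, F} \<subseteq> ?L" using H F spanned_lat[OF H(1)] by auto
  qed
  ultimately have eq: "push_coeff K Q ?H F = (\<Sum>U\<in>{?H, F}. monom 1 (dim U - dim ?H))"
    by (simp add: fibre_sum_def)
  show ?thesis
  proof (cases "?H = F")
    case False
    then have "dim F = Suc (dim ?H)"
      using corank F dim_less[of ?H F] H by (fastforce simp: corank_one_def)
    then show ?thesis using eq False by simp
  qed (use eq in simp)
qed

text \<open>A subspace U with span G has dimension at most dim G + 1 and differs from F, which
  bounds the fibre sum. In the recursion the factor 1 + t of the span H costs one degree; this is
  compensated by the strict bound on \<open>P G H\<close> together with dim F \<le> dim H +
  1.\<close>

lemma degree_push_coeff: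
  assumes F: "F \<in> Sub" and G: "G \<in> lat K" "G \<noteq> {0}" "G \<subset> spanned K F"
  shows "2 * degree (push_coeff K Q G F) \<le> dim F - dim G"
  using G
proof (induction "dim F - dim G" arbitrary: G rule: less_induct)
  case less
  note G = less.prems
  let ?H = "spanned K F"
  have H: "?H \<in> lat K" "?H \<subseteq> F" "?H \<in> Sub"
    using spanned_in_lat spanned_subset spanned_Sub F by auto
  then have GF: "G \<subseteq> F" "G \<in> Sub" using G(3) lat_Sub[OF G(1)] by auto
  have H0: "?H \<noteq> {0}" using G Sub_zero[OF GF(2)] by auto
  have dims: "dim G < dim ?H" "dim ?H \<le> dim F" using dim_less[of G ?H] dim_mono[of ?H F] G H GF F by auto
  have "coeff (push_coeff K Q G F) i = 0" if i: "dim F - dim G < 2 * i" for i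
  proof -
    have "coeff (fibre_sum K F G) i = 0"
    proof -
      have "dim U - dim G \<noteq> i" if U: "U \<in> Sub" "U \<subseteq> F" "spanned K U = G" for U
      proof -
        have "dim U \<le> Suc (dim G)" using corank U G by (auto simp: corank_one_def)
        moreover have "U \<noteq> F" using U G by auto
        then have "dim U < dim F" using U F dim_less by blast
        ultimately show ?thesis using i by linarith
      qed
      then show ?thesis by (auto simp: fibre_sum_def coeff_sum intro!: sum.neutral)
    qed
    moreover have "coeff (push_coeff K Q G' F * P G G') i = 0"
      if G': "G' \<in> {G' \<in> lat K. G \<subset> G' \<and> G' \<subseteq> F}" for G'
    proof -
      have G'S: "G' \<in> Sub" "G' \<in> lat K" using G' lat_Sub by auto
      have P: "2 * degree (P G G') < dim G' - dim G" using G G' by (intro KL_familyD(2)[OF KL]) auto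
      have G'H: "G' \<subseteq> ?H" using G' lat_le_spanned_iff[OF _ F] by auto
      have d: "dim G < dim G'" "dim G' \<le> dim F"
        using dim_less[of G G'] dim_mono[of G' F] G'S G' GF F by auto
      show ?thesis
      proof (cases "G' = ?H")
        case False
        have "G' \<noteq> {0}" using G' G Sub_zero[OF GF(2)] by auto
        then have "2 * degree (push_coeff K Q G' F) \<le> dim F - dim G'"
          using False G' G'H d by (intro less.hyps) auto
        then show ?thesis using P i d by (intro degree_mult_le_of_halves) auto
      next
        case True
        have "degree (1 + monom (1::int) 1) \<le> 1" by (intro degree_add_le degree_monom_le) auto
        moreover have "?H \<noteq> F \<Longrightarrow> dim ?H < dim F" using dim_less[of ?H F] H F by auto
        ultimately have "degree (push_coeff K Q G' F) \<le> dim F - dim ?H"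
          unfolding True push_coeff_spanned[OF F H0] by (cases "?H = F") simp_all
        moreover have "dim F \<le> Suc (dim ?H)" using corank F H0 by (simp add: corank_one_def)
        moreover have "degree (push_coeff K Q G' F * P G G') \<le> degree (push_coeff K Q G' F) + degree (P G G')"
          by (rule degree_mult_le)
        ultimately show ?thesis using P i dims unfolding True by (intro coeff_eq_0) linarith
      qed
    qed
    ultimately show ?thesis
      unfolding push_coeff_eq[OF KL inv G(1) F GF(1)] by (simp add: coeff_sum)
  qed
  then have "degree (push_coeff K Q G F) \<le> (dim F - dim G) div 2"
    by (intro degree_le) auto
  then show ?case by linarith
qed

text \<open>For G other than {0} and the span H, the half-degree bounds add up to less than dim F /
  2, since the bound for P is strict. If H \<noteq> F, the remaining term is (1 + t)
  \<open>P {0} H\<close>; its factor t reaches degree i only when dim F = 2i.\<close>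

lemma coeff_push_coeff:
  assumes F: "F \<in> Sub" "F \<noteq> {0}" and i: "dim F \<le> 2 * i"
  shows "coeff (push_coeff K Q {0} F) i = coeff (fibre_sum K F {0}) i
    - (if spanned K F \<noteq> F \<and> spanned K F \<noteq> {0} \<and> dim F = 2 * i
       then coeff (P {0} (spanned K F)) (i - 1) else 0)"
proof -
  let ?H = "spanned K F"
  let ?L = "{G \<in> lat K. {0} \<subset> G \<and> G \<subseteq> F}"
  have H: "?H \<in> lat K" "?H \<subseteq> F" "?H \<in> Sub"
    using spanned_in_lat spanned_subset spanned_Sub F by auto
  have f: "0 < dim F" using dim_eq_0[OF F(1)] F(2) by simp
  have eq: "push_coeff K Q {0} F = fibre_sum K F {0} - (\<Sum>G\<in>?L. push_coeff K Q G F * P {0} G)"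
    using push_coeff_eq[OF KL inv zero_in_lat F(1)] Sub_zero[OF F(1)] by simp
  show ?thesis
  proof (cases "?H = {0}")
    case True
    then have empty: "?L = {}" using lat_le_spanned_iff[OF _ F(1)] by auto
    show ?thesis unfolding eq empty using True by simp
  next
    case False
    have "?H \<in> ?L" using H False Sub_zero[OF H(3)] by auto
    have "coeff (push_coeff K Q G F * P {0} G) i = 0" if G: "G \<in> ?L - {?H}" for G
    proof -
      have "G \<noteq> {0}" "G \<subset> ?H" using G lat_le_spanned_iff[OF _ F(1), of G] by auto
      then have "2 * degree (push_coeff K Q G F) \<le> dim F - dim G"
        using G by (intro degree_push_coeff[OF F(1)]) auto
      moreover have "2 * degree (P {0} G) < dim G"
        using KL_familyD(2)[OF KL zero_in_lat, of G] G dim_zero by simp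
      moreover have "dim G \<le> dim F" using dim_mono[of G F] G lat_Sub F by auto
      ultimately show ?thesis using i by (intro degree_mult_le_of_halves) auto
    qed
    then have "(\<Sum>G\<in>?L. coeff (push_coeff K Q G F * P {0} G) i)
        = coeff (push_coeff K Q ?H F * P {0} ?H) i"
      using \<open>?H \<in> ?L\<close> finite_lat[of K] by (subst sum.remove[of _ ?H]) auto
    also have "\<dots> = (if ?H \<noteq> F \<and> dim F = 2 * i then coeff (P {0} ?H) (i - 1) else 0)"
    proof -
      have P: "2 * degree (P {0} ?H) < dim ?H"
        using KL_familyD(2)[OF KL zero_in_lat H(1)] False Sub_zero[OF H(3)] dim_zero
        by (simp add: psubset_eq)
      have "dim ?H \<le> dim F" using dim_mono H F by auto
      then have Pi: "coeff (P {0} ?H) i = 0" using P i by (intro coeff_eq_0) linarith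
      show ?thesis
      proof (cases "?H = F")
        case True
        then show ?thesis using Pi push_coeff_spanned[OF F(1) False] by simp
      next
        case ne: False
        obtain j where j: "i = Suc j" using i f by (cases i) auto
        have d: "dim ?H < dim F" using dim_less[of ?H F] H F ne by auto
        have "coeff (push_coeff K Q ?H F * P {0} ?H) i = coeff (P {0} ?H) i + coeff (P {0} ?H) j"
          using push_coeff_spanned[OF F(1) False] ne j
          by (simp add: algebra_simps coeff_monom_mult)
        moreover have "coeff (P {0} ?H) j = 0" if "dim F \<noteq> 2 * i"
          using P d i j that by (intro coeff_eq_0) linarith
        ultimately show ?thesis using Pi ne j by auto
      qed
    qed
    finally show ?thesis unfolding eq using False by (simp add: coeff_sum)
  qed
qed

end

end

instance bit :: finite
proof
  have "(UNIV :: bit set) = {0, 1}" using bit_not_zero_iff by blast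
  then show "finite (UNIV :: bit set)" by (metis finite.emptyI finite.insertI)
qed

lemma CARD_bit: "CARD(bit) = 2"
proof -
  have "(UNIV :: bit set) = {0, 1}" using bit_not_zero_iff by blast
  then show ?thesis by (metis card_2_iff zero_neq_one)
qed

section \<open>Affine geometries\<close>

text \<open>The generating polynomial, by dimension, of the subspaces of an n-dimensional space
  (Rogers--Szego polynomial).\<close>

definition gauss_poly :: "nat \<Rightarrow> nat \<Rightarrow> int poly" where
  "gauss_poly q n = (\<Sum>k\<le>n. of_nat (gauss q n k) * monom 1 k)"

context finite_space
begin

lemma spanned_affine:
  assumes Z: "Z \<in> Sub" and S: "S \<in> Sub" and "\<not> Z \<subseteq> S" "A \<inter> Z = Z - S"
  shows "Z \<in> lat A"
proof -
  obtain x where x: "x \<in> Z" "x \<notin> S" using assms by blast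
  have "z \<in> span (Z - S)" if z: "z \<in> Z" for z
  proof (cases "z \<in> S")
    case True
    have "z + x \<in> Z" using z x SubD(1)[OF Z] by (simp add: subspace_add)
    moreover have "z + x \<notin> S"
      using True x subspace_diff[OF SubD(1)[OF S], of "z + x" z] by auto
    ultimately have "(z + x) - x \<in> span (Z - S)" using x by (intro span_diff span_base) auto
    then show ?thesis by simp
  qed (use z in \<open>auto intro: span_base\<close>)
  then have "spanned A Z = Z"
    using spanned_subset[OF Z, of A] assms(4) by (auto simp: spanned_def)
  then show ?thesis using Z by (simp add: lat_def)
qed

text \<open>A subspace of H is a flat if it is zero or not contained in S. Above a nonzero flat all
  subspaces are flats, so that interval is a full subspace lattice with polynomial 1. The nonzero
  flats then contribute t^dim over the subspaces of H outside S; the zero subspace cancels in the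
  difference of the two \<open>gauss_poly\<close>.\<close>

lemma palindromic_KL_affine:
  assumes KL: "KL_family (lat A) P" and H: "H \<in> Sub" and S: "S \<in> Sub" "S \<subseteq> H"
    and dim: "dim H = Suc (dim S)" and A: "A \<inter> H = H - S"
  shows "palindromic (dim H) (P {0} H + (gauss_poly (CARD('a)) (dim H) - gauss_poly (CARD('a)) (dim S)))"
proof -
  have notS: "\<not> H \<subseteq> S" using dim_mono[OF H S(1)] dim by auto
  have inlat: "Z \<in> lat A" if "Z \<in> Sub" "Z \<subseteq> H" "\<not> Z \<subseteq> S" for Z
    using that A by (intro spanned_affine[OF that(1) S(1)]) auto
  have Hlat: "H \<in> lat A" using H notS by (intro inlat) auto
  have lat_iff: "Z \<in> lat A \<longleftrightarrow> Z = {0} \<or> \<not> Z \<subseteq> S" if Z: "Z \<in> Sub" "Z \<subseteq> H" for Z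
  proof
    assume Zl: "Z \<in> lat A"
    show "Z = {0} \<or> \<not> Z \<subseteq> S"
    proof (rule ccontr)
      assume *: "\<not> (Z = {0} \<or> \<not> Z \<subseteq> S)"
      then have "A \<inter> Z = {}" using A Z by auto
      then have "spanned A Z = {0}" by (simp add: spanned_def)
      then show False using * spanned_lat[OF Zl] by simp
    qed
  qed (use zero_in_lat inlat Z in auto)
  have one: "P Z H = 1" if "Z \<in> lat A" "Z \<noteq> {0}" "Z \<subseteq> H" for Z
    using that
  proof (induction "dim H - dim Z" arbitrary: Z rule: less_induct)
    case less
    note Z = less.prems
    have ZS: "Z \<in> Sub" "\<not> Z \<subseteq> S" using Z lat_Sub lat_iff by auto
    show ?case
    proof (cases "Z = H")
      case True
      then show ?thesis using KL_familyD(1)[OF KL Hlat] by simp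
    next
      case False
      then have ZH: "Z \<subset> H" using Z by blast
      have "{Z' \<in> lat A. Z \<subseteq> Z' \<and> Z' \<subseteq> H} = interval Z H"
        using lat_Sub inlat ZS(2) unfolding interval_def by blast
      then have pal: "palindromic (dim H - dim Z) (\<Sum>Z'\<in>interval Z H. monom 1 (dim Z' - dim Z) * P Z' H)"
        using KL_familyD(3)[OF KL Z(1) Hlat Z(3)] by simp
      have mem: "Z \<in> interval Z H" using ZS Z by (simp add: interval_def)
      have "P Z' H = 1" if "Z' \<in> interval Z H - {Z}" for Z'
      proof -
        have Z': "Z' \<in> Sub" "Z \<subset> Z'" "Z' \<subseteq> H" using that by (auto simp: interval_def)
        then have "dim Z < dim Z'" "dim Z' \<le> dim H" using dim_less ZS dim_mono H by auto
        moreover have "Z' \<noteq> {0}" using Z' Z(2) Sub_zero[OF ZS(1)] by auto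
        moreover have "Z' \<in> lat A" using Z' ZS by (intro inlat) auto
        ultimately show ?thesis using Z' by (intro less.hyps) auto
      qed
      then have "(\<Sum>Z'\<in>interval Z H. monom 1 (dim Z' - dim Z) * P Z' H)
          = P Z H + (\<Sum>Z'\<in>interval Z H - {Z}. monom 1 (dim Z' - dim Z))"
        by (subst sum.remove[OF finite_interval mem]) simp
      moreover have "(\<Sum>Z'\<in>interval Z H. monom (1::int) (dim Z' - dim Z))
          = 1 + (\<Sum>Z'\<in>interval Z H - {Z}. monom 1 (dim Z' - dim Z))"
        by (subst sum.remove[OF finite_interval mem]) simp
      ultimately have "(\<Sum>Z'\<in>interval Z H. monom 1 (dim Z' - dim Z) * P Z' H)
          - (\<Sum>Z'\<in>interval Z H. monom 1 (dim Z' - dim Z)) = P Z H - 1"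
        by simp
      then have "palindromic (dim H - dim Z) (P Z H - 1)"
        using palindromic_diff[OF pal palindromic_interval[OF ZS(1) H Z(3)]] by simp
      moreover have "2 * degree (P Z H - 1) < dim H - dim Z"
        using KL_familyD(2)[OF KL Z(1) Hlat ZH] degree_diff_le_max[of "P Z H" 1] by simp
      ultimately have "P Z H - 1 = 0" by (rule palindromic_small_eq_0)
      then show ?thesis by simp
    qed
  qed
  have H0: "{0} \<subseteq> H" "{0} \<subseteq> S" using Sub_zero H S by auto
  have "{Z \<in> lat A. {0} \<subseteq> Z \<and> Z \<subseteq> H} = insert {0} (interval {0} H - interval {0} S)"
    using lat_Sub lat_iff zero_in_lat H0 Sub_zero by (auto simp: interval_def)
  moreover have "{0} \<notin> interval {0} H - interval {0} S"
    using H0 zero_in_Sub by (auto simp: interval_def)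
  ultimately have "(\<Sum>Z\<in>{Z \<in> lat A. {0} \<subseteq> Z \<and> Z \<subseteq> H}. monom 1 (dim Z - dim {0}) * P Z H)
      = P {0} H + (\<Sum>Z\<in>interval {0} H - interval {0} S. monom 1 (dim Z - dim {0}) * P Z H)"
    using finite_interval by simp
  also have "(\<Sum>Z\<in>interval {0} H - interval {0} S. monom 1 (dim Z - dim {0}) * P Z H)
      = (\<Sum>Z\<in>interval {0} H - interval {0} S. monom 1 (dim Z - dim {0}))"
  proof (intro sum.cong refl)
    fix Z assume Z: "Z \<in> interval {0} H - interval {0} S"
    then have "Z \<in> Sub" "Z \<subseteq> H" "\<not> Z \<subseteq> S" by (auto simp: interval_def)
    moreover from this have "Z \<noteq> {0}" using H0 by auto
    ultimately have "P Z H = 1" using inlat by (intro one) auto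
    then show "monom 1 (dim Z - dim {0}) * P Z H = monom 1 (dim Z - dim {0})" by simp
  qed
  also have "\<dots> = (\<Sum>Z\<in>interval {0} H. monom 1 (dim Z - dim {0}))
      - (\<Sum>Z\<in>interval {0} S. monom 1 (dim Z - dim {0}))"
    using S by (intro sum_diff finite_interval) (auto simp: interval_def)
  also have "\<dots> = gauss_poly (CARD('a)) (dim H) - gauss_poly (CARD('a)) (dim S)"
    using sum_interval[OF zero_in_Sub H H0(1), of "monom (1::int)"]
      sum_interval[OF zero_in_Sub S(1) H0(2), of "monom (1::int)"]
    by (simp add: gauss_poly_def dim_zero)
  finally show ?thesis
    using KL_familyD(3)[OF KL zero_in_lat Hlat H0(1)] dim_zero by simp
qed

lemma degree_KL_affine:
  assumes KL: "KL_family (lat A) P" and H: "H \<in> Sub" and S: "S \<in> Sub" "S \<subseteq> H"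
    and dim: "dim H = Suc (dim S)" and A: "A \<inter> H = H - S"
  shows "2 * degree (P {0} H) < dim H"
proof -
  have "\<not> H \<subseteq> S" using dim_mono[OF H S(1)] dim by auto
  then have "H \<in> lat A" using spanned_affine[OF H S(1)] A by simp
  moreover have "{0} \<subset> H" using dim dim_zero Sub_zero[OF H] by auto
  ultimately show ?thesis using KL_familyD(2)[OF KL zero_in_lat, of H] dim_zero by simp
qed

end

lemma palindromic_unique:
  assumes "palindromic n (p + z)" "palindromic n (r + z)" "2 * degree p < n" "2 * degree r < n"
  shows "p = r"
proof -
  have "palindromic n (p - r)" using palindromic_diff[OF assms(1,2)] by simp
  moreover have "2 * degree (p - r) < n" using degree_diff_le_max[of p r] assms by simp
  ultimately show ?thesis using palindromic_small_eq_0 by fastforce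
qed

text \<open>The added coordinate 1 realizes affine points as the complement of the hyperplane
  \<open>f 0 = 0\<close> in the sequences supported on {0..b}, so that
  \<open>palindromic_KL_affine\<close> applies with this hyperplane as S.\<close>

lemma binary_affine_geometry_KL:
  fixes b :: nat
  defines "M \<equiv> binary_affine_geometry b"
  shows "matroid_rank M = Suc b" "2 * degree (KL_poly M) < Suc b"
    and "palindromic (Suc b) (KL_poly M + (gauss_poly 2 (Suc b) - gauss_poly 2 b))"
proof -
  define s where "s = (\<lambda>(c::bit) (f :: nat \<Rightarrow> bit) i. c * f i)"
  let ?Y = "{f :: nat \<Rightarrow> bit. \<forall>i>b. f i = 0}"
  let ?G = "{a :: nat \<Rightarrow> bit. \<forall>i\<ge>b. a i = 0}"
  let ?v = "case_nat 1 :: (nat \<Rightarrow> bit) \<Rightarrow> nat \<Rightarrow> bit"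
  let ?K = "?v ` ?G"
  let ?S = "case_nat 0 ` ?G"
  have vs: "vector_space s"
    unfolding s_def by unfold_locales (auto simp: fun_eq_iff algebra_simps)
  interpret vector_space s by (rule vs)
  have finY: "finite ?Y"
  proof -
    have "?Y = {f. \<forall>x. (x \<in> {..b} \<longrightarrow> f x \<in> UNIV) \<and> (x \<notin> {..b} \<longrightarrow> f x = 0)}" by auto
    then show ?thesis using finite_set_of_finite_funs[of "{..b}" "UNIV :: bit set" 0] by simp
  qed
  have sub: "subspace ?Y" by (rule subspaceI) (auto simp: s_def)
  interpret finite_space s ?Y
    using finY sub by unfold_locales
  have K: "?K = {f \<in> ?Y. f 0 = 1}" and S: "?S = {f \<in> ?Y. f 0 = 0}"
  proof -
    have eq: "case_nat c ` ?G = {f \<in> ?Y. f 0 = c}" for c :: bit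
    proof
      show "{f \<in> ?Y. f 0 = c} \<subseteq> case_nat c ` ?G"
      proof
        fix f assume "f \<in> {f \<in> ?Y. f 0 = c}"
        then have "f = case_nat c (\<lambda>i. f (Suc i))" "(\<lambda>i. f (Suc i)) \<in> ?G"
          by (auto simp: fun_eq_iff split: nat.split)
        then show "f \<in> case_nat c ` ?G" by blast
      qed
    qed (auto split: nat.split)
    show "?K = {f \<in> ?Y. f 0 = 1}" "?S = {f \<in> ?Y. f 0 = 0}" by (rule eq)+
  qed
  have "subspace {f \<in> ?Y. f 0 = 0}" by (rule subspaceI) (auto simp: s_def)
  then have SSub: "?S \<in> Sub" unfolding S by (auto simp: Sub_def)
  have cardG: "card ?G = 2 ^ b"
  proof -
    have "bij_betw (\<lambda>f. {i. f i = (1::bit)}) ?G (Pow {..<b})"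
    proof (rule bij_betw_byWitness[where f' = "\<lambda>A i. if i \<in> A then 1 else 0"])
      show "(\<lambda>f. {i. f i = (1::bit)}) ` ?G \<subseteq> Pow {..<b}"
        by (auto simp: not_less[symmetric])
    qed (auto simp: fun_eq_iff)
    then show ?thesis by (simp add: bij_betw_same_card card_Pow)
  qed
  have inj: "inj (case_nat c :: (nat \<Rightarrow> bit) \<Rightarrow> nat \<Rightarrow> bit)" for c
  proof (rule injI)
    fix f g :: "nat \<Rightarrow> bit" assume "case_nat c f = case_nat c g"
    then have "case_nat c f (Suc i) = case_nat c g (Suc i)" for i by simp
    then show "f = g" by (simp add: fun_eq_iff)
  qed
  have "card ?S = 2 ^ b" "card ?K = 2 ^ b"
    using cardG by (simp_all add: card_image inj_on_subset[OF inj])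
  moreover have Y: "?Y = ?K \<union> ?S" and disj: "?K \<inter> ?S = {}" unfolding K S by auto
  moreover have "card (?K \<union> ?S) = card ?K + card ?S"
    using disj by (rule card_Un_disjoint[rotated 2]) (use finY in \<open>auto simp: Y\<close>)
  ultimately have "card ?Y = 2 ^ Suc b" by (simp only: mult_2 power_Suc)
  then have dimY: "dim ?Y = Suc b"
    using card_Sub[OF Y_in_Sub] CARD_bit by (simp del: power_Suc)
  have dimS: "dim ?S = b"
    using card_Sub[OF SSub] CARD_bit \<open>card ?S = 2 ^ b\<close> by simp
  have rep: "represents M ?v ?K"
    unfolding represents_def M_def binary_affine_geometry_def s_def[symmetric]
  proof (intro conjI ballI allI impI)
    show "finite (ground (Matroid ?G (\<lambda>S. dim (?v ` S))))"
      using finite_imageD[of ?v ?G] finite_subset[OF _ finY, of ?K] inj_on_subset[OF inj] K by auto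
    show "0 \<notin> ?K" unfolding K by simp
    show "?K \<subseteq> ?Y" unfolding K by auto
  next
    fix x assume "x \<in> ?K"
    then obtain a where "a \<in> ?G" "x = ?v a" by blast
    then show "\<exists>e\<in>ground (Matroid ?G (\<lambda>S. dim (?v ` S))). x \<in> span {?v e}"
      by (auto intro: span_base)
  qed auto
  have KY: "?K \<inter> ?Y = ?Y - ?S" unfolding K S by auto
  have KL: "KL_family (lat ?K) (\<lambda>U V. KL_poly (minor M ?v U V))" using KL_family_represents[OF rep] .
  have "?S \<subseteq> ?Y" unfolding S by auto
  note facts = KL Y_in_Sub SSub this _ KY
  show "matroid_rank M = Suc b"
  proof -
    have "\<not> ?Y \<subseteq> ?S" using dim_mono[OF Y_in_Sub SSub] dimY dimS by auto
    then have "?Y \<in> lat ?K" using spanned_affine[OF Y_in_Sub SSub _ KY] by simp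
    then show ?thesis
      using rank_minor[OF rep zero_in_lat, of ?Y] minor_zero_top[OF rep] dimY dim_zero Sub_zero[OF Y_in_Sub] by simp
  qed
  show "2 * degree (KL_poly M) < Suc b"
    using degree_KL_affine[OF facts] dimY dimS minor_zero_top[OF rep] by simp
  show "palindromic (Suc b) (KL_poly M + (gauss_poly 2 (Suc b) - gauss_poly 2 b))"
    using palindromic_KL_affine[OF facts] dimY dimS minor_zero_top[OF rep] CARD_bit by simp
qed

context finite_space
begin

text \<open>Instead of an isomorphism of matroids, uniqueness is used: both polynomials complete the
  same polynomial, given by dim S alone, to a palindromic one within the same degree bound.\<close>

lemma KL_affine_eq_binary:
  assumes KL: "KL_family (lat A) P" and H: "H \<in> Sub" and S: "S \<in> Sub" "S \<subseteq> H"
    and dim: "dim H = Suc (dim S)" and A: "A \<inter> H = H - S" and card: "CARD('a) = 2"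
  shows "P {0} H = KL_poly (binary_affine_geometry (dim S))"
proof (rule palindromic_unique)
  show "palindromic (Suc (dim S)) (P {0} H + (gauss_poly 2 (Suc (dim S)) - gauss_poly 2 (dim S)))"
    using palindromic_KL_affine[OF assms(1-6)] card dim by simp
  show "2 * degree (P {0} H) < Suc (dim S)"
    using degree_KL_affine[OF assms(1-6)] dim by simp
qed (rule binary_affine_geometry_KL)+

end

section \<open>Charts\<close>

text \<open>In the application \<open>V i = W + X i\<close>, \<open>D i = \<langle>w i\<rangle> + L i + X i\<close> and \<open>E i = L i + X i\<close>, so that
  \<open>D i - E i\<close> is the cone over \<open>C i\<close>.\<close>

locale charts = finite_space scale Y
  for scale :: "'a::{field,finite} \<Rightarrow> 'b::ab_group_add \<Rightarrow> 'b" and Y :: "'b set" +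
  fixes I :: "nat set" and W :: "'b set" and V D E :: "nat \<Rightarrow> 'b set"
  assumes finite_I: "finite I"
    and W: "W \<in> Sub"
    and V: "\<And>i. i \<in> I \<Longrightarrow> V i \<in> Sub" "\<And>i. i \<in> I \<Longrightarrow> W \<subseteq> V i"
    and D: "\<And>i. i \<in> I \<Longrightarrow> D i \<in> Sub" "\<And>i. i \<in> I \<Longrightarrow> D i \<subseteq> V i"
    and E: "\<And>i. i \<in> I \<Longrightarrow> E i \<in> Sub" "\<And>i. i \<in> I \<Longrightarrow> E i \<subseteq> D i"
      "\<And>i. i \<in> I \<Longrightarrow> dim (D i) = Suc (dim (E i))"
    and transversal: "\<And>i j k a b. i \<in> I \<Longrightarrow> j \<in> I \<Longrightarrow> k \<in> I \<Longrightarrow> i \<noteq> j \<Longrightarrow>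
      a \<in> V i - W \<Longrightarrow> b \<in> V j - W \<Longrightarrow> a + b \<notin> V k"
    and transversal3: "\<And>i j k n a b c. i \<in> I \<Longrightarrow> j \<in> I \<Longrightarrow> k \<in> I \<Longrightarrow> n \<in> I \<Longrightarrow>
      i \<noteq> j \<Longrightarrow> i \<noteq> k \<Longrightarrow> j \<noteq> k \<Longrightarrow>
      a \<in> V i - W \<Longrightarrow> b \<in> V j - W \<Longrightarrow> c \<in> V k - W \<Longrightarrow> a + b + c \<notin> V n"
begin

definition chart :: "nat \<Rightarrow> 'b set" where
  "chart i = D i - E i"

text \<open>The cone over the complement of the charts in J. The index set is a parameter because
  the proof compares J, its singletons and the empty set.\<close>

definition K :: "nat set \<Rightarrow> 'b set" where
  "K J = Y - W - (\<Union>i\<in>J. chart i)"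

lemma Sub_add: "U \<in> Sub \<Longrightarrow> x \<in> U \<Longrightarrow> y \<in> U \<Longrightarrow> x + y \<in> U"
  and Sub_diff: "U \<in> Sub \<Longrightarrow> x \<in> U \<Longrightarrow> y \<in> U \<Longrightarrow> x - y \<in> U"
  and Sub_scale: "U \<in> Sub \<Longrightarrow> x \<in> U \<Longrightarrow> scale c x \<in> U"
  by (simp_all add: Sub_def subspace_add subspace_diff subspace_scale)

lemma Sub_add_cancel: "U \<in> Sub \<Longrightarrow> y \<in> U \<Longrightarrow> x + y \<in> U \<longleftrightarrow> x \<in> U"
  using Sub_add[of U x y] Sub_diff[of U "x + y" y] by auto

lemma Sub_add_cancel': "U \<in> Sub \<Longrightarrow> x \<in> U \<Longrightarrow> x + y \<in> U \<longleftrightarrow> y \<in> U"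
  using Sub_add_cancel[of U x y] by (simp add: add.commute)

lemma Sub_scale_cancel: "U \<in> Sub \<Longrightarrow> c \<noteq> 0 \<Longrightarrow> scale c x \<in> U \<longleftrightarrow> x \<in> U"
  using Sub_scale[of U x c] Sub_scale[of U "scale c x" "1 / c"] by auto

lemma chart_V: "i \<in> I \<Longrightarrow> x \<in> chart i \<Longrightarrow> x \<in> V i"
  using D by (auto simp: chart_def)

text \<open>\<open>transversal\<close> with both vectors equal to x, since x + x stays in V
  i.\<close>

lemma V_Int:
  assumes "i \<in> I" "j \<in> I" "i \<noteq> j" "x \<in> V i" "x \<in> V j" shows "x \<in> W"
proof (rule ccontr)
  assume "x \<notin> W"
  then have "x + x \<notin> V i" using assms by (intro transversal[of i j]) auto
  then show False using assms V(1)[of i] Sub_add by blast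
qed

lemma chart_add_E:
  assumes "i \<in> I" "e \<in> E i" shows "x + e \<in> chart i \<longleftrightarrow> x \<in> chart i"
  using Sub_add_cancel[OF D(1) , of i e x] Sub_add_cancel[OF E(1), of i e x] E(2)[of i] assms
  by (auto simp: chart_def)

lemma chart_proportional:
  assumes "i \<in> I" "x \<in> chart i" "y \<in> chart i"
  obtains k where "k \<noteq> 0" "y - scale k x \<in> E i"
proof -
  obtain k where "y - scale k x \<in> E i"
    using hyperplane_coset[OF D(1) E(1) E(2) E(3), of i x y] assms by (auto simp: chart_def)
  moreover from this have "k \<noteq> 0" using assms by (auto simp: chart_def)
  ultimately show ?thesis using that by blast
qed

text \<open>In the application such a sum has nonzero components in two of the X i, so it lies in no
  V k and hence in no chart.\<close>

lemma sum_in_K: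
  assumes "i \<in> I" "j \<in> I" "i \<noteq> j" "J \<subseteq> I" "a \<in> V i" "a \<notin> W" "b \<in> V j" "b \<notin> W"
  shows "a + b \<in> K J"
proof -
  have V: "a + b \<notin> V k" if "k \<in> I" for k
    using assms that by (intro transversal[of i j]) auto
  have "a \<in> Y" "b \<in> Y" using assms SubD(2) charts.V(1)[OF charts_axioms] by blast+
  then have "a + b \<in> Y" using Y_in_Sub by (simp add: Sub_add)
  moreover have "a + b \<notin> W" using V[OF assms(1)] assms charts.V(2)[OF charts_axioms] by blast
  moreover have "a + b \<notin> chart k" if "k \<in> J" for k using V chart_V assms that by blast
  ultimately show ?thesis by (auto simp: K_def)
qed

lemma spanned_K_base: "x \<in> K J \<Longrightarrow> x \<in> U \<Longrightarrow> x \<in> spanned (K J) U"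
  by (simp add: spanned_def span_base)

lemma outside_spanned:
  assumes "U \<in> Sub" "x \<in> U" "x \<notin> spanned (K J) U"
  shows "x \<in> W \<or> (\<exists>i\<in>J. x \<in> chart i)"
  using assms spanned_K_base[of x J U] SubD(2)[OF assms(1)] by (auto simp: K_def)

lemma spanned_zero_iff:
  assumes "U \<in> Sub" shows "spanned (K J) U = {0} \<longleftrightarrow> K J \<inter> U = {}"
proof
  assume "spanned (K J) U = {0}"
  moreover have "0 \<notin> K J" using Sub_zero[OF W] by (simp add: K_def)
  ultimately show "K J \<inter> U = {}" using spanned_K_base[of _ J U] by auto
qed (simp add: spanned_def)

lemma spanned_nonzero:
  assumes "U \<in> Sub" "spanned (K J) U \<noteq> {0}"
  obtains g where "g \<in> K J" "g \<in> U" "g \<in> spanned (K J) U" "g \<notin> W"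
  using assms spanned_zero_iff[of U J] spanned_K_base[of _ J U] by (auto simp: K_def)

text \<open>A vector of W is pushed out of W by adding g; since g belongs to A, the sum still avoids
  A.\<close>

lemma move_outside:
  assumes "A \<in> Sub" "x \<notin> A" "g \<in> A" "g \<notin> W" "g \<in> U" "x \<in> U" "U \<in> Sub"
  obtains a where "a \<in> U" "a \<notin> A" "a \<notin> W"
proof (cases "x \<in> W")
  case True
  then have "x + g \<in> U" "x + g \<notin> A" "x + g \<notin> W"
    using assms Sub_add Sub_add_cancel[of A g x] Sub_add_cancel'[OF W, of x g] by auto
  then show ?thesis using that by blast
qed (use assms that in blast)

text \<open>Let a be a chart point of U outside the span H, say in chart i. If H together with a
  missed a vector b of U, then b could be taken outside W and would also lie in chart i, since sums
  across charts belong to \<open>K J\<close>. So some b - k a lies in E i, and the same argument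
  forces it into W. Translating a point g of \<open>K J\<close> by it leads into chart i; but chart
  i is invariant under E i, so g would lie in it.\<close>

lemma corank_one_K:
  assumes J: "J \<subseteq> I" shows "corank_one (K J)"
  unfolding corank_one_def
proof (intro ballI impI)
  fix U assume U: "U \<in> Sub" and nz: "spanned (K J) U \<noteq> {0}"
  let ?H = "spanned (K J) U"
  have H: "?H \<in> Sub" "?H \<subseteq> U" using spanned_Sub spanned_subset U by auto
  obtain g where g: "g \<in> K J" "g \<in> U" "g \<in> ?H" "g \<notin> W" using spanned_nonzero[OF U nz] .
  show "dim U \<le> Suc (dim ?H)"
  proof (cases "U \<subseteq> ?H")
    case True
    then show ?thesis using dim_mono[OF U H(1)] by simp
  next
    case False
    then obtain a where a: "a \<in> U" "a \<notin> ?H" "a \<notin> W"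
      using move_outside[OF H(1) _ g(3,4,2) _ U] by blast
    then obtain i where i: "i \<in> J" "a \<in> chart i" using outside_spanned[OF U] by blast
    let ?H1 = "span (insert a ?H)"
    have "insert a ?H \<subseteq> Y" using a H U SubD(2) by blast
    then have H1: "?H1 \<in> Sub" by (rule span_in_Sub)
    have H1': "a \<in> ?H1" "?H \<subseteq> ?H1" using span_superset[of "insert a ?H"] by auto
    have "U \<subseteq> ?H1"
    proof (rule ccontr)
      assume "\<not> U \<subseteq> ?H1"
      then obtain b where b: "b \<in> U" "b \<notin> ?H1" "b \<notin> W"
        using move_outside[OF H1 _ _ g(4,2) _ U] g(3) H1'(2) by blast
      have notH: "x \<notin> ?H" if "x \<notin> ?H1" for x using that H1' by blast
      obtain j where j: "j \<in> J" "b \<in> chart j" using outside_spanned[OF U b(1) notH] b by blast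
      have cross: False if "k \<in> J" "k \<noteq> i" "y \<in> chart k" "y \<in> U" "y \<notin> ?H1" "y \<notin> W" for k y
      proof -
        have "a + y \<in> K J"
          using that a i J chart_V by (intro sum_in_K[of i k]) auto
        then have "a + y \<in> ?H" using a that U by (intro spanned_K_base) (auto intro: Sub_add)
        then have "a + y \<in> ?H1" using H1' by blast
        then show False using that Sub_add_cancel'[OF H1 H1'(1)] by blast
      qed
      then have "j = i" using j b by blast
      then obtain k where k: "b - scale k a \<in> E i"
        using chart_proportional[of i a b] i j J by blast
      let ?b = "b - scale k a"
      have b': "?b \<in> U" "?b \<notin> ?H1"
        using a b U H1' Sub_diff[OF U b(1) Sub_scale[OF U a(1)]]
          Sub_add_cancel[OF H1 Sub_scale[OF H1 H1'(1)], of ?b k] by auto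
      have "?b \<in> W"
      proof (rule ccontr)
        assume nW: "?b \<notin> W"
        then obtain n where n: "n \<in> J" "?b \<in> chart n" using outside_spanned[OF U b'(1) notH[OF b'(2)]] by blast
        then show False using cross[OF n(1) _ n(2) b' nW] k by (auto simp: chart_def)
      qed
      have gb: "g + ?b \<in> U" "g + ?b \<notin> ?H1" "g + ?b \<notin> W"
        using g b' U \<open>?b \<in> W\<close> W H1 H1' Sub_add Sub_add_cancel'[OF H1, of g ?b]
          Sub_add_cancel[OF W, of ?b g] by auto
      then obtain n where n: "n \<in> J" "g + ?b \<in> chart n"
        using outside_spanned[OF U gb(1) notH[OF gb(2)]] by blast
      then have "n = i" using cross gb by blast
      then have "g \<in> chart i" using n k i J chart_add_E[of i ?b g] by blast
      then show False using g(1) i by (auto simp: K_def)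
    qed
    then show ?thesis using dim_mono[OF U H1] dim_insert_Sub[OF H(1) a(2)] by simp
  qed
qed

section \<open>Subspaces that are spanned only up to a hyperplane\<close>

definition bad :: "nat set \<Rightarrow> 'b set \<Rightarrow> bool" where
  "bad J F \<longleftrightarrow> spanned (K J) F \<noteq> F \<and> spanned (K J) F \<noteq> {0}"

lemma bad_obtain:
  assumes F: "F \<in> Sub" "bad J F"
  obtains g a i where "g \<in> K J" "g \<in> spanned (K J) F" "g \<notin> W" "g \<in> F"
    "i \<in> J" "a \<in> F" "a \<notin> spanned (K J) F" "a \<notin> W" "a \<in> chart i"
proof -
  let ?H = "spanned (K J) F"
  have H: "?H \<in> Sub" "?H \<subseteq> F" using spanned_Sub spanned_subset F by auto
  obtain g where g: "g \<in> K J" "g \<in> F" "g \<in> ?H" "g \<notin> W"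
    using spanned_nonzero[OF F(1)] F(2) by (auto simp: bad_def)
  obtain a where a: "a \<in> F" "a \<notin> ?H" "a \<notin> W"
    using move_outside[OF H(1) _ g(3,4,2) _ F(1)] H(2) F(2) unfolding bad_def by blast
  then show ?thesis using that g outside_spanned[OF F(1)] by blast
qed

lemma bad_dim:
  assumes "F \<in> Sub" "bad J F" "J \<subseteq> I"
  shows "dim F = Suc (dim (spanned (K J) F))"
  using corank_one_K[OF assms(3)] assms dim_less[OF spanned_Sub[of F "K J"], of F] spanned_subset[of F "K J"]
  unfolding corank_one_def bad_def by (metis less_antisym not_less_eq psubsetI not_le)

text \<open>The translation argument of \<open>corank_one_K\<close>, with the supposed chart point y
  of the span in the role of a: a vector of F outside the span then differs from a multiple of y by
  an element of E j that lies in W, and translation by it would put g into chart j.\<close>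

lemma bad_Int_chart:
  assumes F: "F \<in> Sub" "bad J F" and J: "J \<subseteq> I" and y: "j \<in> J" "y \<in> spanned (K J) F" "y \<in> chart j"
  shows "y \<in> W"
proof (rule ccontr)
  assume yW: "y \<notin> W"
  let ?H = "spanned (K J) F"
  have H: "?H \<in> Sub" "?H \<subseteq> F" using spanned_Sub spanned_subset F by auto
  obtain g a i where g: "g \<in> K J" "g \<in> ?H" "g \<notin> W" "g \<in> F"
    and a: "i \<in> J" "a \<in> F" "a \<notin> ?H" "a \<notin> W" "a \<in> chart i"
    using bad_obtain[OF F] .
  have yF: "y \<in> F" using H y by auto
  have cross: False if "k \<in> J" "k \<noteq> j" "x \<in> V k" "x \<in> F" "x \<notin> ?H" "x \<notin> W" for k x
  proof -
    have "x + y \<in> K J" using that y yW J chart_V by (intro sum_in_K[of k j]) auto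
    then have "x + y \<in> ?H" using that yF F(1) by (intro spanned_K_base) (auto intro: Sub_add)
    then show False using that y Sub_add_cancel[OF H(1)] by blast
  qed
  have "i = j" using cross[of i a] a J chart_V by blast
  then obtain k where k: "a - scale k y \<in> E j"
    using chart_proportional[of j y a] a y J by blast
  let ?z = "a - scale k y"
  have z: "?z \<in> F" "?z \<notin> ?H"
    using a y yF F(1) H Sub_diff[OF F(1) a(2) Sub_scale[OF F(1) yF]]
      Sub_add_cancel[OF H(1) Sub_scale[OF H(1) y(2)], of ?z k] by auto
  have "?z \<in> W"
  proof (rule ccontr)
    assume zW: "?z \<notin> W"
    then obtain n where n: "n \<in> J" "?z \<in> chart n" using outside_spanned[OF F(1) z] by blast
    then have "n \<noteq> j" using k by (auto simp: chart_def)
    then show False using cross[OF n(1) _ _ z zW] n J chart_V by blast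
  qed
  have gz: "g + ?z \<in> F" "g + ?z \<notin> ?H" "g + ?z \<notin> W"
    using g z F(1) \<open>?z \<in> W\<close> Sub_add Sub_add_cancel'[OF H(1), of g ?z] Sub_add_cancel[OF W, of ?z g]
    by auto
  then obtain n where n: "n \<in> J" "g + ?z \<in> chart n" using outside_spanned[OF F(1) gz(1,2)] by blast
  then have "n = j" using cross[OF n(1) _ _ gz] J chart_V by blast
  then have "g \<in> chart j" using n k y J chart_add_E[of j ?z g] by blast
  then show False using g(1) y by (auto simp: K_def)
qed

text \<open>Makes the correction term independent of J: the points in the spanned hyperplane are all
  its vectors outside W, whichever charts have been removed.\<close>

lemma K_Int_spanned_bad:
  assumes "F \<in> Sub" "bad J F" "J \<subseteq> I"
  shows "K J \<inter> spanned (K J) F = spanned (K J) F - W"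
  using bad_Int_chart[OF assms] SubD(2)[OF spanned_Sub[OF assms(1)]] by (auto simp: K_def)

lemma not_bad_empty: "F \<in> Sub \<Longrightarrow> \<not> bad {} F"
  using bad_obtain[of F "{}"] by blast

lemma K_antimono: "J \<subseteq> J' \<Longrightarrow> K J' \<subseteq> K J"
  by (auto simp: K_def)

lemma spanned_K_antimono: "J \<subseteq> J' \<Longrightarrow> spanned (K J') F \<subseteq> spanned (K J) F"
  unfolding spanned_def using K_antimono by (intro span_mono) blast

lemma K_single_other:
  assumes "i \<in> I" "j \<in> I" "i \<noteq> j" "x \<in> chart i" "x \<notin> W" "x \<in> Y" shows "x \<in> K {j}"
  using assms V_Int[of i j x] chart_V by (auto simp: K_def)

text \<open>The vector x enlarges a span that already has codimension one in F, so
  \<open>K {k}\<close> spans all of F.\<close>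

lemma not_bad_single:
  assumes F: "F \<in> Sub" "bad J F" and J: "J \<subseteq> I" "k \<in> J"
    and x: "x \<in> K {k}" "x \<in> F" "x \<notin> spanned (K J) F"
  shows "\<not> bad {k} F"
proof -
  let ?H = "spanned (K J) F" and ?H' = "spanned (K {k}) F"
  have sub: "?H \<in> Sub" "?H' \<in> Sub" using spanned_Sub F by auto
  have "?H \<subset> ?H'" using spanned_K_antimono[of "{k}" J F] spanned_K_base[OF x(1,2)] J x by auto
  then have "dim F \<le> dim ?H'" using bad_dim[OF F J(1)] dim_less[OF sub] by simp
  then have "?H' = F" using dim_eq[OF sub(2) F(1) spanned_subset[OF F(1)]] by simp
  then show ?thesis by (simp add: bad_def)
qed

text \<open>A point g of \<open>K {i}\<close> in F also belongs to \<open>K J\<close>: if it lay in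
  another chart, g + a would be in \<open>K {i}\<close>, and a would be in the span. Hence
  \<open>K J\<close> has nonzero span in F, and the two spans, being nested and of codimension one,
  coincide.\<close>

lemma bad_single_imp:
  assumes F: "F \<in> Sub" "bad {i} F" and J: "J \<subseteq> I" "i \<in> J"
  shows "bad J F" "spanned (K J) F = spanned (K {i}) F"
proof -
  let ?H = "spanned (K J) F" and ?H' = "spanned (K {i}) F"
  have iI: "{i} \<subseteq> I" using J by auto
  have sub: "?H \<in> Sub" "?H' \<in> Sub" using spanned_Sub F by auto
  obtain g a where g: "g \<in> K {i}" "g \<in> ?H'" "g \<notin> W" "g \<in> F"
    and a: "a \<in> F" "a \<notin> ?H'" "a \<notin> W" "a \<in> chart i"
    using bad_obtain[OF F] by blast
  have "g \<in> K J"
  proof (rule ccontr)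
    assume "g \<notin> K J"
    then obtain j where j: "j \<in> J" "g \<in> chart j" using g by (auto simp: K_def)
    then have "j \<noteq> i" using g by (auto simp: K_def)
    then have "g + a \<in> K {i}" using j g a J chart_V by (intro sum_in_K[of j i]) auto
    then have "g + a \<in> ?H'" using g a F(1) by (intro spanned_K_base) (auto intro: Sub_add)
    then show False using g a Sub_add_cancel'[OF sub(2)] by blast
  qed
  have HH': "?H \<subseteq> ?H'" using spanned_K_antimono[of "{i}" J F] J by auto
  have "g \<in> ?H" using \<open>g \<in> K J\<close> g by (intro spanned_K_base)
  moreover have "g \<noteq> 0" using g Sub_zero[OF W] by auto
  moreover have "?H \<noteq> F" using HH' a by blast
  ultimately show bad: "bad J F" by (auto simp: bad_def)
  show "?H = ?H'"
    using dim_eq[OF sub HH'] bad_dim[OF F(1) bad J(1)] bad_dim[OF F iI] by simp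
qed

lemma CARD_2:
  assumes "CARD('a) = 2" shows "scale k x = (if k = 0 then 0 else x)" "x + x = 0" "x - y = x + y"
proof -
  have "{0, 1 :: 'a} = UNIV" using assms by (intro card_subset_eq) auto
  then have cases: "k = 0 \<or> k = 1" for k :: 'a by auto
  then show "scale k x = (if k = 0 then 0 else x)" by (metis scale_one scale_zero_left)
  have "(1::'a) + 1 = 0" using cases[of "1 + 1"] by (metis add_cancel_right_right zero_neq_one)
  then have two: "z + z = 0" for z :: 'b by (metis scale_left_distrib scale_one scale_zero_left)
  show "x + x = 0" by (rule two)
  have "- y = y" using two[of y] by (rule minus_unique)
  then show "x - y = x + y" by (metis diff_conv_add_uminus)
qed

text \<open>Such an F is the union of four cosets of S: S itself in W, S + a in chart i, S + b in
  chart j, and S + a + b, which consists of points of the complement.\<close>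

definition pair :: "nat \<Rightarrow> nat \<Rightarrow> 'b set \<Rightarrow> bool" where
  "pair i j F \<longleftrightarrow> CARD('a) = 2 \<and> (\<exists>S a b. S \<in> Sub \<and> S \<subseteq> W \<inter> E i \<inter> E j \<and>
     a \<in> chart i - W \<and> b \<in> chart j - W \<and> F = span (insert a (insert b S)))"

text \<open>If the vectors of F outside the span and W all lie in one chart i, removing that chart
  alone already gives the same span. Otherwise two of them, a and b, lie in different charts, and
  sums across these charts determine F completely.\<close>

lemma bad_cases:
  assumes F: "F \<in> Sub" "bad J F" and J: "J \<subseteq> I"
  obtains (single) i where "i \<in> J" "bad {i} F" "\<And>j. j \<in> J \<Longrightarrow> j \<noteq> i \<Longrightarrow> \<not> bad {j} F"
  | (pair) i j where "i \<in> J" "j \<in> J" "i \<noteq> j" "pair i j F" "\<And>k. k \<in> J \<Longrightarrow> \<not> bad {k} F"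
proof -
  let ?H = "spanned (K J) F"
  have H: "?H \<in> Sub" "?H \<subseteq> F" using spanned_Sub spanned_subset F by auto
  obtain g a i where g: "g \<in> K J" "g \<in> ?H" "g \<notin> W" "g \<in> F"
    and a: "i \<in> J" "a \<in> F" "a \<notin> ?H" "a \<notin> W" "a \<in> chart i"
    using bad_obtain[OF F] .
  have FY: "F \<subseteq> Y" using F SubD by blast
  show ?thesis
  proof (cases "\<forall>x\<in>F. x \<notin> ?H \<longrightarrow> x \<notin> W \<longrightarrow> x \<in> chart i")
    case True
    have "K {i} \<inter> F \<subseteq> ?H" using True by (auto simp: K_def)
    then have "spanned (K {i}) F \<subseteq> ?H" unfolding spanned_def[of "K {i}"] by (rule span_le_Sub[OF H(1)])
    then have "spanned (K {i}) F = ?H" using spanned_K_antimono[of "{i}" J F] a by auto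
    then have "bad {i} F" using F(2) by (simp add: bad_def)
    moreover have "\<not> bad {j} F" if "j \<in> J" "j \<noteq> i" for j
      using that a J FY by (intro not_bad_single[OF F J, of j a] K_single_other[of i j a]) auto
    ultimately show ?thesis using single a(1) by blast
  next
    case False
    then obtain b where b: "b \<in> F" "b \<notin> ?H" "b \<notin> W" "b \<notin> chart i" by blast
    then obtain j where j: "j \<in> J" "b \<in> chart j" using outside_spanned[OF F(1)] by blast
    have ij: "i \<noteq> j" "i \<in> I" "j \<in> I" using b j a J by auto
    have nb: "\<not> bad {k} F" if "k \<in> J" for k
    proof (cases "k = i")
      case True
      then show ?thesis using j b ij FY that by (intro not_bad_single[OF F J, of k b] K_single_other[of j k b]) auto
    next
      case False
      then show ?thesis using a ij J FY that by (intro not_bad_single[OF F J, of k a] K_single_other[of i k a]) auto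
    qed
    have inH: "x + y \<in> ?H" if "x \<in> V i" "x \<in> F" "x \<notin> W" "y \<in> V j" "y \<in> F" "y \<notin> W" for x y
      using that ij J F(1) by (intro spanned_K_base sum_in_K[of i j]) (auto intro: Sub_add)
    have aV: "a \<in> V i" and bV: "b \<in> V j" using a j ij chart_V by auto
    \<comment> \<open>For nonzero d both a + d b and a + b are in the span H, hence so is (d - 1) b;
      as b is not, d = 1.\<close>
    have card: "CARD('a) = 2"
    proof -
      have "d = 1" if d: "d \<noteq> 0" for d :: 'a
      proof (rule ccontr)
        assume "d \<noteq> 1"
        have "scale d b \<notin> W" "scale d b \<in> V j" "scale d b \<in> F"
          using Sub_scale_cancel[OF W d] Sub_scale[OF V(1)] ij bV b F(1) by (auto intro: Sub_scale)
        then have "(a + scale d b) - (a + b) \<in> ?H"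
          using inH[of a "scale d b"] inH[of a b] a b aV bV by (intro Sub_diff[OF H(1)]) auto
        moreover have "(a + scale d b) - (a + b) = scale (d - 1) b"
          by (simp add: scale_left_diff_distrib)
        ultimately show False using Sub_scale_cancel[OF H(1), of "d - 1" b] \<open>d \<noteq> 1\<close> b by simp
      qed
      then have "UNIV = {0, 1 :: 'a}" by blast
      then show ?thesis by (metis card_2_iff zero_neq_one)
    qed
    note two = CARD_2[OF card]
    have hyp: "x + y \<in> ?H" if xy: "x \<in> F" "y \<in> F" "x \<notin> ?H" "y \<notin> ?H" for x y
    proof -
      obtain k where k: "y - scale k x \<in> ?H"
        using hyperplane_coset[OF F(1) H(1,2) bad_dim[OF F J], of x y] xy by blast
      then have "k \<noteq> 0" using xy by auto
      then show ?thesis using k two by (simp add: add.commute)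
    qed
    let ?S = "F \<inter> W"
    \<comment> \<open>Both (z + a) + b and a + b are sums across the two charts, so their difference
      z lies in H.\<close>
    have SH: "?S \<subseteq> ?H"
    proof
      fix z assume z: "z \<in> ?S"
      then have "z \<in> V i" using V(2)[OF ij(2)] by auto
      then have "z + a \<in> V i" "z + a \<in> F" "z + a \<notin> W"
        using z aV a Sub_add[OF V(1)[OF ij(2)]] Sub_add[OF F(1)] Sub_add_cancel'[OF W, of z a] by auto
      then have "(z + a) + b \<in> ?H" using inH bV b by blast
      moreover have "a + b \<in> ?H" using inH aV bV a b by blast
      ultimately show "z \<in> ?H" using Sub_add_cancel[OF H(1), of "a + b" z] by (simp add: add.assoc)
    qed
    \<comment> \<open>A point x of a third chart would make a + b + x avoid W and all charts by
      \<open>transversal3\<close>, although this vector is outside H because a + b is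
      inside.\<close>
    have covered: "x \<in> chart i \<or> x \<in> chart j" if x: "x \<in> F" "x \<notin> ?H" for x
    proof -
      have xW: "x \<notin> W" using SH x by blast
      then obtain k where k: "k \<in> J" "x \<in> chart k" using outside_spanned[OF F(1) x] by blast
      have "k = i \<or> k = j"
      proof (rule ccontr)
        assume k': "\<not> (k = i \<or> k = j)"
        have "a + b + x \<notin> V n" if "n \<in> I" for n
          using that k k' ij J aV bV a b xW chart_V by (intro transversal3[of i j k]) auto
        moreover have "a + b \<in> ?H" using inH aV bV a b by blast
        then have "a + b + x \<notin> ?H" using x Sub_add_cancel'[OF H(1)] by blast
        moreover have "a + b + x \<in> F" using a b x F(1) by (simp add: Sub_add)
        ultimately show False
          using outside_spanned[OF F(1), of "a + b + x"] V(2)[of i] chart_V ij J by blast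
      qed
      then show ?thesis using k by auto
    qed
    \<comment> \<open>Adding z in W to the chart point c stays in V k and outside H, hence in chart
      k. Over the two-element field the proportionality factor is 1, so z itself lies in E
      k.\<close>
    have SE: "?S \<subseteq> E k" if c: "k \<in> I" "c \<in> F" "c \<notin> ?H" "c \<notin> W" "c \<in> chart k"
      "\<And>x. x \<in> F \<Longrightarrow> x \<notin> ?H \<Longrightarrow> x \<in> V k \<Longrightarrow> x \<in> chart k" for c k
    proof
      fix z assume z: "z \<in> ?S"
      then have z': "z \<in> F" "z \<in> ?H" "z \<in> V k" using SH V(2)[OF c(1)] by auto
      have "z + c \<in> F" using Sub_add[OF F(1) z'(1) c(2)] .
      moreover have "z + c \<notin> ?H" using Sub_add_cancel'[OF H(1) z'(2)] c(3) by simp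
      moreover have "z + c \<in> V k" using Sub_add[OF V(1)[OF c(1)] z'(3) chart_V[OF c(1,5)]] .
      ultimately have "z + c \<in> chart k" by (rule c(6))
      then obtain d where "d \<noteq> 0" "z + c - scale d c \<in> E k"
        using chart_proportional[OF c(1,5), of "z + c"] by blast
      then show "z \<in> E k" using two(1)[of d c] by simp
    qed
    have chart_i: "x \<in> chart i" if "x \<in> F" "x \<notin> ?H" "x \<in> V i" for x
      using covered[OF that(1,2)] that SH V_Int[of i j x] ij chart_V[of j x] by blast
    have chart_j: "x \<in> chart j" if "x \<in> F" "x \<notin> ?H" "x \<in> V j" for x
      using covered[OF that(1,2)] that SH V_Int[of i j x] ij chart_V[of i x] by blast
    have S: "?S \<in> Sub" "?S \<subseteq> W \<inter> E i \<inter> E j"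
    proof -
      show "?S \<in> Sub" using F(1) W by (rule Sub_Int)
      have "?S \<subseteq> E i" using ij(2) a(2-5) chart_i by (rule SE)
      moreover have "?S \<subseteq> E j" using ij(3) b(1-3) j(2) chart_j by (rule SE)
      ultimately show "?S \<subseteq> W \<inter> E i \<inter> E j" by blast
    qed
    \<comment> \<open>If x + c were outside W, adding a point of the other chart would give a vector
      of H; since x + c is in H, that point would be too.\<close>
    have near: "x + c \<in> W" if x: "x \<in> F" "x \<notin> ?H" "x \<in> chart k"
      and c: "c \<in> F" "c \<notin> ?H" "c \<in> chart k" and k: "k \<in> {i, j}" for x c k
    proof (rule ccontr)
      assume nW: "x + c \<notin> W"
      have "k \<in> I" using k ij by auto
      have xc: "x + c \<in> V k" "x + c \<in> F" "x + c \<in> ?H"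
        using Sub_add[OF V(1)[OF \<open>k \<in> I\<close>] chart_V[OF \<open>k \<in> I\<close> x(3)] chart_V[OF \<open>k \<in> I\<close> c(3)]]
          Sub_add[OF F(1) x(1) c(1)] hyp[OF x(1) c(1) x(2) c(2)] by auto
      show False
      proof (cases "k = i")
        case True
        then show False using inH[of "x + c" b] xc nW bV b Sub_add_cancel'[OF H(1), of "x + c" b] by blast
      next
        case False
        then have "k = j" using k by auto
        then show False using inH[of a "x + c"] xc nW aV a Sub_add_cancel[OF H(1), of "x + c" a] by blast
      qed
    qed
    have decomp: "x \<in> span (insert a (insert b ?S))" if x: "x \<in> F" "x \<notin> ?H" for x
    proof -
      have "x + a \<in> W \<or> x + b \<in> W" using covered[OF x] near x a b j by blast
      then obtain c where c: "c \<in> {a, b}" "x + c \<in> ?S" using x a b F(1) Sub_add by blast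
      then have "(x + c) - c \<in> span (insert a (insert b ?S))"
        by (intro span_diff span_base) auto
      then show ?thesis by simp
    qed
    have "F = span (insert a (insert b ?S))"
    proof
      show "F \<subseteq> span (insert a (insert b ?S))"
      proof
        fix x assume x: "x \<in> F"
        show "x \<in> span (insert a (insert b ?S))"
        proof (cases "x \<in> ?H")
          case True
          then have "x + a \<notin> ?H" using Sub_add_cancel'[OF H(1), of x a] a(3) by simp
          moreover have "x + a \<in> F" using Sub_add[OF F(1) x a(2)] .
          ultimately have "(x + a) - a \<in> span (insert a (insert b ?S))"
            using decomp by (intro span_diff) (auto intro: span_base)
          then show ?thesis by simp
        qed (use decomp x in blast)
      qed
      show "span (insert a (insert b ?S)) \<subseteq> F" using a b F(1) by (intro span_le_Sub) auto
    qed
    then have "pair i j F"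
      unfolding pair_def using card S a b j by blast
    then show ?thesis using pair[OF a(1) j(1) ij(1) _ nb] by blast
  qed
qed

end

lemma palindromic_monom_half: "even n \<Longrightarrow> palindromic n (monom c (n div 2))"
  unfolding palindromic_iff by (auto elim!: evenE)

context charts
begin

lemma pair_sym: "pair i j F \<longleftrightarrow> pair j i F"
proof -
  have "pair j i F" if p: "pair i j F" for i j
  proof -
    obtain S a b where "CARD('a) = 2" "S \<in> Sub" "S \<subseteq> W \<inter> E i \<inter> E j"
      "a \<in> chart i - W" "b \<in> chart j - W" "F = span (insert a (insert b S))"
      using p unfolding pair_def by blast
    moreover from this have "F = span (insert b (insert a S))" "S \<subseteq> W \<inter> E j \<inter> E i"
      by (auto simp: insert_commute)
    ultimately show ?thesis unfolding pair_def by blast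
  qed
  then show ?thesis by blast
qed

section \<open>Structure of the subspaces attached to two charts\<close>

context
  fixes i j S a b F
  assumes card: "CARD('a) = 2" and ij: "i \<in> I" "j \<in> I" "i \<noteq> j"
    and S: "S \<in> Sub" "S \<subseteq> W \<inter> E i \<inter> E j"
    and a: "a \<in> chart i" "a \<notin> W" and b: "b \<in> chart j" "b \<notin> W"
    and F: "F = span (insert a (insert b S))"
begin

lemma pair_mem_iff: "x \<in> F \<longleftrightarrow> x \<in> S \<or> x + a \<in> S \<or> x + b \<in> S \<or> x + (a + b) \<in> S"
proof -
  note two = CARD_2(1,3)[OF card]
  have "{0, 1 :: 'a} = UNIV" using card by (intro card_subset_eq) auto
  then have ex: "(\<exists>k. P k) \<longleftrightarrow> P 0 \<or> P 1" for P :: "'a \<Rightarrow> bool" by (metis UNIV_I insertE singletonD)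
  show ?thesis
    unfolding F span_breakdown_eq span_Sub[OF S(1)] ex
    by (simp add: two(2) add.assoc) blast
qed

lemma pair_points: "a \<in> V i" "b \<in> V j" "a + b \<notin> W"
  "s \<in> S \<Longrightarrow> s + a \<in> V i" "s \<in> S \<Longrightarrow> s + a \<notin> W" "s \<in> S \<Longrightarrow> s + a \<in> chart i"
  "s \<in> S \<Longrightarrow> s + b \<in> V j" "s \<in> S \<Longrightarrow> s + b \<notin> W" "s \<in> S \<Longrightarrow> s + b \<in> chart j"
  "s \<in> S \<Longrightarrow> s + (a + b) \<notin> W"
proof -
  show ab: "a \<in> V i" "b \<in> V j" using a b ij chart_V by auto
  have "a + b \<notin> V i" using ab a b ij by (intro transversal[of i j]) auto
  then show abW: "a + b \<notin> W" using V(2)[OF ij(1)] by blast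
  show "s + a \<in> V i" "s + b \<in> V j" if "s \<in> S"
  proof -
    have "s \<in> V i" "s \<in> V j" using that S V(2) ij by blast+
    then show "s + a \<in> V i" "s + b \<in> V j" using ab V(1) ij Sub_add by blast+
  qed
  show "s + a \<notin> W" "s + b \<notin> W" "s + (a + b) \<notin> W" if "s \<in> S"
    using that S(2) a(2) b(2) abW Sub_add_cancel'[OF W, of s] by blast+
  show "s + a \<in> chart i" "s + b \<in> chart j" if "s \<in> S"
    using that S(2) a(1) b(1) chart_add_E[OF ij(1), of s a] chart_add_E[OF ij(2), of s b]
    by (auto simp: add.commute)
qed

lemma add_mem_S: "x + y \<in> S \<Longrightarrow> \<exists>s\<in>S. x = s + y"
  using CARD_2(2)[OF card, of y] by (intro bexI[of _ "x + y"]) (simp_all add: add.assoc)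

lemma pair_Sub: "F \<in> Sub"
proof -
  have "a \<in> Y" "b \<in> Y" using pair_points(1,2) SubD(2)[OF V(1)] ij by auto
  then show ?thesis using SubD(2)[OF S(1)] unfolding F by (intro span_in_Sub) auto
qed

lemma pair_base: "a \<in> F" "b \<in> F" "S \<subseteq> F" "a + b \<in> F"
  unfolding F by (auto intro: span_base span_add)

lemma pair_Int_W: "F \<inter> W = S"
proof
  show "F \<inter> W \<subseteq> S"
  proof
    fix x assume x: "x \<in> F \<inter> W"
    show "x \<in> S"
    proof (rule ccontr)
      assume "x \<notin> S"
      then have "x + a \<in> S \<or> x + b \<in> S \<or> x + (a + b) \<in> S" using x pair_mem_iff by auto
      then show False using x add_mem_S pair_points(5,8,10) by blast
    qed
  qed
qed (use pair_base S in auto)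

text \<open>F determines S as its intersection with W, but determines a only up to the coset S + a.
  This redundancy is divided out in \<open>card_pair\<close>.\<close>

lemma pair_Int_chart: "F \<inter> (chart i - W) = (\<lambda>s. s + a) ` S"
proof
  show "F \<inter> (chart i - W) \<subseteq> (\<lambda>s. s + a) ` S"
  proof
    fix x assume x: "x \<in> F \<inter> (chart i - W)"
    then have xV: "x \<in> V i" using chart_V ij by auto
    have "x \<notin> S" using x S by auto
    moreover have "x + b \<notin> S"
    proof
      assume "x + b \<in> S"
      then obtain s where "s \<in> S" "x = s + b" using add_mem_S by blast
      then show False using V_Int[OF ij xV] pair_points(7) x by auto
    qed
    moreover have "x + (a + b) \<notin> S"
    proof
      assume "x + (a + b) \<in> S"
      then obtain s where s: "s \<in> S" "x = s + (a + b)" using add_mem_S by blast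
      then have "s + a + b \<notin> V i"
        using pair_points ij b by (intro transversal[of i j]) auto
      then show False using s xV by (simp add: add.assoc)
    qed
    ultimately have "x + a \<in> S" using x pair_mem_iff by auto
    then show "x \<in> (\<lambda>s. s + a) ` S" using add_mem_S by blast
  qed
  show "(\<lambda>s. s + a) ` S \<subseteq> F \<inter> (chart i - W)"
    using pair_points(5,6) pair_base Sub_add[OF pair_Sub] by blast
qed

lemma pair_dim: "dim F = dim S + 2"
proof -
  have "b \<notin> S" using S b by auto
  then have 1: "dim (insert b S) = Suc (dim S)" by (rule dim_insert_Sub[OF S(1)])
  have "insert b S \<subseteq> Y" using pair_base SubD(2)[OF pair_Sub] by auto
  moreover have "a \<in> Y" using pair_base SubD(2)[OF pair_Sub] by auto
  moreover have "a \<notin> span (insert b S)"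
  proof
    assume "a \<in> span (insert b S)"
    then obtain k where "a - scale k b \<in> S" by (auto simp: span_breakdown_eq span_Sub[OF S(1)])
    then have "a \<in> S \<or> a + b \<in> S" using CARD_2(1)[OF card, of k b] CARD_2(3)[OF card, of a b] by (metis diff_zero)
    then show False using S a pair_points(3) by auto
  qed
  ultimately show ?thesis unfolding F by (simp add: dim_insert 1)
qed

text \<open>Of the four cosets of S in F only S + a + b consists of points of \<open>K J\<close>.
  Hence S is a hyperplane of the span, and the points there form an affine geometry.\<close>

lemma pair_spanned:
  assumes J: "i \<in> J" "j \<in> J" "J \<subseteq> I"
  shows "spanned (K J) F = span (insert (a + b) S)"
proof -
  have Sab: "s + (a + b) \<in> K J" if "s \<in> S" for s
    using sum_in_K[OF ij J(3) pair_points(4)[OF that] pair_points(5)[OF that] pair_points(2) b(2)]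
    by (simp add: add.assoc)
  have "K J \<inter> F = (\<lambda>s. s + (a + b)) ` S"
  proof
    show "K J \<inter> F \<subseteq> (\<lambda>s. s + (a + b)) ` S"
    proof
      fix x assume x: "x \<in> K J \<inter> F"
      have "x \<notin> S" using x S by (auto simp: K_def)
      moreover have "x + a \<notin> S" "x + b \<notin> S"
        using x J add_mem_S pair_points(6,9) by (fastforce simp: K_def)+
      ultimately have "x + (a + b) \<in> S" using x pair_mem_iff by auto
      then show "x \<in> (\<lambda>s. s + (a + b)) ` S" using add_mem_S by blast
    qed
    show "(\<lambda>s. s + (a + b)) ` S \<subseteq> K J \<inter> F"
      using Sab pair_base Sub_add[OF pair_Sub] by blast
  qed
  then have eq: "spanned (K J) F = span ((\<lambda>s. s + (a + b)) ` S)" by (simp add: spanned_def)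
  let ?A = "span ((\<lambda>s. s + (a + b)) ` S)"
  have base: "s + (a + b) \<in> ?A" if "s \<in> S" for s using that by (intro span_base) auto
  have "a + b \<in> ?A" using base[of 0] Sub_zero[OF S(1)] by simp
  moreover have "s \<in> ?A" if "s \<in> S" for s
    using span_diff[OF base[OF that] \<open>a + b \<in> ?A\<close>] by simp
  ultimately have "insert (a + b) S \<subseteq> ?A" by auto
  moreover have "(\<lambda>s. s + (a + b)) ` S \<subseteq> span (insert (a + b) S)"
    using span_add[OF span_base span_base, of _ "insert (a + b) S" "a + b"] by auto
  ultimately show ?thesis unfolding eq by (simp add: span_eq)
qed

lemma pair_bad:
  assumes J: "i \<in> J" "j \<in> J" "J \<subseteq> I"
  shows "bad J F" and "k \<in> J \<Longrightarrow> \<not> bad {k} F"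
    and "dim (spanned (K J) F) = Suc (dim (spanned (K J) F \<inter> W))"
proof -
  let ?H = "spanned (K J) F"
  have H: "?H \<in> Sub" "?H \<subseteq> F" using spanned_Sub spanned_subset pair_Sub by auto
  have mem: "x \<in> ?H \<longleftrightarrow> x \<in> S \<or> x + (a + b) \<in> S" for x
  proof -
    have "(\<exists>k. x - scale k (a + b) \<in> S) \<longleftrightarrow> x \<in> S \<or> x + (a + b) \<in> S"
      using CARD_2(1)[OF card, of _ "a + b"] CARD_2(3)[OF card, of x "a + b"] zero_neq_one
      by (metis diff_zero)
    then show ?thesis
      unfolding pair_spanned[OF J] span_breakdown_eq span_Sub[OF S(1)] .
  qed
  have "a + b \<in> ?H" using Sub_zero[OF S(1)] CARD_2(2)[OF card] mem by simp
  moreover have "a + b \<noteq> 0" using pair_points(3) Sub_zero[OF W] by metis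
  moreover have "dim F \<noteq> dim ?H"
  proof -
    have "a + b \<notin> S" using S pair_points(3) by auto
    then show ?thesis unfolding pair_spanned[OF J] pair_dim by (simp add: dim_insert_Sub[OF S(1)])
  qed
  ultimately show bad: "bad J F" by (auto simp: bad_def)
  have "?H \<inter> W = S" using mem pair_Int_W H by blast
  then show "dim ?H = Suc (dim (?H \<inter> W))"
    using bad_dim[OF pair_Sub bad J(3)] pair_dim by simp
  have nH: "a \<notin> ?H" "b \<notin> ?H"
    using bad_Int_chart[OF pair_Sub bad J(3) J(1), of a] bad_Int_chart[OF pair_Sub bad J(3) J(2), of b] a b
    by auto
  have Y: "a \<in> Y" "b \<in> Y" using pair_base SubD(2)[OF pair_Sub] by auto
  show "\<not> bad {k} F" if k: "k \<in> J"
  proof (cases "k = i")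
    case True
    then show ?thesis using b ij Y nH pair_base k
      by (intro not_bad_single[OF pair_Sub bad J(3), of k b] K_single_other[of j k b]) auto
  next
    case False
    then show ?thesis using a ij Y nH pair_base k J
      by (intro not_bad_single[OF pair_Sub bad J(3), of k a] K_single_other[of i k a]) auto
  qed
qed

lemma pair_chart_index:
  assumes "k \<in> I" "x \<in> F" "x \<in> chart k" "x \<notin> W" shows "k = i \<or> k = j"
proof (rule ccontr)
  assume k: "\<not> (k = i \<or> k = j)"
  have xV: "x \<in> V k" using assms chart_V by blast
  have "x \<notin> S" using assms S by auto
  moreover have "x + a \<notin> S" "x + b \<notin> S"
    using add_mem_S pair_points(4,7) V_Int[of i k x] V_Int[of j k x] ij assms k xV by blast+
  moreover have "x + (a + b) \<notin> S"
  proof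
    assume "x + (a + b) \<in> S"
    then obtain s where s: "s \<in> S" "x = s + (a + b)" using add_mem_S by blast
    then have "s + a + b \<notin> V k"
      using pair_points ij b assms by (intro transversal[of i j]) auto
    then show False using s xV by (simp add: add.assoc)
  qed
  ultimately show False using assms pair_mem_iff by auto
qed

end

lemma pairE:
  assumes "pair i j F"
  obtains S a b where "CARD('a) = 2" "S \<in> Sub" "S \<subseteq> W \<inter> E i \<inter> E j"
    "a \<in> chart i" "a \<notin> W" "b \<in> chart j" "b \<notin> W" "F = span (insert a (insert b S))"
  using assms unfolding pair_def by blast

text \<open>The chart points in any second presentation of F lie in charts i and j by
  \<open>pair_chart_index\<close>; the ordering of indices excludes the swapped pair.\<close>

lemma pair_unique:
  assumes "i \<in> I" "j \<in> I" "i < j" "pair i j F" and "i' \<in> I" "j' \<in> I" "i' < j'" "pair i' j' F"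
  shows "i' = i \<and> j' = j"
proof -
  obtain S a b where s: "CARD('a) = 2" "S \<in> Sub" "S \<subseteq> W \<inter> E i \<inter> E j"
    "a \<in> chart i" "a \<notin> W" "b \<in> chart j" "b \<notin> W" "F = span (insert a (insert b S))"
    using assms(4) by (rule pairE)
  obtain S' a' b' where s': "CARD('a) = 2" "S' \<in> Sub" "S' \<subseteq> W \<inter> E i' \<inter> E j'"
    "a' \<in> chart i'" "a' \<notin> W" "b' \<in> chart j'" "b' \<notin> W" "F = span (insert a' (insert b' S'))"
    using assms(8) by (rule pairE)
  have "a' \<in> F" "b' \<in> F" unfolding s'(8) by (auto intro: span_base)
  then have "i' = i \<or> i' = j" "j' = i \<or> j' = j"
    using pair_chart_index[OF s(1) assms(1,2) _ s(2-8)] assms s' by auto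
  then show ?thesis using assms(3,7) by auto
qed

lemma pair_imp:
  assumes "i \<in> J" "j \<in> J" "i \<noteq> j" "J \<subseteq> I" "pair i j F"
  shows "F \<in> Sub" "bad J F" "\<And>k. k \<in> J \<Longrightarrow> \<not> bad {k} F"
    "dim (spanned (K J) F) = Suc (dim (spanned (K J) F \<inter> W))" "F \<noteq> {0}" "CARD('a) = 2"
proof -
  obtain S a b where s: "CARD('a) = 2" "S \<in> Sub" "S \<subseteq> W \<inter> E i \<inter> E j"
    "a \<in> chart i" "a \<notin> W" "b \<in> chart j" "b \<notin> W" "F = span (insert a (insert b S))"
    using assms(5) by (rule pairE)
  have ij: "i \<in> I" "j \<in> I" using assms by auto
  note facts = s(1) ij assms(3) s(2-8)
  show "F \<in> Sub" using pair_Sub[OF facts] .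
  show "bad J F" using pair_bad(1)[OF facts assms(1,2,4)] .
  show "\<And>k. k \<in> J \<Longrightarrow> \<not> bad {k} F" using pair_bad(2)[OF facts assms(1,2,4)] .
  show "dim (spanned (K J) F) = Suc (dim (spanned (K J) F \<inter> W))"
    using pair_bad(3)[OF facts assms(1,2,4)] .
  show "F \<noteq> {0}" using pair_dim[OF facts] dim_zero by auto
  show "CARD('a) = 2" by fact
qed

section \<open>Comparison of push-forward coefficients for different sets of charts\<close>

lemma disjoint_K_cases:
  assumes U: "U \<in> Sub" and J: "J \<subseteq> I"
  shows "spanned (K J) U = {0} \<longleftrightarrow> U \<subseteq> W \<or> (\<exists>i\<in>J. \<not> U \<subseteq> W \<and> U \<subseteq> W \<union> chart i)"
  unfolding spanned_zero_iff[OF U]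
proof
  assume disj: "K J \<inter> U = {}"
  then have cov: "x \<in> W \<or> (\<exists>i\<in>J. x \<in> chart i)" if "x \<in> U" for x
    using that SubD(2)[OF U] by (auto simp: K_def)
  show "U \<subseteq> W \<or> (\<exists>i\<in>J. \<not> U \<subseteq> W \<and> U \<subseteq> W \<union> chart i)"
  proof (cases "U \<subseteq> W")
    case False
    then obtain a i where a: "a \<in> U" "a \<notin> W" "i \<in> J" "a \<in> chart i" using cov by blast
    have "x \<in> W \<union> chart i" if x: "x \<in> U" for x
    proof (rule ccontr)
      assume nx: "x \<notin> W \<union> chart i"
      then obtain j where "j \<in> J" "x \<in> chart j" using cov x by blast
      then have "a + x \<in> K J" using a nx J chart_V by (intro sum_in_K[of i j]) auto
      then show False using disj Sub_add[OF U a(1) x] by blast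
    qed
    then show ?thesis using a False by blast
  qed simp
qed (auto simp: K_def)

lemma fibre_sum_charts:
  assumes J: "J \<subseteq> I"
  shows "fibre_sum (K J) F {0} = (\<Sum>U\<in>{U \<in> Sub. U \<subseteq> F \<and> U \<subseteq> W}. monom 1 (dim U))
    + (\<Sum>i\<in>J. \<Sum>U\<in>{U \<in> Sub. U \<subseteq> F \<and> \<not> U \<subseteq> W \<and> U \<subseteq> W \<union> chart i}. monom 1 (dim U))"
proof -
  let ?A = "{U \<in> Sub. U \<subseteq> F \<and> U \<subseteq> W}"
  let ?B = "\<lambda>i. {U \<in> Sub. U \<subseteq> F \<and> \<not> U \<subseteq> W \<and> U \<subseteq> W \<union> chart i}"
  have finJ: "finite J" using J finite_I finite_subset by blast
  have "{U \<in> Sub. U \<subseteq> F \<and> spanned (K J) U = {0}} = {U \<in> Sub. U \<subseteq> F \<and>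
      (U \<subseteq> W \<or> (\<exists>i\<in>J. \<not> U \<subseteq> W \<and> U \<subseteq> W \<union> chart i))}"
    by (intro Collect_cong conj_cong refl disjoint_K_cases[OF _ J]) assumption
  also have "\<dots> = ?A \<union> (\<Union>i\<in>J. ?B i)" by auto
  finally have "{U \<in> Sub. U \<subseteq> F \<and> spanned (K J) U = {0}} = ?A \<union> (\<Union>i\<in>J. ?B i)" .
  then have "fibre_sum (K J) F {0} = (\<Sum>U\<in>?A \<union> (\<Union>i\<in>J. ?B i). monom 1 (dim U))"
    by (simp add: fibre_sum_def dim_zero)
  also have "\<dots> = (\<Sum>U\<in>?A. monom 1 (dim U)) + (\<Sum>U\<in>(\<Union>i\<in>J. ?B i). monom 1 (dim U))"
    using finite_Sub finJ by (intro sum.union_disjoint) auto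
  also have "(\<Sum>U\<in>(\<Union>i\<in>J. ?B i). monom 1 (dim U)) = (\<Sum>i\<in>J. \<Sum>U\<in>?B i. monom (1::int) (dim U))"
  proof (rule sum.UNION_disjoint[OF finJ])
    show "\<forall>i\<in>J. finite (?B i)" using finite_Sub by simp
    show "\<forall>i\<in>J. \<forall>j\<in>J. i \<noteq> j \<longrightarrow> ?B i \<inter> ?B j = {}"
    proof (intro ballI impI)
      fix i j assume ij: "i \<in> J" "j \<in> J" "i \<noteq> j"
      have "x \<in> W" if "x \<in> W \<union> chart i" "x \<in> W \<union> chart j" for x
        using that V_Int[of i j x] chart_V[of i x] chart_V[of j x] ij J by blast
      then show "?B i \<inter> ?B j = {}" by blast
    qed
  qed
  finally show ?thesis .
qed

lemma push_coeff_zero: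
  assumes "Q {0} {0} = 1" shows "push_coeff A Q {0} {0} = 1"
proof -
  have sp: "spanned A {0} = {0}" using zero_in_lat by (rule spanned_lat)
  have "{U \<in> Sub. U \<subseteq> {0} \<and> {0} \<subseteq> spanned A U} = {{0}}"
    using zero_in_Sub Sub_zero sp by auto
  then show ?thesis using assms sp by (simp add: push_coeff_def monom_0)
qed

definition pairs :: "nat set \<Rightarrow> (nat \<times> nat) set" where
  "pairs J = {(i, j). i \<in> J \<and> j \<in> J \<and> i < j}"

lemma finite_pairs: "J \<subseteq> I \<Longrightarrow> finite (pairs J)"
  using finite_I by (intro finite_subset[of "pairs J" "I \<times> I"]) (auto simp: pairs_def)

text \<open>A monomial in the middle degree of F. In the application \<open>t b\<close> is
  \<open>tau\<close> of AG(b,2), where b = dim F - 2 is the dimension of the part of F in W.\<close>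

definition pair_term :: "(nat \<Rightarrow> int) \<Rightarrow> nat \<times> nat \<Rightarrow> 'b set \<Rightarrow> int poly" where
  "pair_term t p F = (if pair (fst p) (snd p) F \<and> even (dim F)
     then monom (t (dim F - 2)) (dim F div 2) else 0)"

context
  fixes P Q :: "nat set \<Rightarrow> 'b set \<Rightarrow> 'b set \<Rightarrow> int poly"
    and \<kappa> :: "'b set \<Rightarrow> int poly" and t :: "nat \<Rightarrow> int"
  assumes KL: "\<And>J. J \<subseteq> I \<Longrightarrow> KL_family (lat (K J)) (P J)"
    and inv: "\<And>J. J \<subseteq> I \<Longrightarrow> inv_KL_family (lat (K J)) (P J) (Q J)"
    and \<kappa>: "\<And>J H. J \<subseteq> I \<Longrightarrow> H \<in> lat (K J) \<Longrightarrow> K J \<inter> H = H - W \<Longrightarrow> P J {0} H = \<kappa> H"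
    and t: "\<And>H. H \<in> Sub \<Longrightarrow> CARD('a) = 2 \<Longrightarrow> dim H = Suc (dim (H \<inter> W)) \<Longrightarrow> even (dim (H \<inter> W)) \<Longrightarrow>
      coeff (\<kappa> H) (dim (H \<inter> W) div 2) = t (dim (H \<inter> W))"
begin

text \<open>The middle coefficient by which the push-forward coefficient of a bad subspace differs
  from the sum over the subspaces with span zero.\<close>

definition defect :: "nat set \<Rightarrow> 'b set \<Rightarrow> nat \<Rightarrow> int" where
  "defect J F i = (if bad J F \<and> dim F = 2 * i then coeff (\<kappa> (spanned (K J) F)) (i - 1) else 0)"

lemma coeff_push_coeff_charts:
  assumes "J \<subseteq> I" "F \<in> Sub" "F \<noteq> {0}" "dim F \<le> 2 * i"
  shows "coeff (push_coeff (K J) (Q J) {0} F) i = coeff (fibre_sum (K J) F {0}) i - defect J F i"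
proof -
  have "P J {0} (spanned (K J) F) = \<kappa> (spanned (K J) F)" if "bad J F"
    using assms that by (intro \<kappa> spanned_in_lat K_Int_spanned_bad)
  then show ?thesis
    using coeff_push_coeff[OF KL[OF assms(1)] inv[OF assms(1)] corank_one_K[OF assms(1)] assms(2-4)]
    by (auto simp: defect_def bad_def)
qed

text \<open>In the single-chart case the spans for J and for {k} coincide and
  \<open>\<kappa>\<close> depends on the span only, so the defects agree. In the case of two charts
  all singleton defects vanish, and exactly one pair term is attached to F.\<close>

lemma defect_charts:
  assumes J: "J \<subseteq> I" and F: "F \<in> Sub"
  shows "defect J F i = (\<Sum>k\<in>J. defect {k} F i) + (\<Sum>p\<in>pairs J. coeff (pair_term t p F) i)"
proof (cases "bad J F")
  case False
  have "defect {k} F i = 0" if "k \<in> J" for k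
    using bad_single_imp(1)[OF F _ J that] False by (auto simp: defect_def)
  moreover have "pair_term t p F = 0" if "p \<in> pairs J" for p
    using pair_imp(2)[OF _ _ _ J] that False by (fastforce simp: pairs_def pair_term_def)
  ultimately show ?thesis using False by (simp add: defect_def)
next
  case True
  have finJ: "finite J" using J finite_I finite_subset by blast
  from F True J show ?thesis
  proof (cases rule: bad_cases)
    case (single k)
    have "defect {k'} F i = (if k' = k then defect {k} F i else 0)" if "k' \<in> J" for k'
      using single(3)[OF that] by (auto simp: defect_def)
    then have "(\<Sum>k'\<in>J. defect {k'} F i) = (\<Sum>k'\<in>J. if k' = k then defect {k} F i else 0)"
      by (rule sum.cong[OF refl])
    also have "\<dots> = defect {k} F i"
      unfolding sum.delta[OF finJ] using single(1) by simp
    finally have "(\<Sum>k\<in>J. defect {k} F i) = defect {k} F i" .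
    moreover have "pair_term t p F = 0" if "p \<in> pairs J" for p
      using pair_imp(3)[OF _ _ _ J, of "fst p" "snd p" F k] that single(1,2)
      by (auto simp: pairs_def pair_term_def)
    moreover have "defect J F i = defect {k} F i"
      using bad_single_imp[OF F single(2) J single(1)] single(2) by (simp add: defect_def)
    ultimately show ?thesis by simp
  next
    case (pair k n)
    obtain p where p: "p \<in> pairs J" "pair (fst p) (snd p) F"
    proof (cases "k < n")
      case True
      then show ?thesis using that[of "(k, n)"] pair(1,2,4) by (simp add: pairs_def)
    next
      case False
      then show ?thesis using that[of "(n, k)"] pair(1-4) pair_sym[of k n F] by (simp add: pairs_def)
    qed
    then have pJ: "fst p \<in> J" "snd p \<in> J" "fst p < snd p" by (auto simp: pairs_def)
    let ?H = "spanned (K J) F"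
    have "defect {k'} F i = 0" if "k' \<in> J" for k'
      using pair(5)[OF that] by (simp add: defect_def)
    moreover have "(\<Sum>p'\<in>pairs J. coeff (pair_term t p' F) i) = coeff (pair_term t p F) i"
    proof -
      have "pair_term t p' F = 0" if p': "p' \<in> pairs J - {p}" for p'
      proof -
        have "fst p \<in> I" "snd p \<in> I" "fst p' \<in> I" "snd p' \<in> I" "fst p' < snd p'" "p' \<noteq> p"
          using p' pJ J by (auto simp: pairs_def)
        then have "\<not> pair (fst p') (snd p') F"
          using pair_unique[of "fst p" "snd p" F "fst p'" "snd p'"] p(2) pJ(3) by (metis prod_eqI)
        then show ?thesis by (simp add: pair_term_def)
      qed
      then show ?thesis using p(1) finite_pairs[OF J] by (simp add: sum.remove)
    qed
    moreover have "defect J F i = coeff (pair_term t p F) i"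
    proof -
      have card: "CARD('a) = 2" and H: "dim ?H = Suc (dim (?H \<inter> W))"
        using pair_imp(4,6)[OF pJ(1,2) _ J p(2)] pJ(3) by auto
      \<comment> \<open>One dimension separates F from its span, another the span from W; hence the
        argument dim F - 2 of t.\<close>
      have dimF: "dim F = dim (?H \<inter> W) + 2" using bad_dim[OF F True J] H by simp
      show ?thesis
      proof (cases "even (dim F)")
        case even: True
        then have "coeff (\<kappa> ?H) (dim (?H \<inter> W) div 2) = t (dim (?H \<inter> W))"
          using H card dimF by (intro t spanned_Sub F) auto
        moreover have "dim F = 2 * i \<longleftrightarrow> i = dim F div 2" using even by auto
        moreover have "dim F div 2 - 1 = dim (?H \<inter> W) div 2" "dim F - 2 = dim (?H \<inter> W)"
          using dimF by auto
        ultimately show ?thesis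
          using True p(2) even by (auto simp: defect_def pair_term_def)
      next
        case odd: False
        then have "dim F \<noteq> 2 * i" by auto
        then show ?thesis using odd by (simp add: defect_def pair_term_def)
      qed
    qed
    ultimately show ?thesis by simp
  qed
qed

text \<open>Both sides are palindromic of weight dim F, so coefficients from the middle on suffice.
  There the coefficient is a fibre sum minus a defect; the former is additive in the charts, the
  latter additive up to pair terms. The zero subspace is treated apart, as
  \<open>coeff_push_coeff\<close> excludes it.\<close>

lemma push_coeff_charts:
  assumes J: "J \<subseteq> I" and F: "F \<in> Sub"
  shows "push_coeff (K J) (Q J) {0} F = push_coeff (K {}) (Q {}) {0} F
    + (\<Sum>k\<in>J. push_coeff (K {k}) (Q {k}) {0} F - push_coeff (K {}) (Q {}) {0} F)
    - (\<Sum>p\<in>pairs J. pair_term t p F)"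
proof (cases "F = {0}")
  case True
  have "push_coeff (K J') (Q J') {0} {0} = 1" if "J' \<subseteq> I" for J'
    using inv[OF that] zero_in_lat[of "K J'"] by (intro push_coeff_zero) (simp add: inv_KL_family_def)
  moreover have "pair_term t p {0} = 0" if "p \<in> pairs J" for p
    using pair_imp(5)[OF _ _ _ J, of "fst p" "snd p" "{0}"] that
    by (auto simp: pair_term_def pairs_def)
  ultimately show ?thesis using True J by (simp add: subset_iff)
next
  case False
  let ?T = "\<lambda>J'. push_coeff (K J') (Q J') {0} F"
  let ?\<delta> = "?T J - (?T {} + (\<Sum>k\<in>J. ?T {k} - ?T {}) - (\<Sum>p\<in>pairs J. pair_term t p F))"
  have pal: "palindromic (dim F) (?T J')" if "J' \<subseteq> I" for J'
    using palindromic_push_coeff[OF KL[OF that] inv[OF that] zero_in_lat F] Sub_zero[OF F] dim_zero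
    by simp
  have "?\<delta> = 0"
  proof (rule palindromic_eq_0)
    have "palindromic (dim F) (pair_term t p F)" for p
      by (simp add: pair_term_def palindromic_monom_half)
    moreover have "palindromic (dim F) (?T {k} - ?T {})" if "k \<in> J" for k
      using that J by (intro palindromic_diff pal) auto
    ultimately show "palindromic (dim F) ?\<delta>"
      using J by (intro palindromic_diff palindromic_add palindromic_sum pal) auto
  next
    fix i assume i: "dim F \<le> 2 * i"
    have T: "coeff (?T J') i = coeff (fibre_sum (K J') F {0}) i - defect J' F i" if "J' \<subseteq> I" for J'
      using coeff_push_coeff_charts[OF that F False i] .
    let ?B = "\<lambda>k. \<Sum>U\<in>{U \<in> Sub. U \<subseteq> F \<and> \<not> U \<subseteq> W \<and> U \<subseteq> W \<union> chart k}. monom (1::int) (dim U)"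
    have T1: "coeff (?T {k}) i - coeff (?T {}) i = coeff (?B k) i - defect {k} F i" if "k \<in> J" for k
      using that J T[of "{k}"] T[of "{}"] fibre_sum_charts[of "{k}" F] fibre_sum_charts[of "{}" F]
        not_bad_empty[OF F] by (auto simp: defect_def)
    have "coeff (?T J) i - coeff (?T {}) i
        = (\<Sum>k\<in>J. coeff (?B k) i) - defect J F i"
      using J T[of J] T[of "{}"] fibre_sum_charts[of J F] fibre_sum_charts[of "{}" F]
        not_bad_empty[OF F] by (simp add: defect_def coeff_sum[of "\<lambda>k. ?B k" J])
    also have "\<dots> = (\<Sum>k\<in>J. coeff (?B k) i - defect {k} F i) - (\<Sum>p\<in>pairs J. coeff (pair_term t p F) i)"
      unfolding defect_charts[OF J F] sum_subtractf by simp
    also have "(\<Sum>k\<in>J. coeff (?B k) i - defect {k} F i) = (\<Sum>k\<in>J. coeff (?T {k}) i - coeff (?T {}) i)"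
      by (intro sum.cong refl) (simp only: T1)
    finally show "coeff ?\<delta> i = 0"
      by (simp add: coeff_sum)
  qed
  then show ?thesis by simp
qed

end

lemma inv_KL_charts:
  fixes P Q :: "nat set \<Rightarrow> 'b set \<Rightarrow> 'b set \<Rightarrow> int poly"
  assumes KL: "\<And>J. J \<subseteq> I \<Longrightarrow> KL_family (lat (K J)) (P J)"
    and inv: "\<And>J. J \<subseteq> I \<Longrightarrow> inv_KL_family (lat (K J)) (P J) (Q J)"
    and "\<And>J H. J \<subseteq> I \<Longrightarrow> H \<in> lat (K J) \<Longrightarrow> K J \<inter> H = H - W \<Longrightarrow> P J {0} H = \<kappa> H"
    and "\<And>H. H \<in> Sub \<Longrightarrow> CARD('a) = 2 \<Longrightarrow> dim H = Suc (dim (H \<inter> W)) \<Longrightarrow> even (dim (H \<inter> W)) \<Longrightarrow>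
      coeff (\<kappa> H) (dim (H \<inter> W) div 2) = t (dim (H \<inter> W))"
    and spans: "spanned (K I) Y = Y" and J: "J \<subseteq> I"
  shows "Q J {0} Y = Q {} {0} Y + (\<Sum>k\<in>J. Q {k} {0} Y - Q {} {0} Y)
    - (\<Sum>p\<in>pairs J. \<Sum>F\<in>Sub. smult ((- 1) ^ dim F * int (CARD('a)) ^ ((dim Y - dim F) choose 2))
        (pair_term t p F))"
proof -
  let ?m = "\<lambda>F. (- 1) ^ dim F * int (CARD('a)) ^ ((dim Y - dim F) choose 2)"
  let ?T = "\<lambda>J. push_coeff (K J) (Q J) {0}"
  have Q: "Q J' {0} Y = (\<Sum>F\<in>Sub. smult (?m F) (?T J' F))" if "J' \<subseteq> I" for J'
  proof (rule inv_KL_eq_sum_push_coeff[OF KL[OF that] inv[OF that]])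
    \<comment> \<open>Removing fewer charts leaves more points, so spanning is inherited from the
      full set I.\<close>
    show "spanned (K J') Y = Y"
      using spanned_K_antimono[OF that, of Y] spanned_subset[OF Y_in_Sub, of "K J'"] spans by blast
  qed
  have "Q J {0} Y = (\<Sum>F\<in>Sub. smult (?m F) (?T {} F + (\<Sum>k\<in>J. ?T {k} F - ?T {} F)
      - (\<Sum>p\<in>pairs J. pair_term t p F)))"
    unfolding Q[OF J] by (intro sum.cong refl) (subst push_coeff_charts[OF assms(1-4) J], simp_all)
  also have "\<dots> = (\<Sum>F\<in>Sub. smult (?m F) (?T {} F))
      + (\<Sum>F\<in>Sub. \<Sum>k\<in>J. smult (?m F) (?T {k} F) - smult (?m F) (?T {} F))
      - (\<Sum>F\<in>Sub. \<Sum>p\<in>pairs J. smult (?m F) (pair_term t p F))"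
    by (simp only: smult_diff_right smult_add_right smult_sum_right sum.distrib sum_subtractf)
  also have "\<dots> = Q {} {0} Y + (\<Sum>k\<in>J. Q {k} {0} Y - Q {} {0} Y)
      - (\<Sum>p\<in>pairs J. \<Sum>F\<in>Sub. smult (?m F) (pair_term t p F))"
  proof -
    have "(\<Sum>F\<in>Sub. \<Sum>k\<in>J. smult (?m F) (?T {k} F) - smult (?m F) (?T {} F))
        = (\<Sum>k\<in>J. \<Sum>F\<in>Sub. smult (?m F) (?T {k} F) - smult (?m F) (?T {} F))"
      by (rule sum.swap)
    also have "\<dots> = (\<Sum>k\<in>J. Q {k} {0} Y - Q {} {0} Y)"
      using J by (intro sum.cong refl) (simp add: Q subset_iff sum_subtractf)
    finally show ?thesis
      using Q[of "{}"] sum.swap[of "\<lambda>F p. smult (?m F) (pair_term t p F)" "pairs J" Sub] by simp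
  qed
  finally show ?thesis .
qed

section \<open>Counting the subspaces attached to two charts\<close>

lemma card_chart_minus_W:
  assumes "i \<in> I" "CARD('a) = 2" "\<not> D i \<inter> W \<subseteq> E i"
  shows "card (chart i - W) = 2 ^ dim (E i) - 2 ^ dim (W \<inter> E i)"
proof -
  have DW: "D i \<inter> W \<in> Sub" using D W assms by (intro Sub_Int)
  have "dim (D i \<inter> W) = Suc (dim (D i \<inter> W \<inter> E i))"
    using D E assms DW by (intro dim_Int_hyperplane[of "D i" "E i"]) auto
  moreover have eq: "D i \<inter> W \<inter> E i = W \<inter> E i" using E(2)[OF assms(1)] by auto
  moreover have WE: "W \<inter> E i \<in> Sub" using W E assms by (intro Sub_Int)
  ultimately have "card (D i \<inter> W - W \<inter> E i) = 2 ^ dim (W \<inter> E i)"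
    using card_Diff_hyperplane[OF DW WE] assms(2) E(2)[OF assms(1)] by auto
  moreover have "card (D i - E i) = 2 ^ dim (E i)"
    using card_Diff_hyperplane[OF D(1) E(1) E(2) E(3)] assms by simp
  moreover have "chart i - W = (D i - E i) - (D i \<inter> W - W \<inter> E i)" by (auto simp: chart_def)
  moreover have "D i \<inter> W - W \<inter> E i \<subseteq> D i - E i" by auto
  ultimately show ?thesis using SubD(3)[OF DW] by (simp add: card_Diff_subset)
qed

text \<open>Double counting of the triples (S, a, b): F determines S and leaves 2^b choices for each
  of the two chart points.\<close>

lemma card_pair:
  assumes ij: "i \<in> I" "j \<in> I" "i \<noteq> j" and card: "CARD('a) = 2"
  shows "card {F. pair i j F \<and> dim F = b + 2} * 2 ^ (2 * b)
    = card {S \<in> Sub. S \<subseteq> W \<inter> E i \<inter> E j \<and> dim S = b} * card (chart i - W) * card (chart j - W)"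
proof -
  let ?T = "{S \<in> Sub. S \<subseteq> W \<inter> E i \<inter> E j \<and> dim S = b} \<times> (chart i - W) \<times> (chart j - W)"
  let ?f = "\<lambda>(S, a, b). span (insert a (insert b S))"
  let ?R = "{F. pair i j F \<and> dim F = b + 2}"
  have chartY: "chart k \<subseteq> Y" if "k \<in> I" for k using that D(1) SubD(2) by (auto simp: chart_def)
  have finT: "finite ?T"
    using finite_Sub finite_subset[OF chartY finite_Y] ij by auto
  have img: "?f ` ?T = ?R"
  proof
    show "?f ` ?T \<subseteq> ?R"
    proof
      fix F assume "F \<in> ?f ` ?T"
      then obtain S a c where s: "S \<in> Sub" "S \<subseteq> W \<inter> E i \<inter> E j" "dim S = b" "a \<in> chart i - W"
        "c \<in> chart j - W" "F = span (insert a (insert c S))" by auto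
      then have "pair i j F" unfolding pair_def using card by blast
      moreover have "dim F = b + 2"
        using pair_dim[OF card ij s(1,2) _ _ _ _ s(6)] s by auto
      ultimately show "F \<in> ?R" by simp
    qed
    show "?R \<subseteq> ?f ` ?T"
    proof
      fix F assume F: "F \<in> ?R"
      then have "pair i j F" by simp
      then obtain S a c where s: "CARD('a) = 2" "S \<in> Sub" "S \<subseteq> W \<inter> E i \<inter> E j"
        "a \<in> chart i" "a \<notin> W" "c \<in> chart j" "c \<notin> W" "F = span (insert a (insert c S))"
        by (rule pairE)
      then have "dim S = b" using F pair_dim[OF s(1) ij s(2-8)] by simp
      then show "F \<in> ?f ` ?T" using s by (intro image_eqI[of _ _ "(S, a, c)"]) auto
    qed
  qed
  have fibre: "card {x \<in> ?T. ?f x = F} = 2 ^ (2 * b)" if F: "F \<in> ?R" for F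
  proof -
    have "pair i j F" using F by simp
    then obtain S a c where s: "CARD('a) = 2" "S \<in> Sub" "S \<subseteq> W \<inter> E i \<inter> E j"
      "a \<in> chart i" "a \<notin> W" "c \<in> chart j" "c \<notin> W" "F = span (insert a (insert c S))"
      by (rule pairE)
    note facts = s(1) ij s(2-8)
    have Sb: "dim S = b" using F pair_dim[OF facts] by simp
    have S': "S \<subseteq> W \<inter> E j \<inter> E i" "F = span (insert c (insert a S))"
      using s by (auto simp: insert_commute)
    have sets: "F \<inter> W = S" "F \<inter> (chart i - W) = (\<lambda>s. s + a) ` S" "F \<inter> (chart j - W) = (\<lambda>s. s + c) ` S"
      using pair_Int_W[OF facts] pair_Int_chart[OF facts]
        pair_Int_chart[OF s(1) ij(2,1) ij(3)[symmetric] s(2) S'(1) s(6,7,4,5) S'(2)] by auto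
    have "{x \<in> ?T. ?f x = F} = {S} \<times> (F \<inter> (chart i - W)) \<times> (F \<inter> (chart j - W))"
    proof
      show "{x \<in> ?T. ?f x = F} \<subseteq> {S} \<times> (F \<inter> (chart i - W)) \<times> (F \<inter> (chart j - W))"
      proof
        fix x assume "x \<in> {x \<in> ?T. ?f x = F}"
        then obtain S' a' c' where x: "x = (S', a', c')" "S' \<in> Sub" "S' \<subseteq> W \<inter> E i \<inter> E j"
          "a' \<in> chart i" "a' \<notin> W" "c' \<in> chart j" "c' \<notin> W" "F = span (insert a' (insert c' S'))" by auto
        have "F \<inter> W = S'" using pair_Int_W[OF card ij x(2-8)] .
        moreover have "a' \<in> F" "c' \<in> F" unfolding x(8) by (auto intro: span_base)
        ultimately show "x \<in> {S} \<times> (F \<inter> (chart i - W)) \<times> (F \<inter> (chart j - W))"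
          using x sets(1) by auto
      qed
      show "{S} \<times> (F \<inter> (chart i - W)) \<times> (F \<inter> (chart j - W)) \<subseteq> {x \<in> ?T. ?f x = F}"
      proof
        fix x assume "x \<in> {S} \<times> (F \<inter> (chart i - W)) \<times> (F \<inter> (chart j - W))"
        then obtain a' c' where x: "x = (S, a', c')" "a' \<in> F" "a' \<in> chart i" "a' \<notin> W"
          "c' \<in> F" "c' \<in> chart j" "c' \<notin> W" by auto
        let ?F' = "span (insert a' (insert c' S))"
        have "?F' \<subseteq> F" using x pair_base[OF facts] pair_Sub[OF facts] by (intro span_le_Sub) auto
        moreover have "dim ?F' = dim F"
          using pair_dim[OF card ij s(2,3) x(3,4,6,7) refl] pair_dim[OF facts] by simp
        moreover have "?F' \<in> Sub" using pair_Sub[OF card ij s(2,3) x(3,4,6,7) refl] .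
        ultimately have "?F' = F" using dim_eq[OF _ pair_Sub[OF facts]] by simp
        then show "x \<in> {x \<in> ?T. ?f x = F}" using x s Sb by simp
      qed
    qed
    moreover have "card ((\<lambda>s. s + d) ` S) = 2 ^ b" for d
      using card_Sub[OF s(2)] Sb card by (simp add: card_image)
    ultimately show ?thesis
      unfolding sets by (simp add: card_cartesian_product mult_2 power_add)
  qed
  have "card ?T = (\<Sum>F\<in>?R. card {x \<in> ?T. ?f x = F})"
  proof -
    have "finite ?R" unfolding img[symmetric] by (rule finite_imageI[OF finT])
    then have "(\<Sum>F\<in>?R. \<Sum>x\<in>{x \<in> ?T. ?f x = F}. 1) = (\<Sum>x\<in>?T. 1 :: nat)"
      by (rule sum.group[OF finT _ equalityD1[OF img]])
    then show ?thesis by (simp only: card_eq_sum)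
  qed
  also have "\<dots> = card ?R * 2 ^ (2 * b)" using fibre by simp
  finally show ?thesis by (simp add: card_cartesian_product mult.assoc)
qed

lemma card_pair_power:
  assumes ij: "i \<in> I" "j \<in> I" "i \<noteq> j" and card: "CARD('a) = 2"
    and D_W: "\<not> D i \<inter> W \<subseteq> E i" "\<not> D j \<inter> W \<subseteq> E j"
    and dims: "dim (W \<inter> E i) = l\<^sub>i" "dim (E i) = l\<^sub>i + m\<^sub>i" "dim (W \<inter> E j) = l\<^sub>j" "dim (E j) = l\<^sub>j + m\<^sub>j"
    and b: "b \<le> dim (W \<inter> E i \<inter> E j)"
  shows "int (card {F. pair i j F \<and> dim F = b + 2})
    = (2 ^ m\<^sub>i - 1) * (2 ^ m\<^sub>j - 1) *
      (int (gauss_binomial 2 (dim (W \<inter> E i \<inter> E j)) b) * 2 ^ (l\<^sub>i + l\<^sub>j - 2 * b))"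
proof -
  let ?C = "W \<inter> E i \<inter> E j" and ?N = "card {F. pair i j F \<and> dim F = b + 2}"
  have C: "?C \<in> Sub" using W E ij by (intro Sub_Int) auto
  have WE: "W \<inter> E i \<in> Sub" "W \<inter> E j \<in> Sub" using W E ij by (auto intro: Sub_Int)
  have "dim ?C \<le> l\<^sub>i" "dim ?C \<le> l\<^sub>j"
    unfolding dims[symmetric] using C WE by (auto intro!: dim_mono)
  then have bl: "b \<le> l\<^sub>i" "b \<le> l\<^sub>j" using b by auto
  have "{S \<in> Sub. S \<subseteq> ?C \<and> dim S = b} = {Z \<in> interval {0} ?C. dim Z = dim {0} + b}"
    using Sub_zero by (auto simp: interval_def dim_zero)
  moreover have "{0} \<subseteq> ?C" using Sub_zero[OF C] by simp
  ultimately have g: "card {S \<in> Sub. S \<subseteq> ?C \<and> dim S = b} = gauss 2 (dim ?C) b"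
    using card_interval[OF zero_in_Sub C] card dim_zero by simp
  have chart: "card (chart i - W) = 2 ^ l\<^sub>i * (2 ^ m\<^sub>i - 1)" "card (chart j - W) = 2 ^ l\<^sub>j * (2 ^ m\<^sub>j - 1)"
    using card_chart_minus_W[OF ij(1) card D_W(1)] card_chart_minus_W[OF ij(2) card D_W(2)]
    unfolding dims by (simp_all add: power_add diff_mult_distrib2)
  have "?N * 2 ^ (2 * b) = gauss 2 (dim ?C) b * (2 ^ l\<^sub>i * (2 ^ m\<^sub>i - 1)) * (2 ^ l\<^sub>j * (2 ^ m\<^sub>j - 1))"
    using card_pair[OF ij card, of b] unfolding g chart .
  also have "\<dots> = (2 ^ m\<^sub>i - 1) * (2 ^ m\<^sub>j - 1) * gauss 2 (dim ?C) b * 2 ^ (l\<^sub>i + l\<^sub>j)"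
    by (simp add: power_add mult_ac)
  also have "(2::nat) ^ (l\<^sub>i + l\<^sub>j) = 2 ^ (l\<^sub>i + l\<^sub>j - 2 * b) * 2 ^ (2 * b)"
    using bl by (simp flip: power_add)
  finally have "?N = (2 ^ m\<^sub>i - 1) * (2 ^ m\<^sub>j - 1) * gauss 2 (dim ?C) b * 2 ^ (l\<^sub>i + l\<^sub>j - 2 * b)"
    by simp
  then show ?thesis by (simp add: gauss_binomial_eq_gauss of_nat_diff mult.assoc)
qed

text \<open>Subspaces are grouped by b = dim F - 2. Evenness of b makes the sign trivial, and the
  remaining Moebius weight is \<open>u_coeff (dim Y - b - 2)\<close>.\<close>

lemma sum_pair_term:
  assumes ij: "i \<in> I" "j \<in> I" "i \<noteq> j" and card: "CARD('a) = 2"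
    and D_W: "\<not> D i \<inter> W \<subseteq> E i" "\<not> D j \<inter> W \<subseteq> E j"
    and dims: "dim (W \<inter> E i) = l\<^sub>i" "dim (E i) = l\<^sub>i + m\<^sub>i" "dim (W \<inter> E j) = l\<^sub>j" "dim (E j) = l\<^sub>j + m\<^sub>j"
  shows "(\<Sum>F\<in>Sub. smult ((- 1) ^ dim F * int (CARD('a)) ^ ((dim Y - dim F) choose 2))
      (pair_term t (i, j) F))
    = smult ((2 ^ m\<^sub>i - 1) * (2 ^ m\<^sub>j - 1))
        (\<Sum>b | b \<le> dim (W \<inter> E i \<inter> E j) \<and> even b.
          monom (int (gauss_binomial 2 (dim (W \<inter> E i \<inter> E j)) b) * 2 ^ (l\<^sub>i + l\<^sub>j - 2 * b) *
            t b * u_coeff (dim Y - b - 2)) ((b + 2) div 2))"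
proof -
  let ?C = "W \<inter> E i \<inter> E j"
  let ?B = "{b. b \<le> dim ?C \<and> even b}"
  let ?A = "{F \<in> Sub. pair i j F \<and> even (dim F)}"
  let ?g = "\<lambda>b. monom (u_coeff (dim Y - b - 2) * t b) ((b + 2) div 2)"
  have C: "?C \<in> Sub" using W E ij by (intro Sub_Int) auto
  have dimF: "F \<in> Sub \<and> (\<exists>b. b \<le> dim ?C \<and> dim F = b + 2)" if "pair i j F" for F
  proof -
    obtain S a c where s: "CARD('a) = 2" "S \<in> Sub" "S \<subseteq> ?C"
      "a \<in> chart i" "a \<notin> W" "c \<in> chart j" "c \<notin> W" "F = span (insert a (insert c S))"
      using \<open>pair i j F\<close> by (rule pairE)
    show ?thesis
      using pair_Sub[OF s(1) ij s(2-8)] pair_dim[OF s(1) ij s(2-8)] dim_mono[OF s(2) C s(3)] by auto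
  qed
  have "(\<Sum>F\<in>Sub. smult ((- 1) ^ dim F * int (CARD('a)) ^ ((dim Y - dim F) choose 2)) (pair_term t (i, j) F))
      = (\<Sum>F\<in>Sub. if pair i j F \<and> even (dim F) then ?g (dim F - 2) else 0)"
  proof (intro sum.cong refl)
    fix F assume "F \<in> Sub"
    show "smult ((- 1) ^ dim F * int (CARD('a)) ^ ((dim Y - dim F) choose 2)) (pair_term t (i, j) F)
        = (if pair i j F \<and> even (dim F) then ?g (dim F - 2) else 0)"
    proof (cases "pair i j F \<and> even (dim F)")
      case True
      then obtain b where "dim F = b + 2" using dimF by blast
      then show ?thesis using True
        by (simp add: pair_term_def u_coeff_def card smult_monom)
    next
      case False
      then have "pair_term t (i, j) F = 0" by (auto simp: pair_term_def)
      then show ?thesis using False by (simp only: if_False smult_0_right)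
    qed
  qed
  also have "\<dots> = (\<Sum>F\<in>?A. ?g (dim F - 2))"
    by (rule sum.inter_filter[OF finite_Sub, symmetric])
  also have "\<dots> = (\<Sum>b\<in>?B. \<Sum>F\<in>{F \<in> ?A. dim F - 2 = b}. ?g (dim F - 2))"
  proof (intro sum.group[symmetric])
    show "(\<lambda>F. dim F - 2) ` ?A \<subseteq> ?B" using dimF by fastforce
  qed (use finite_Sub in auto)
  also have "\<dots> = (\<Sum>b\<in>?B. smult ((2 ^ m\<^sub>i - 1) * (2 ^ m\<^sub>j - 1))
      (monom (int (gauss_binomial 2 (dim ?C) b) * 2 ^ (l\<^sub>i + l\<^sub>j - 2 * b) *
            t b * u_coeff (dim Y - b - 2)) ((b + 2) div 2)))"
  proof (intro sum.cong refl)
    fix b assume b: "b \<in> ?B"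
    have "{F \<in> ?A. dim F - 2 = b} = {F. pair i j F \<and> dim F = b + 2}"
      using dimF b by fastforce
    moreover have "of_nat n * monom c k = monom (int n * c) k" for n c k
      by (simp add: of_nat_poly smult_monom)
    ultimately have "(\<Sum>F\<in>{F \<in> ?A. dim F - 2 = b}. ?g (dim F - 2))
        = monom (int (card {F. pair i j F \<and> dim F = b + 2}) * (u_coeff (dim Y - b - 2) * t b)) ((b + 2) div 2)"
      by simp
    also have "int (card {F. pair i j F \<and> dim F = b + 2}) = (2 ^ m\<^sub>i - 1) * (2 ^ m\<^sub>j - 1) *
        (int (gauss_binomial 2 (dim ?C) b) * 2 ^ (l\<^sub>i + l\<^sub>j - 2 * b))"
      using b by (intro card_pair_power[OF assms]) simp
    finally show "(\<Sum>F\<in>{F \<in> ?A. dim F - 2 = b}. ?g (dim F - 2))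
      = smult ((2 ^ m\<^sub>i - 1) * (2 ^ m\<^sub>j - 1))
      (monom (int (gauss_binomial 2 (dim ?C) b) * 2 ^ (l\<^sub>i + l\<^sub>j - 2 * b) *
            t b * u_coeff (dim Y - b - 2)) ((b + 2) div 2))"
      by (simp add: smult_monom mult_ac)
  qed
  finally show ?thesis by (simp only: smult_sum_right)
qed

end

section \<open>Complements of charts in projective space\<close>

context finite_space
begin

lemma span_singleton_eq_iff:
  assumes "x \<noteq> 0" shows "span {x} = span {y} \<longleftrightarrow> (\<exists>k. k \<noteq> 0 \<and> x = scale k y)"
proof
  assume "span {x} = span {y}"
  then have "x \<in> span {y}" using span_base[of x "{x}"] by auto
  then show "\<exists>k. k \<noteq> 0 \<and> x = scale k y" using assms by (auto simp: span_singleton)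
next
  assume "\<exists>k. k \<noteq> 0 \<and> x = scale k y"
  then obtain k where k: "k \<noteq> 0" "x = scale k y" by blast
  then have "y = scale (1 / k) x" by simp
  then show "span {x} = span {y}"
    unfolding span_eq using span_scale[OF span_base[of y "{y}"], of k] span_scale[OF span_base[of x "{x}"], of "1 / k"] k
    by simp
qed

definition rep :: "'b set \<Rightarrow> 'b" where
  "rep p = (SOME x. x \<noteq> 0 \<and> p = span {x})"

lemma rep:
  assumes "p \<in> proj_points scale UNIV" shows "rep p \<noteq> 0" "p = span {rep p}"
proof -
  have "\<exists>x. x \<noteq> 0 \<and> p = span {x}" using assms by (auto simp: proj_points_def)
  then have "rep p \<noteq> 0 \<and> p = span {rep p}" unfolding rep_def by (rule someI_ex)
  then show "rep p \<noteq> 0" "p = span {rep p}" by blast+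
qed

lemma proj_span_rep:
  assumes "S \<subseteq> proj_points scale UNIV" shows "proj_span scale S = span (rep ` S)"
proof -
  have "p \<subseteq> span (rep ` S)" if "p \<in> S" for p
  proof -
    have "span {rep p} \<subseteq> span (rep ` S)" using that by (intro span_mono) auto
    then show ?thesis using rep(2)[of p] assms that by auto
  qed
  moreover have "rep p \<in> p" if "p \<in> S" for p
    using rep(2)[of p] assms that span_base[of "rep p" "{rep p}"] by auto
  then have "rep ` S \<subseteq> \<Union>S" by auto
  ultimately show ?thesis
    unfolding proj_span_def span_eq using span_superset[of "\<Union>S"] by blast
qed

lemma span_in_proj_points_iff:
  assumes "subspace W" "x \<noteq> 0" shows "span {x} \<in> proj_points scale W \<longleftrightarrow> x \<in> W"
proof
  assume "span {x} \<in> proj_points scale W"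
  then obtain y where "y \<in> W" "span {x} = span {y}" by (auto simp: proj_points_def)
  then show "x \<in> W" using span_singleton_eq_iff[OF assms(2)] subspace_scale[OF assms(1)] by auto
qed (use assms in \<open>auto simp: proj_points_def\<close>)

end

lemma (in charts) inv_KL_poly_complement_charts:
  fixes C :: "nat \<Rightarrow> 'b set set"
  defines "B \<equiv> proj_points scale UNIV - proj_points scale W"
  defines "q \<equiv> \<lambda>J. inv_KL_poly (proj_matroid scale (B - (\<Union>i\<in>J. C i)))"
  assumes Y: "Y = UNIV" and C: "\<And>i x. i \<in> I \<Longrightarrow> x \<noteq> 0 \<Longrightarrow> span {x} \<in> C i \<longleftrightarrow> x \<in> chart i"
    and spans: "proj_span scale (B - (\<Union>i\<in>I. C i)) = UNIV" and J: "J \<subseteq> I"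
  shows "q J = q {} + (\<Sum>k\<in>J. q {k} - q {}) - (\<Sum>p\<in>pairs J. \<Sum>F\<in>Sub.
      smult ((- 1) ^ dim F * int (CARD('a)) ^ ((dim (UNIV :: 'b set) - dim F) choose 2))
        (pair_term (\<lambda>b. tau (binary_affine_geometry b)) p F))"
proof -
  define pp where "pp = proj_points scale UNIV"
  define N where "N J = B - (\<Union>i\<in>J. C i)" for J
  define M where "M J = proj_matroid scale (N J)" for J
  have K_iff: "x \<in> K J \<longleftrightarrow> x \<notin> W \<and> (\<forall>i\<in>J. x \<notin> chart i)" for x J
    unfolding K_def using Y by blast
  have subW: "subspace W" using W by (rule SubD)
  have Npp: "N J \<subseteq> pp" for J by (auto simp: N_def B_def pp_def)
  have mem: "p \<in> N J \<longleftrightarrow> rep p \<in> K J" if p: "p \<in> pp" and J: "J \<subseteq> I" for p J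
  proof -
    have r: "rep p \<noteq> 0" "p = span {rep p}" using rep p by (auto simp: pp_def)
    have "p \<in> C i \<longleftrightarrow> rep p \<in> chart i" if "i \<in> J" for i
      using C[of i "rep p"] r that J by auto
    moreover have "p \<in> proj_points scale W \<longleftrightarrow> rep p \<in> W"
      using span_in_proj_points_iff[OF subW r(1)] r(2) by simp
    ultimately show ?thesis using p by (auto simp: N_def B_def K_iff pp_def)
  qed
  have span_mem: "span {x} \<in> pp" if "x \<noteq> 0" for x using that by (auto simp: pp_def proj_points_def)
  have rep_span: "\<exists>k. k \<noteq> 0 \<and> x = scale k (rep (span {x}))" if "x \<noteq> 0" for x
    using span_singleton_eq_iff[OF that] rep(2) span_mem[OF that] unfolding pp_def by blast
  have K0: "x \<noteq> 0" if "x \<in> K J" for x J using that Sub_zero[OF W] by (auto simp: K_iff)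
  have K_scale: "x \<in> K J" if "scale k x \<in> K J" "k \<noteq> 0" "J \<subseteq> I" for x k J
  proof -
    have "scale k x \<in> chart i \<longleftrightarrow> x \<in> chart i" if "i \<in> J" for i
      using Sub_scale_cancel[OF D(1) \<open>k \<noteq> 0\<close>] Sub_scale_cancel[OF E(1) \<open>k \<noteq> 0\<close>] that \<open>J \<subseteq> I\<close>
      by (auto simp: chart_def)
    then show ?thesis using that Sub_scale_cancel[OF W \<open>k \<noteq> 0\<close>] by (auto simp: K_iff)
  qed
  have rep_NK: "represents (M J) rep (K J)" if J: "J \<subseteq> I" for J
    unfolding represents_def
  proof (intro conjI ballI allI impI)
    have "ground (M J) \<subseteq> Pow Y" using Y by blast
    then show "finite (ground (M J))" using finite_Y by (simp add: finite_subset)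
    show "rep ` ground (M J) \<subseteq> K J"
      using mem[OF _ J] Npp by (auto simp: M_def proj_matroid_def)
    show "K J \<subseteq> Y" using Y by blast
    show "0 \<notin> K J" using K0 by auto
  next
    fix x assume x: "x \<in> K J"
    then obtain k where k: "k \<noteq> 0" "x = scale k (rep (span {x}))" using rep_span K0 by blast
    then have "rep (span {x}) \<in> K J" using x K_scale J by metis
    then have "span {x} \<in> N J" using mem[OF span_mem J] K0[OF x] by blast
    moreover have "x \<in> span {rep (span {x})}" using k by (metis span_base span_scale singletonI)
    ultimately show "\<exists>e\<in>ground (M J). x \<in> span {rep e}" by (auto simp: M_def proj_matroid_def)
  next
    fix S assume "S \<subseteq> ground (M J)"
    then have "S \<subseteq> proj_points scale UNIV" using Npp by (auto simp: M_def proj_matroid_def pp_def)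
    then show "rk (M J) S = dim (rep ` S)" by (simp add: M_def proj_matroid_def proj_span_rep)
  qed
  let ?P = "\<lambda>J U V. KL_poly (minor (M J) rep U V)" and ?Q = "\<lambda>J U V. inv_KL_poly (minor (M J) rep U V)"
  \<comment> \<open>Built from H and W alone, so that it serves for every J.\<close>
  define \<kappa> where "\<kappa> H = KL_poly (Matroid {p \<in> pp. rep p \<in> H - W} (\<lambda>S. dim (proj_span scale S)))" for H
  have KL: "KL_family (lat (K J)) (?P J)" if "J \<subseteq> I" for J
    using KL_family_represents[OF rep_NK[OF that]] .
  have inv: "inv_KL_family (lat (K J)) (?P J) (?Q J)" if "J \<subseteq> I" for J
    using inv_KL_family_represents[OF rep_NK[OF that]] .
  have \<kappa>: "?P J {0} H = \<kappa> H" if J: "J \<subseteq> I" and "K J \<inter> H = H - W" for J H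
  proof -
    have "pts (M J) rep H = {p \<in> pp. rep p \<in> K J \<inter> H}"
      using mem[OF _ J] Npp by (auto simp: pts_def M_def proj_matroid_def)
    then show ?thesis
      unfolding minor_zero[OF rep_NK[OF J]] that(2)
      by (simp add: \<kappa>_def restrict_to_def M_def proj_matroid_def)
  qed
  have t: "coeff (\<kappa> H) (dim (H \<inter> W) div 2) = tau (binary_affine_geometry (dim (H \<inter> W)))"
    if H: "H \<in> Sub" "CARD('a) = 2" "dim H = Suc (dim (H \<inter> W))" "even (dim (H \<inter> W))" for H
  proof -
    \<comment> \<open>Since \<open>\<kappa>\<close> is the same for every J, it is evaluated for the
      empty set of charts, where the points of H are exactly the complement of the hyperplane H
      \<inter> W.\<close>
    have A: "K {} \<inter> H = H - H \<inter> W" by (auto simp: K_iff)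
    then have "\<kappa> H = ?P {} {0} H" by (intro \<kappa>[symmetric]) auto
    also have "\<dots> = KL_poly (binary_affine_geometry (dim (H \<inter> W)))"
      using H A W by (intro KL_affine_eq_binary[OF KL]) (auto intro: Sub_Int)
    finally show ?thesis
      using H(4) by (simp add: tau_def binary_affine_geometry_KL(1))
  qed
  have "spanned (K I) Y = Y"
  proof -
    have "UNIV = span (rep ` N I)"
      using spans proj_span_rep[of "N I"] Npp[of I] by (simp add: N_def pp_def)
    also have "\<dots> \<subseteq> span (K I)" using mem[of _ I] Npp by (intro span_mono) auto
    finally show ?thesis using Y by (simp add: spanned_def top.extremum_unique)
  qed
  note main = inv_KL_charts[where P = ?P and Q = ?Q, OF KL inv \<kappa> t this J]
  have Q: "?Q J {0} Y = q J" if "J \<subseteq> I" for J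
    using minor_zero_top[OF rep_NK[OF that]] by (simp add: q_def M_def N_def)
  have "(\<Sum>k\<in>J. ?Q {k} {0} Y - ?Q {} {0} Y) = (\<Sum>k\<in>J. q {k} - q {})"
    using J by (intro sum.cong refl) (simp only: Q empty_subsetI subset_iff insert_iff empty_iff simp_thms)
  moreover have "dim (UNIV :: 'b set) = dim Y" by (simp only: Y)
  ultimately show ?thesis
    using main by (simp only: Q[OF J] Q[OF empty_subsetI])
qed

section \<open>Alternating sums that detect interactions of charts\<close>

lemma sum_alternating_supersets:
  assumes S: "finite S" and A: "A \<subset> S"
  shows "(\<Sum>S'\<in>{S' \<in> Pow S. A \<subseteq> S'}. (- 1 :: 'c::comm_ring_1) ^ (card S - card S')) = 0"
proof -
  obtain x where x: "x \<in> S" "x \<notin> A" using A by blast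
  let ?Z = "{S' \<in> Pow (S - {x}). A \<subseteq> S'}"
  have finZ: "finite ?Z" using S by simp
  have split: "{S' \<in> Pow S. A \<subseteq> S'} = ?Z \<union> insert x ` ?Z" (is "?L = ?R")
  proof (intro set_eqI iffI)
    fix S' assume S': "S' \<in> ?L"
    show "S' \<in> ?R"
    proof (cases "x \<in> S'")
      case True
      then have "S' - {x} \<in> ?Z" "S' = insert x (S' - {x})" using S' x by auto
      then show ?thesis by blast
    qed (use S' in auto)
  qed (use x in auto)
  have inj: "inj_on (insert x) ?Z"
  proof (rule inj_onI)
    fix S1 S2 assume "S1 \<in> ?Z" "S2 \<in> ?Z" "insert x S1 = insert x S2"
    then show "S1 = S2" by (metis Diff_insert_absorb DiffD2 Pow_iff insertI1 mem_Collect_eq subsetD)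
  qed
  have "(- 1 :: 'c) ^ (card S - card (insert x S')) = - ((- 1) ^ (card S - card S'))" if "S' \<in> ?Z" for S'
  proof -
    have fin: "finite S'" and "x \<notin> S'" and sub: "insert x S' \<subseteq> S"
      using that S x finite_subset by auto
    then have "card S - card S' = Suc (card S - card (insert x S'))"
      using card_mono[OF S sub] by simp
    then show ?thesis by simp
  qed
  then have "(\<Sum>S'\<in>insert x ` ?Z. (- 1 :: 'c) ^ (card S - card S'))
      = - (\<Sum>S'\<in>?Z. (- 1) ^ (card S - card S'))"
    unfolding sum.reindex[OF inj] sum_negf[symmetric] by (intro sum.cong) simp_all
  moreover have "?Z \<inter> insert x ` ?Z = {}" by auto
  ultimately show ?thesis
    unfolding split using finZ by (simp add: sum.union_disjoint)
qed

text \<open>Each summand of f is supported on the supersets of a set with at most two elements. As S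
  has at least three, that set is proper, and the alternating sum over its supersets cancels in
  pairs.\<close>

lemma alternating_sum_quadratic:
  fixes f :: "nat set \<Rightarrow> 'c::comm_ring_1"
  assumes S: "finite S" "3 \<le> card S"
    and f: "\<And>S'. S' \<subseteq> S \<Longrightarrow> f S' = a + (\<Sum>k\<in>S'. g k) - (\<Sum>(i, j)\<in>{(i, j). i \<in> S' \<and> j \<in> S' \<and> i < j}. x i j)"
  shows "(\<Sum>S'\<in>Pow S. (- 1) ^ (card S - card S') * f S') = 0"
proof -
  let ?s = "\<lambda>S'. (- 1 :: 'c) ^ (card S - card S')"
  let ?P = "{(i, j). i \<in> S \<and> j \<in> S \<and> i < j}"
  have finP: "finite ?P" by (rule finite_subset[of _ "S \<times> S"]) (use S in auto)
  have vanish: "(\<Sum>S'\<in>{S' \<in> Pow S. A \<subseteq> S'}. ?s S') = 0" if "A \<subseteq> S" "finite A" "card A \<le> 2" for A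
    using that S by (intro sum_alternating_supersets) auto
  have "(\<Sum>S'\<in>Pow S. ?s S' * f S') = (\<Sum>S'\<in>Pow S. ?s S') * a
      + (\<Sum>S'\<in>Pow S. \<Sum>k\<in>{k. k \<in> S \<and> {k} \<subseteq> S'}. ?s S' * g k)
      - (\<Sum>S'\<in>Pow S. \<Sum>p\<in>{p. p \<in> ?P \<and> {fst p, snd p} \<subseteq> S'}. ?s S' * x (fst p) (snd p))"
  proof -
    have "?s S' * f S' = ?s S' * a + (\<Sum>k\<in>{k. k \<in> S \<and> {k} \<subseteq> S'}. ?s S' * g k)
        - (\<Sum>p\<in>{p. p \<in> ?P \<and> {fst p, snd p} \<subseteq> S'}. ?s S' * x (fst p) (snd p))"
      if S': "S' \<in> Pow S" for S'
    proof -
      have sets: "{k. k \<in> S \<and> {k} \<subseteq> S'} = S'"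
        "{p. p \<in> ?P \<and> {fst p, snd p} \<subseteq> S'} = {(i, j). i \<in> S' \<and> j \<in> S' \<and> i < j}"
        using S' by auto
      have "(\<Sum>(i, j)\<in>{(i, j). i \<in> S' \<and> j \<in> S' \<and> i < j}. x i j)
          = (\<Sum>p\<in>{(i, j). i \<in> S' \<and> j \<in> S' \<and> i < j}. x (fst p) (snd p))"
        by (simp add: case_prod_beta)
      then have "f S' = a + (\<Sum>k\<in>S'. g k) - (\<Sum>p\<in>{(i, j). i \<in> S' \<and> j \<in> S' \<and> i < j}. x (fst p) (snd p))"
        using f[of S'] S' by simp
      then show ?thesis
        unfolding sets by (simp only: sum_distrib_left right_diff_distrib distrib_left)
    qed
    then show ?thesis by (simp add: sum.distrib sum_subtractf sum_distrib_right)
  qed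
  also have "(\<Sum>S'\<in>Pow S. \<Sum>k\<in>{k. k \<in> S \<and> {k} \<subseteq> S'}. ?s S' * g k)
      = (\<Sum>k\<in>S. \<Sum>S'\<in>{S' \<in> Pow S. {k} \<subseteq> S'}. ?s S' * g k)"
    using S by (intro sum.swap_restrict) auto
  also have "\<dots> = 0"
    using vanish[of "{k}" for k] by (intro sum.neutral) (simp add: sum_distrib_right[symmetric])
  also have "(\<Sum>S'\<in>Pow S. \<Sum>p\<in>{p. p \<in> ?P \<and> {fst p, snd p} \<subseteq> S'}. ?s S' * x (fst p) (snd p))
      = (\<Sum>p\<in>?P. \<Sum>S'\<in>{S' \<in> Pow S. {fst p, snd p} \<subseteq> S'}. ?s S' * x (fst p) (snd p))"
    using S finP by (intro sum.swap_restrict) auto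
  also have "\<dots> = 0"
  proof (rule sum.neutral, rule ballI)
    fix p assume p: "p \<in> ?P"
    have "card {fst p, snd p} \<le> 2" using card_insert_le_m1[of 2 "{snd p}" "fst p"] by simp
    then have "(\<Sum>S'\<in>{S' \<in> Pow S. {fst p, snd p} \<subseteq> S'}. ?s S') = 0"
      using p by (intro vanish) auto
    then show "(\<Sum>S'\<in>{S' \<in> Pow S. {fst p, snd p} \<subseteq> S'}. ?s S' * x (fst p) (snd p)) = 0"
      by (simp only: sum_distrib_right[symmetric] mult_zero_left)
  qed
  also have "(\<Sum>S'\<in>Pow S. ?s S') = 0" using vanish[of "{}"] by (simp add: Pow_def)
  finally show ?thesis by simp
qed

lemma (in finite_space) finite_span: "finite B \<Longrightarrow> finite (span B)"
proof (induction B rule: finite_induct)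
  case (insert x B)
  show ?case
  proof (cases "x \<in> span B")
    case True
    then show ?thesis using insert by (simp add: span_redundant)
  next
    case False
    then show ?thesis
      using card_span_insert(1)[OF subspace_span insert.IH] by (simp add: span_insert_span)
  qed
qed simp

text \<open>Supplies the coordinate projection onto \<open>U i\<close>, by which the charts are told
  apart.\<close>

lemma (in vector_space) direct_sum_component:
  assumes I: "finite I" "i \<in> I" and U: "direct_sum scale I U"
  obtains p where "\<And>x y. p (x + y) = p x + p y" "\<And>x. x \<in> U i \<Longrightarrow> p x = x"
    "\<And>j x. j \<in> I \<Longrightarrow> j \<noteq> i \<Longrightarrow> x \<in> U j \<Longrightarrow> p x = 0"
proof -
  have sub: "subspace (U j)" if "j \<in> I" for j using U that by (simp add: direct_sum_def)
  define dec where "dec v = (THE u. u \<in> (\<Pi>\<^sub>E j\<in>I. U j) \<and> v = (\<Sum>j\<in>I. u j))" for v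
  have ex: "\<exists>!u. u \<in> (\<Pi>\<^sub>E j\<in>I. U j) \<and> v = (\<Sum>j\<in>I. u j)" for v
    using U by (simp add: direct_sum_def)
  have dec: "dec v \<in> (\<Pi>\<^sub>E j\<in>I. U j)" "v = (\<Sum>j\<in>I. dec v j)" for v
    using theI'[OF ex[of v]] by (simp_all add: dec_def)
  have unique: "dec v = u" if "u \<in> (\<Pi>\<^sub>E j\<in>I. U j)" "v = (\<Sum>j\<in>I. u j)" for u v
    using ex[of v] dec[of v] that by blast
  have single: "dec x i = (if j = i then x else 0)" if j: "j \<in> I" "x \<in> U j" for j x
  proof -
    have "dec x = (\<lambda>k\<in>I. if k = j then x else 0)"
    proof (rule unique)
      show "(\<lambda>k\<in>I. if k = j then x else 0) \<in> (\<Pi>\<^sub>E j\<in>I. U j)"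
        using j sub by (auto simp: subspace_0)
      show "x = (\<Sum>k\<in>I. (\<lambda>k\<in>I. if k = j then x else 0) k)" using I j by (simp add: sum.delta)
    qed
    then show ?thesis using I j by auto
  qed
  have "dec (x + y) = (\<lambda>j\<in>I. dec x j + dec y j)" for x y
  proof (rule unique)
    show "(\<lambda>j\<in>I. dec x j + dec y j) \<in> (\<Pi>\<^sub>E j\<in>I. U j)"
      using dec(1)[of x] dec(1)[of y] sub by (auto intro!: subspace_add)
    have "x + y = (\<Sum>j\<in>I. dec x j) + (\<Sum>j\<in>I. dec y j)" using dec(2) by metis
    then show "x + y = (\<Sum>j\<in>I. (\<lambda>j\<in>I. dec x j + dec y j) j)"
      by (simp add: sum.distrib)
  qed
  then have "dec (x + y) i = dec x i + dec y i" for x y using I by simp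
  then show ?thesis using that[of "\<lambda>v. dec v i"] single[of i] single I(2) by simp
qed

lemma finite_finite_dimensional:
  fixes scale :: "'a::{field,finite} \<Rightarrow> 'v::ab_group_add \<Rightarrow> 'v"
  assumes "finite_dimensional_vector_space scale Basis"
  shows "finite (UNIV :: 'v set)"
proof -
  interpret fd: finite_dimensional_vector_space scale Basis by (rule assms)
  \<comment> \<open>The zero subspace serves as \<open>Y\<close>, because finiteness of the whole
    space is what is being proved.\<close>
  interpret zero: finite_space scale "{0}"
    by unfold_locales (simp_all add: fd.subspace_single_0)
  show ?thesis using zero.finite_span[OF fd.finite_Basis] fd.span_Basis by simp
qed

lemma inv_KL_poly_charts:
  fixes scale :: "'a::{field,finite} \<Rightarrow> 'v::ab_group_add \<Rightarrow> 'v"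
    and Basis W :: "'v set" and X L :: "nat \<Rightarrow> 'v set" and w :: "nat \<Rightarrow> 'v" and h :: nat
    and C :: "nat \<Rightarrow> 'v set set"
  assumes V: "finite_dimensional_vector_space scale Basis"
    and decomposition: "direct_sum scale (insert None (Some ` {0..h})) (case_option W X)"
    and L: "\<And>i. i \<in> {1..h} \<Longrightarrow> module.subspace scale (L i) \<and> L i \<subseteq> W"
    and w: "\<And>i. i \<in> {1..h} \<Longrightarrow> w i \<in> W - L i"
    and C: "\<And>i. C i = {module.span scale {w i + y + x} | y x. y \<in> L i \<and> x \<in> X i}"
    and N_spans: "proj_span scale (proj_points scale UNIV - proj_points scale W - (\<Union>i\<in>{1..h}. C i)) = UNIV"
    and q: "\<And>J. q J = inv_KL_poly (proj_matroid scale (proj_points scale UNIV - proj_points scale W - (\<Union>i\<in>J. C i)))"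
    and T: "\<And>i j. T i j =
        smult ((2 ^ vector_space.dim scale (X i) - 1) * (2 ^ vector_space.dim scale (X j) - 1))
          (\<Sum>b | b \<le> vector_space.dim scale (L i \<inter> L j) \<and> even b.
             monom (int (gauss_binomial 2 (vector_space.dim scale (L i \<inter> L j)) b) *
                 2 ^ (vector_space.dim scale (L i) + vector_space.dim scale (L j) - 2 * b) *
                 tau (binary_affine_geometry b) *
                 u_coeff (vector_space.dim scale (UNIV :: 'v set) - b - 2))
               ((b + 2) div 2))"
    and J: "J \<subseteq> {1..h}"
  shows "q J = q {} + (\<Sum>k\<in>J. q {k} - q {})
    - (if CARD('a) = 2 then \<Sum>(i, j)\<in>{(i, j). i \<in> J \<and> j \<in> J \<and> i < j}. T i j else 0)"
proof -
  interpret vector_space scale using V by (rule finite_dimensional_vector_space.axioms(1))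
  interpret finite_space scale UNIV
    using finite_finite_dimensional[OF V] by unfold_locales (simp_all add: subspace_UNIV)
  let ?I = "insert None (Some ` {0..h})" and ?I' = "{1..h}"
  have finI: "finite ?I" by simp
  have inI: "i \<in> ?I' \<Longrightarrow> Some i \<in> ?I" for i by auto
  have subW: "subspace W" and subX: "i \<in> ?I' \<Longrightarrow> subspace (X i)" for i
    using decomposition unfolding direct_sum_def by (force split: option.split)+
  have "\<exists>p. (\<forall>x y. p (x + y) = p x + p y) \<and> (\<forall>x\<in>X i. p x = x) \<and> (\<forall>x\<in>W. p x = 0) \<and>
      (\<forall>j\<in>?I'. j \<noteq> i \<longrightarrow> (\<forall>x\<in>X j. p x = 0))" if i: "i \<in> ?I'" for i
  proof -
    obtain p where p: "\<And>x y. p (x + y) = p x + p y" "\<And>x. x \<in> case_option W X (Some i) \<Longrightarrow> p x = x"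
      "\<And>j x. j \<in> ?I \<Longrightarrow> j \<noteq> Some i \<Longrightarrow> x \<in> case_option W X j \<Longrightarrow> p x = 0"
      using direct_sum_component[OF finI inI[OF i] decomposition] by blast
    have "p x = 0" if "x \<in> W" for x using p(3)[of None x] that by simp
    moreover have "p x = 0" if "j \<in> ?I'" "j \<noteq> i" "x \<in> X j" for j x
      using p(3)[of "Some j" x] that by auto
    ultimately show ?thesis using p(1,2) by (intro exI[of _ p]) auto
  qed
  then have "\<forall>i\<in>?I'. \<exists>p. (\<forall>x y. p (x + y) = p x + p y) \<and> (\<forall>x\<in>X i. p x = x) \<and> (\<forall>x\<in>W. p x = 0) \<and>
      (\<forall>j\<in>?I'. j \<noteq> i \<longrightarrow> (\<forall>x\<in>X j. p x = 0))" by (rule ballI)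
  from bchoice[OF this] obtain p where p: "\<forall>i\<in>?I'. (\<forall>x y. p i (x + y) = p i x + p i y) \<and>
      (\<forall>x\<in>X i. p i x = x) \<and> (\<forall>x\<in>W. p i x = 0) \<and> (\<forall>j\<in>?I'. j \<noteq> i \<longrightarrow> (\<forall>x\<in>X j. p i x = 0))" ..
  have p_add: "p i (x + y) = p i x + p i y" and p_X: "x \<in> X i \<Longrightarrow> p i x = x"
    and p_W: "x \<in> W \<Longrightarrow> p i x = 0" and p_other: "j \<in> ?I' \<Longrightarrow> j \<noteq> i \<Longrightarrow> x \<in> X j \<Longrightarrow> p i x = 0"
    if "i \<in> ?I'" for i j x y
    using bspec[OF p that] by blast+
  define Vi where "Vi i = {x + y |x y. x \<in> W \<and> y \<in> X i}" for i
  define E where "E i = {x + y |x y. x \<in> L i \<and> y \<in> X i}" for i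
  define D where "D i = span (insert (w i) (E i))" for i
  have zero_mem: "0 \<in> W" "i \<in> ?I' \<Longrightarrow> 0 \<in> X i" "i \<in> ?I' \<Longrightarrow> 0 \<in> L i" for i
    using subW subX L subspace_0 by auto
  have W: "W \<in> Sub" using subW by (simp add: Sub_def)
  have ES: "E i \<in> Sub" and VS: "Vi i \<in> Sub" and XS: "X i \<in> Sub" and LS: "L i \<in> Sub" if "i \<in> ?I'" for i
    using that subX L subW unfolding E_def Vi_def Sub_def by (auto intro!: subspace_sums)
  have WV: "W \<subseteq> Vi i" and XE: "X i \<subseteq> E i" and LE: "L i \<subseteq> E i" if i: "i \<in> ?I'" for i
  proof -
    show "W \<subseteq> Vi i"
    proof
      fix x assume "x \<in> W"
      then have "x + 0 \<in> Vi i" using zero_mem(2)[OF i] unfolding Vi_def by blast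
      then show "x \<in> Vi i" by simp
    qed
    show "X i \<subseteq> E i"
    proof
      fix x assume "x \<in> X i"
      then have "0 + x \<in> E i" using zero_mem(3)[OF i] unfolding E_def by blast
      then show "x \<in> E i" by simp
    qed
    show "L i \<subseteq> E i"
    proof
      fix x assume "x \<in> L i"
      then have "x + 0 \<in> E i" using zero_mem(2)[OF i] unfolding E_def by blast
      then show "x \<in> E i" by simp
    qed
  qed
  have EV: "E i \<subseteq> Vi i" if "i \<in> ?I'" for i using L[OF that] by (auto simp: E_def Vi_def)
  have WE: "W \<inter> E i = L i" if i: "i \<in> ?I'" for i
  proof
    show "W \<inter> E i \<subseteq> L i"
    proof
      fix v assume v: "v \<in> W \<inter> E i"
      then obtain x y where xy: "v = x + y" "x \<in> L i" "y \<in> X i" by (auto simp: E_def)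
      then have "p i v = y" using p_add[OF i] p_X[OF i] p_W[OF i] L[OF i] by auto
      then show "v \<in> L i" using p_W[OF i, of v] v xy by simp
    qed
    show "L i \<subseteq> W \<inter> E i" using LE L i by blast
  qed
  have wE: "w i \<notin> E i" "w i \<in> W" if "i \<in> ?I'" for i using w[OF that] WE[OF that] by blast+
  have DS: "D i \<in> Sub" for i unfolding D_def by (rule span_in_Sub) simp
  have DV: "D i \<subseteq> Vi i" if "i \<in> ?I'" for i
    unfolding D_def using WV[OF that] EV[OF that] wE(2)[OF that] by (intro span_le_Sub[OF VS[OF that]]) auto
  have ED: "E i \<subseteq> D i" and wD: "w i \<in> D i" for i unfolding D_def by (auto intro: span_base)
  have dimD: "dim (D i) = Suc (dim (E i))" if "i \<in> ?I'" for i
    unfolding D_def using dim_insert_Sub[OF ES[OF that] wE(1)[OF that]] by simp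
  have dimE: "dim (E i) = dim (L i) + dim (X i)" if i: "i \<in> ?I'" for i
  proof -
    have "E i = (\<lambda>(x, y). x + y) ` (L i \<times> X i)" by (auto simp: E_def)
    moreover have "inj_on (\<lambda>(x, y). x + y) (L i \<times> X i)"
    proof (intro inj_onI; clarify)
      fix x y x' y' assume xy: "x \<in> L i" "y \<in> X i" "x' \<in> L i" "y' \<in> X i" and eq: "x + y = x' + y'"
      have "p i (x + y) = y" "p i (x' + y') = y'"
        using p_add[OF i] p_X[OF i] p_W[OF i] L[OF i] xy by auto
      then show "x = x' \<and> y = y'" using eq by auto
    qed
    ultimately have "card (E i) = card (L i) * card (X i)"
      by (simp add: card_image card_cartesian_product)
    then have "CARD('a) ^ dim (E i) = CARD('a) ^ (dim (L i) + dim (X i))"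
      by (simp add: card_Sub ES[OF i] LS[OF i] XS[OF i] power_add)
    then show ?thesis using CARD_ge_2 by simp
  qed
  have p_V: "p k v = 0" if "i \<in> ?I'" "k \<in> ?I'" "k \<noteq> i" "v \<in> Vi i" for i k v
    using that p_add p_W p_other by (auto simp: Vi_def)
  have p_V_nz: "p i v \<noteq> 0" if iv: "i \<in> ?I'" "v \<in> Vi i - W" for i v
  proof
    assume z: "p i v = 0"
    obtain x y where xy: "v = x + y" "x \<in> W" "y \<in> X i" using iv by (auto simp: Vi_def)
    then have "p i v = y" using p_add p_X p_W iv by auto
    then show False using z xy iv by auto
  qed
  interpret ch: charts scale UNIV ?I' W Vi D E
  proof unfold_locales
    \<comment> \<open>One of i and j differs from k; the projection to its X is nonzero on a + b but
      kills V k.\<close>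
    fix i j k a b assume "i \<in> ?I'" "j \<in> ?I'" "k \<in> ?I'" "i \<noteq> j" "a \<in> Vi i - W" "b \<in> Vi j - W"
    then show "a + b \<notin> Vi k"
      using p_V_nz[of i a] p_V_nz[of j b] p_V[of i j a] p_V[of j i b] p_V[of k i "a + b"]
        p_V[of k j "a + b"] p_add by (cases "k = i") auto
  next
    fix i j k n a b c assume *: "i \<in> ?I'" "j \<in> ?I'" "k \<in> ?I'" "n \<in> ?I'" "i \<noteq> j" "i \<noteq> k" "j \<noteq> k"
      "a \<in> Vi i - W" "b \<in> Vi j - W" "c \<in> Vi k - W"
    have "p i (a + b + c) = p i a" "p j (a + b + c) = p j b"
      using * p_V[of j i b] p_V[of k i c] p_V[of i j a] p_V[of k j c] p_add by auto
    then show "a + b + c \<notin> Vi n"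
      using p_V_nz[of i a] p_V_nz[of j b] p_V[of n i "a + b + c"] p_V[of n j "a + b + c"] * by (cases "n = i") auto
  qed (use W VS WV DS DV ES ED dimD in auto)
  have C_iff: "span {x} \<in> C i \<longleftrightarrow> x \<in> ch.chart i" if i: "i \<in> ?I'" and x: "x \<noteq> 0" for i x
  proof
    assume "span {x} \<in> C i"
    then obtain y z where yz: "y \<in> L i" "z \<in> X i" "span {x} = span {w i + y + z}" by (auto simp: C)
    then obtain k where k: "k \<noteq> 0" "x = scale k (w i + (y + z))"
      using span_singleton_eq_iff[OF x] by (auto simp: add.assoc)
    have yzE: "y + z \<in> E i" using yz by (auto simp: E_def)
    then have "w i + (y + z) \<in> D i" "w i + (y + z) \<notin> E i"
      using ch.Sub_add[OF DS wD] ED ch.Sub_add_cancel[OF ES[OF i]] wE(1)[OF i] by blast+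
    then show "x \<in> ch.chart i"
      unfolding ch.chart_def k(2) using ch.Sub_scale[OF DS] ch.Sub_scale_cancel[OF ES[OF i] k(1)] by blast
  next
    assume "x \<in> ch.chart i"
    then have xD: "x \<in> D i" "x \<notin> E i" by (auto simp: ch.chart_def)
    then obtain k where k: "x - scale k (w i) \<in> E i"
      unfolding D_def by (auto simp: span_breakdown_eq span_Sub[OF ES[OF i]])
    then have "k \<noteq> 0" using xD by auto
    have "scale (1 / k) (x - scale k (w i)) \<in> E i" using k by (intro ch.Sub_scale ES i)
    then obtain y z where yz: "y \<in> L i" "z \<in> X i" "scale (1 / k) (x - scale k (w i)) = y + z"
      by (auto simp: E_def)
    then have "scale k (y + z) = x - scale k (w i)" using \<open>k \<noteq> 0\<close> by (metis scale_scale nonzero_mult_div_cancel_left mult.commute mult.left_neutral scale_one times_divide_eq_right)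
    then have "x = scale k (w i + y + z)" by (simp add: scale_right_distrib algebra_simps)
    then have "span {x} = span {w i + y + z}"
      using span_singleton_eq_iff[OF x] \<open>k \<noteq> 0\<close> by blast
    then show "span {x} \<in> C i" using yz unfolding C by blast
  qed
  have main: "q J = q {} + (\<Sum>k\<in>J. q {k} - q {}) - (\<Sum>s\<in>ch.pairs J. \<Sum>F\<in>Sub.
      smult ((- 1) ^ dim F * int (CARD('a)) ^ ((dim (UNIV :: 'v set) - dim F) choose 2))
        (ch.pair_term (\<lambda>b. tau (binary_affine_geometry b)) s F))"
    using ch.inv_KL_poly_complement_charts[OF refl C_iff N_spans J] unfolding q .
  show ?thesis
  proof (cases "CARD('a) = 2")
    case True
    have "(\<Sum>F\<in>Sub. smult ((- 1) ^ dim F * int (CARD('a)) ^ ((dim (UNIV :: 'v set) - dim F) choose 2))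
        (ch.pair_term (\<lambda>b. tau (binary_affine_geometry b)) s F)) = T (fst s) (snd s)" if "s \<in> ch.pairs J" for s
    proof -
      obtain i j where s: "s = (i, j)" by (cases s)
      then have ij: "i \<in> ?I'" "j \<in> ?I'" "i \<noteq> j" using that J by (auto simp: ch.pairs_def)
      have nsub: "\<not> D i \<inter> W \<subseteq> E i" "\<not> D j \<inter> W \<subseteq> E j" using wD wE ij by blast+
      have WEE: "W \<inter> E i \<inter> E j = L i \<inter> L j" using WE ij by blast
      have dimL: "dim (W \<inter> E i) = dim (L i)" "dim (W \<inter> E j) = dim (L j)" using WE ij by simp_all
      show ?thesis
        unfolding s fst_conv snd_conv T
        by (rule ch.sum_pair_term[OF ij True nsub dimL(1) dimE[OF ij(1)] dimL(2) dimE[OF ij(2)], unfolded WEE])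
    qed
    then have "(\<Sum>s\<in>ch.pairs J. \<Sum>F\<in>Sub.
      smult ((- 1) ^ dim F * int (CARD('a)) ^ ((dim (UNIV :: 'v set) - dim F) choose 2))
        (ch.pair_term (\<lambda>b. tau (binary_affine_geometry b)) s F)) = (\<Sum>s\<in>ch.pairs J. T (fst s) (snd s))"
      by (rule sum.cong[OF refl])
    then show ?thesis unfolding main using True by (simp add: ch.pairs_def case_prod_beta)
  next
    case False
    then have "ch.pair_term t s F = 0" for t s F by (simp add: ch.pair_term_def ch.pair_def)
    then show ?thesis unfolding main using False by simp
  qed
qed

text \<open>The absence of interactions among three or more charts is stated as the vanishing of
  alternating sums over the subsets of such a family. This is why the preceding results are proved
  for every set J of charts, not just for the full one.\<close>

theorem theoremB:
  fixes scale :: "'a::{field,finite} \<Rightarrow> 'v::ab_group_add \<Rightarrow> 'v"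
    and Basis W :: "'v set"
    and X L :: "nat \<Rightarrow> 'v set"
    and w :: "nat \<Rightarrow> 'v"
    and q h R :: nat
    and m l :: "nat \<Rightarrow> nat"
    and c :: "nat \<Rightarrow> nat \<Rightarrow> nat"
    and B N :: "'v set set"
    and C Ni :: "nat \<Rightarrow> 'v set set"
    and Q :: "'v set set \<Rightarrow> int poly"
    and T :: "nat \<Rightarrow> nat \<Rightarrow> int poly"
  assumes q: "q = CARD('a)"
    and V: "finite_dimensional_vector_space scale Basis"
    and R: "R = vector_space.dim scale (UNIV :: 'v set)"
    and h: "h \<ge> 1"
    and decomposition: "direct_sum scale (insert None (Some ` {0..h})) (case_option W X)"
    and m: "\<And>i. m i = vector_space.dim scale (X i)"
    and m_pos: "\<And>i. i \<in> {1..h} \<Longrightarrow> m i > 0"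
    and L: "\<And>i. i \<in> {1..h} \<Longrightarrow> module.subspace scale (L i) \<and> L i \<subseteq> W"
    and w: "\<And>i. i \<in> {1..h} \<Longrightarrow> w i \<in> W - L i"
    and l: "\<And>i. l i = vector_space.dim scale (L i)"
    and C: "\<And>i. C i = {module.span scale {w i + y + x} | y x. y \<in> L i \<and> x \<in> X i}"
    and B: "B = proj_points scale UNIV - proj_points scale W"
    and Ni: "\<And>i. Ni i = B - C i"
    and N: "N = B - (\<Union>i\<in>{1..h}. C i)"
    and N_spans: "proj_span scale N = UNIV"
    and c: "\<And>i j. c i j = vector_space.dim scale (L i \<inter> L j)"
    and Q: "\<And>E. Q E = inv_KL_poly (proj_matroid scale E)"
    and T: "\<And>i j. T i j =
        smult ((2 ^ m i - 1) * (2 ^ m j - 1))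
          (\<Sum>b | b \<le> c i j \<and> even b.
             monom (int (gauss_binomial 2 (c i j) b) * 2 ^ (l i + l j - 2 * b) *
                 tau (binary_affine_geometry b) * u_coeff (R - b - 2))
               ((b + 2) div 2))"
  shows
    "(q > 2 \<longrightarrow> Q N = (\<Sum>i=1..h. Q (Ni i)) - (of_nat h - 1) * Q B) \<and>
     (q = 2 \<longrightarrow>
        Q N = (\<Sum>i=1..h. Q (Ni i)) - (of_nat h - 1) * Q B
              - (\<Sum>(i, j) | 1 \<le> i \<and> i < j \<and> j \<le> h. T i j) \<and>
        (\<forall>S\<subseteq>{1..h}. card S \<ge> 3 \<longrightarrow>
           (\<Sum>S'\<in>Pow S. (- 1) ^ (card S - card S') * Q (B - (\<Union>i\<in>S'. C i))) = 0) \<and>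
        (\<forall>i j. 1 \<le> i \<and> i < j \<and> j \<le> h \<longrightarrow> degree (T i j) \<le> 1 + c i j div 2))"
proof -
  let ?N = "\<lambda>J. B - (\<Union>i\<in>J. C i)"
  let ?P = "\<lambda>J. {(i, j). i \<in> J \<and> j \<in> J \<and> i < j}"
  have main: "Q (?N J) = Q B + (\<Sum>k\<in>J. Q (Ni k) - Q B)
      - (if q = 2 then \<Sum>(i, j)\<in>?P J. T i j else 0)" if J: "J \<subseteq> {1..h}" for J
  proof -
    have "T i j = smult ((2 ^ vector_space.dim scale (X i) - 1) * (2 ^ vector_space.dim scale (X j) - 1))
          (\<Sum>b | b \<le> vector_space.dim scale (L i \<inter> L j) \<and> even b.
             monom (int (gauss_binomial 2 (vector_space.dim scale (L i \<inter> L j)) b) *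
                 2 ^ (vector_space.dim scale (L i) + vector_space.dim scale (L j) - 2 * b) *
                 tau (binary_affine_geometry b) *
                 u_coeff (vector_space.dim scale (UNIV :: 'v set) - b - 2))
               ((b + 2) div 2))" for i j
      unfolding T m l c R ..
    from inv_KL_poly_charts[OF V decomposition L w C N_spans[unfolded N B] refl this J]
    show ?thesis by (simp add: Q B Ni q)
  qed
  have N_eq: "Q N = Q B + (\<Sum>k=1..h. Q (Ni k) - Q B) - (if q = 2 then \<Sum>(i, j)\<in>?P {1..h}. T i j else 0)"
    unfolding N by (rule main) simp
  have single: "Q B + (\<Sum>k=1..h. Q (Ni k) - Q B) = (\<Sum>k=1..h. Q (Ni k)) - (of_nat h - 1) * Q B"
    by (simp add: sum_subtractf algebra_simps)
  show ?thesis
  proof (intro conjI impI allI)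
    assume "q > 2"
    then show "Q N = (\<Sum>i=1..h. Q (Ni i)) - (of_nat h - 1) * Q B"
      using N_eq single by simp
  next
    assume "q = 2"
    moreover have "?P {1..h} = {(i, j). 1 \<le> i \<and> i < j \<and> j \<le> h}" by auto
    ultimately show "Q N = (\<Sum>i=1..h. Q (Ni i)) - (of_nat h - 1) * Q B
        - (\<Sum>(i, j) | 1 \<le> i \<and> i < j \<and> j \<le> h. T i j)"
      using N_eq single by simp
  next
    fix S assume q2: "q = 2" and S: "S \<subseteq> {1..h}" "3 \<le> card S"
    have "Q (?N S') = Q B + (\<Sum>k\<in>S'. Q (Ni k) - Q B) - (\<Sum>(i, j)\<in>?P S'. T i j)"
      if "S' \<subseteq> S" for S'
      using main[of S'] that S(1) q2 by simp
    with finite_subset[OF S(1)] S(2)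
    show "(\<Sum>S'\<in>Pow S. (- 1) ^ (card S - card S') * Q (?N S')) = 0"
      by (intro alternating_sum_quadratic) auto
  next
    fix i j
    show "degree (T i j) \<le> 1 + c i j div 2"
      unfolding T
    proof (intro order_trans[OF degree_smult_le] degree_sum_le)
      show "finite {b. b \<le> c i j \<and> even b}" by simp
      fix b assume "b \<in> {b. b \<le> c i j \<and> even b}"
      then have "(b + 2) div 2 \<le> 1 + c i j div 2" by (simp add: div_le_mono)
      then show "degree (monom (int (gauss_binomial 2 (c i j) b) * 2 ^ (l i + l j - 2 * b) *
          tau (binary_affine_geometry b) * u_coeff (R - b - 2)) ((b + 2) div 2)) \<le> 1 + c i j div 2"
        using degree_monom_le order_trans by blast
    qed
  qed
qed

end
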